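(* Let the volumetric energy term be the Noble–Abel stiffened-gas equation of state $$e_{\mathrm s}(\rho,\eta)=c_{\mathrm V}\,\theta_{\mathrm{ref}}\Big(\frac{\rho}{\rho_{\mathrm{ref}}}\,\frac{1}{1-b\rho}\Big)^{\gamma-1}e^{\eta/c_{\mathrm V}}+\Big(\frac1\rho-b\Big)p_\infty+q,$$ where $\gamma>1$, $c_{\mathrm V},\theta_{\mathrm{ref}},\rho_{\mathrm{ref}}>0$, and $b>0$, $q$, $p_\infty$ are constant material parameters, with $\rho^{-1}\in(b,+\infty)$. Then the scalar quantity $\rho\widetilde E$, where $$\widetilde E:=\tfrac12|\mathbf v|^2+\widetilde{e_{\mathrm s}}(\rho,\eta,\mathbf F,\mathbf Y,y)+\tfrac{\tau_0}{2\kappa}|\mathbf j|^2+\tfrac{\alpha}{2}K_0\operatorname{tr}\big(\mathbf F\mathbf Y^{-1/2}\mathbf F^{\top}\big)+\tfrac{e_{\mathrm{ref}}}{2}|\mathbf Y|^2,$$ $$\widetilde{e_{\mathrm s}}(\rho,\eta,\mathbf F,\mathbf Y,y):=e_{\mathrm s}\Big(\rho,\ \eta+\tfrac{\alpha}{2}\Big(K_1\operatorname{tr}\big(\mathbf F\mathbf Y^{-1/2}\mathbf F^{\top}\big)-k_{\mathrm B}\log\Big(\big(\tfrac{\rho_{\mathrm R}}{\rho}\big)^2y^{1/2}\Big)\Big)\Big),$$ is a mathematical entropy of the system of balance laws (S) given in the context, for the unknown $\mathbf u=(\rho,\rho\eta,\rho\mathbf j,\rho\mathbf v,\rho\mathbf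 F,\rho\mathbf Y,\rho y)$.
   Context: Unknown fields on $\mathbb R^3\times[0,\infty)$: density $\rho>0$ (with $\rho<1/b$), specific entropy $\eta\in\mathbb R$, energy flux $\mathbf j\in\mathbb R^3$, velocity $\mathbf v\in\mathbb R^3$, deformation gradient $\mathbf F\in\mathbb R^{3\times3}$ (invertible), symmetric positive-definite $\mathbf Y\in\mathbb R^{3\times3}$, scalar $y>0$ (standing for $\det\mathbf Y^{-1}$ but treated as an independent variable). The numbers $\alpha,K_0,K_1,k_{\mathrm B},\tau_0,\kappa,\rho_{\mathrm R},e_{\mathrm{ref}}$ are positive constants; $\zeta>0$ is a drag coefficient, possibly a smooth function of the temperature; $\mathbf f$ is the specific body force, entering as part of source terms regarded as smooth functions of $\mathbf u$. $|\cdot|$ is the Euclidean or Frobenius norm, $\mathbf I$ the identity. Derived quantities, as functions of the unknowns: $\mathbf C:=\mathbf F\mathbf Y^{-1/2}\mathbf F^\top$; $\hat\eta:=\eta+\frac{\alpha}{2}\big(K_1\operatorname{tr}\mathbf C-k_{\mathrm B}\log((\rho_{\mathrm R}/\rho)^2y^{1/2})\big)$; temperature $\theta:=\frac{\partial e_{\mathrm s}}{\partial\eta}(\rho,\hat\eta)$; pressure $p:=\rho^2\frac{\partial e_{\mathrm s}}{\partial\rho}(\rho,\hat\eta)$; $K(\theta):=K_0+K_1\theta$; Cauchy stress $\mathbf T:=-p\,\mathbf I+\alpha\rho\,(K(\theta)\mathbf C-k_{\mathrm B}\theta\,\mathbf I)$; entropy production $\xi:=\frac{|\mathbf j|^2}{\kappa\theta^2}+\frac{2\alpha\rho}{\zeta\theta}\big|K(\theta)\mathbf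 C^{1/2}-k_{\mathrm B}\theta\,\mathbf C^{-1/2}\big|^2$; with $\mathbf G:=\mathbf F^{-1}\mathbf F^{-\top}$, $$\mathfrak f:=\frac{8K(\theta)}{\zeta}\mathbf Y-\frac{4k_{\mathrm B}\theta}{\zeta}\mathbf Y\big(\mathbf G\mathbf Y^{-1/2}+\mathbf Y^{-1/2}\mathbf G\big)\mathbf Y,$$ $$h:=\frac{4}{\zeta}\,y\,\operatorname{tr}\Big(k_{\mathrm B}\theta\big(\mathbf G\mathbf Y^{-1/2}+\mathbf Y^{-1/2}\mathbf G\big)\mathbf Y-2K(\theta)\mathbf I\Big).$$ System (S) (divergence taken with respect to the last index): $$\partial_t\rho+\operatorname{div}(\rho\mathbf v)=0,\qquad \partial_t(\rho\eta)+\operatorname{div}\big(\rho\eta\mathbf v+\mathbf j/\theta\big)=\xi,$$ $$\partial_t(\rho\mathbf j)+\operatorname{div}\Big(\rho\,\mathbf j\otimes\mathbf v+\frac{\kappa\log\theta}{\tau_0}\mathbf I\Big)=-\frac{\mathbf j}{\tau_0\theta},\qquad \partial_t(\rho\mathbf v)+\operatorname{div}(\rho\,\mathbf v\otimes\mathbf v-\mathbf T)=\rho\mathbf f,$$ $$\partial_t(\rho F^i_\alpha)+\sum_k\partial_{x^k}\big(\rho(F^i_\alpha v^k-v^iF^k_\alpha)\big)=0,\qquad \partial_t(\rho\mathbf Y)+\operatorname{div}(\rho\,\mathbf Y\otimes\mathbf v)=\rho\,\mathfrak f,\qquad \partial_t(\rho y)+\operatorname{div}(\rho y\mathbf v)=\rho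 h.$$ Standing assumptions under which the conservation law for $\rho\mathbf F$ is written: the material is homogeneous, $\rho\det\mathbf F=\rho_{\mathrm R}$ is constant, and the Piola identity $\operatorname{div}(\mathbf F^\top/\det\mathbf F)=0$ (i.e. $\sum_i\partial_{x^i}(F^i_\alpha/\det\mathbf F)=0$ for each $\alpha$) holds. A scalar function $s(\mathbf u)$ is a mathematical entropy of a system of balance laws $\partial_t\mathbf u+\sum_j\partial_{x^j}\mathbf f^j(\mathbf u)=\mathbf c(\mathbf u)$ if $s$ is smooth and strictly convex in $\mathbf u$ and if the system implies (for smooth solutions) an additional balance law $\partial_ts(\mathbf u)+\sum_j\partial_{x^j}F^j(\mathbf u)=b_0(\mathbf u)$ with smooth functions $F^j,b_0$. *)

theory Defs
  imports "HOL-Analysis.Analysis"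
begin

section \<open>Smooth functions and strict convexity\<close>

primrec Ck_on :: "nat \<Rightarrow> 'a::real_normed_vector set \<Rightarrow> ('a \<Rightarrow> 'b::real_normed_vector) \<Rightarrow> bool" where
  "Ck_on 0 U f \<longleftrightarrow> continuous_on U f"
| "Ck_on (Suc n) U f \<longleftrightarrow>
     (\<forall>x\<in>U. f differentiable (at x)) \<and> (\<forall>v. Ck_on n U (\<lambda>x. frechet_derivative f (at x) v))"

text \<open>Smoothness on a set that need not be open means that there is a smooth extension to an open
  neighbourhood. The two uses for non-open sets are: states whose matrix \<open>Y\<close> ranges over the
  linear subspace of symmetric matrices, and space-time regions touching the initial time \<open>t = 0\<close>.\<close>

definition smooth_on :: "'a::real_normed_vector set \<Rightarrow> ('a \<Rightarrow> 'b::real_normed_vector) \<Rightarrow> bool" where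
  "smooth_on S f \<longleftrightarrow>
     (\<exists>U g. open U \<and> S \<subseteq> U \<and> (\<forall>n. Ck_on n U g) \<and> (\<forall>x\<in>S. g x = f x))"

definition strictly_convex_on :: "'a::real_vector set \<Rightarrow> ('a \<Rightarrow> real) \<Rightarrow> bool" where
  "strictly_convex_on S f \<longleftrightarrow> convex S \<and>
     (\<forall>x\<in>S. \<forall>y\<in>S. \<forall>t. x \<noteq> y \<longrightarrow> 0 < t \<longrightarrow> t < 1 \<longrightarrow>
        f ((1 - t) *\<^sub>R x + t *\<^sub>R y) < (1 - t) * f x + t * f y)"


section \<open>Systems of balance laws in three space dimensions\<close>

type_synonym vec3 = "real ^ 3"
type_synonym mat3 = "real ^ 3 ^ 3"
type_synonym spacetime = "real \<times> vec3"

definition space_time :: "spacetime set" where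
  "space_time = {0..} \<times> UNIV"

text \<open>The time derivative is one-sided at \<open>t = 0\<close>.\<close>

definition dt :: "(spacetime \<Rightarrow> 'b::real_normed_vector) \<Rightarrow> spacetime \<Rightarrow> 'b" where
  "dt g p = vector_derivative (\<lambda>s. g (s, snd p)) (at (fst p) within {0..})"

definition dx :: "3 \<Rightarrow> (spacetime \<Rightarrow> 'b::real_normed_vector) \<Rightarrow> spacetime \<Rightarrow> 'b" where
  "dx k g p = vector_derivative (\<lambda>h. g (fst p, snd p + h *\<^sub>R axis k 1)) (at 0)"

text \<open>Smooth solutions may be global, local in time, or local in space-time: they live on a
  relatively open part \<open>D\<close> of \<open>[0,\<infinity>) \<times> \<real>\<^sup>3\<close>.\<close>

definition smooth_solution ::
  "'u::real_normed_vector set \<Rightarrow> (3 \<Rightarrow> 'u \<Rightarrow> 'u) \<Rightarrow> ('u \<Rightarrow> 'u) \<Rightarrow> spacetime set \<Rightarrow> (spacetime \<Rightarrow> 'u) \<Rightarrow> bool"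
where
  "smooth_solution \<Omega> flux src D u \<longleftrightarrow>
     openin (top_of_set space_time) D \<and> smooth_on D u \<and> u ` D \<subseteq> \<Omega> \<and>
     (\<forall>p\<in>D. dt u p + (\<Sum>k\<in>UNIV. dx k (\<lambda>q. flux k (u q)) p) = src (u p))"

text \<open>\<open>\<Omega>\<close> is the set of admissible states and \<open>side D u\<close> collects the standing assumptions on the
  solutions (involutions) under which the system is considered. As \<open>\<Omega>\<close> need not be convex
  (invertible matrices do not form a convex set), strict convexity of \<open>s\<close> is required on its
  convex hull; this contains every segment joining two states of \<open>\<Omega>\<close>.\<close>

definition mathematical_entropy ::
  "'u::real_normed_vector set \<Rightarrow> (3 \<Rightarrow> 'u \<Rightarrow> 'u) \<Rightarrow> ('u \<Rightarrow> 'u) \<Rightarrow>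
     (spacetime set \<Rightarrow> (spacetime \<Rightarrow> 'u) \<Rightarrow> bool) \<Rightarrow> ('u \<Rightarrow> real) \<Rightarrow> bool"
where
  "mathematical_entropy \<Omega> flux src side s \<longleftrightarrow>
     smooth_on \<Omega> s \<and> strictly_convex_on (convex hull \<Omega>) s \<and>
     (\<exists>(\<Phi> :: 3 \<Rightarrow> 'u \<Rightarrow> real) (b0 :: 'u \<Rightarrow> real).
        (\<forall>k. smooth_on \<Omega> (\<Phi> k)) \<and> smooth_on \<Omega> b0 \<and>
        (\<forall>D u. smooth_solution \<Omega> flux src D u \<longrightarrow> side D u \<longrightarrow>
           (\<forall>p\<in>D. dt (\<lambda>q. s (u q)) p + (\<Sum>k\<in>UNIV. dx k (\<lambda>q. \<Phi> k (u q)) p) = b0 (u p))))"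


section \<open>Symmetric positive definite matrices\<close>

definition spd :: "real ^ 'n ^ 'n \<Rightarrow> bool" where
  "spd A \<longleftrightarrow> transpose A = A \<and> (\<forall>x. x \<noteq> 0 \<longrightarrow> 0 < x \<bullet> (A *v x))"

definition sqrt_mat :: "real ^ 'n ^ 'n \<Rightarrow> real ^ 'n ^ 'n" where
  "sqrt_mat A = (THE B. spd B \<and> B ** B = A)"

definition inv_sqrt_mat :: "real ^ 'n ^ 'n \<Rightarrow> real ^ 'n ^ 'n" where
  "inv_sqrt_mat A = matrix_inv (sqrt_mat A)"


section \<open>Constitutive relations\<close>

text \<open>Material constants: \<open>alpha, K0, K1, kB, tau0, kappa, rhoR, eref\<close> of the viscoelastic
  heat-conducting model, and \<open>cV, theta_ref, rho_ref, gam\<close> (the exponent \<open>\<gamma>\<close>),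
  \<open>covol\<close> (the covolume \<open>b\<close>), \<open>pinf\<close>, \<open>qref\<close> (the energy shift \<open>q\<close>) of the Noble--Abel
  stiffened-gas equation of state.\<close>

record material =
  alpha :: real
  K0 :: real
  K1 :: real
  kB :: real
  tau0 :: real
  kappa :: real
  rhoR :: real
  eref :: real
  cV :: real
  theta_ref :: real
  rho_ref :: real
  gam :: real
  covol :: real
  pinf :: real
  qref :: real

definition e_s :: "material \<Rightarrow> real \<Rightarrow> real \<Rightarrow> real" where
  "e_s M \<rho> \<eta> =
     cV M * theta_ref M * (\<rho> / rho_ref M * (1 / (1 - covol M * \<rho>))) powr (gam M - 1) * exp (\<eta> / cV M)
     + (1 / \<rho> - covol M) * pinf M + qref M"

text \<open>Primitive variables are \<open>(\<rho>, \<eta>, j, v, F, Y, y)\<close>; conserved variables are the same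
  tuple with all components but the first multiplied by \<open>\<rho>\<close>. The entry \<open>F $ i $ a\<close> is
  \<open>F\<^sup>i\<^sub>a\<close>.\<close>

type_synonym state = "real \<times> real \<times> vec3 \<times> vec3 \<times> mat3 \<times> mat3 \<times> real"

fun conserved :: "state \<Rightarrow> state" where
  "conserved (\<rho>, \<eta>, j, v, F, Y, y) =
     (\<rho>, \<rho> * \<eta>, \<rho> *\<^sub>R j, \<rho> *\<^sub>R v, \<rho> *\<^sub>R F, \<rho> *\<^sub>R Y, \<rho> * y)"

fun primitive :: "state \<Rightarrow> state" where
  "primitive (\<rho>, m, J, P, A, B, z) =
     (\<rho>, m / \<rho>, J /\<^sub>R \<rho>, P /\<^sub>R \<rho>, A /\<^sub>R \<rho>, B /\<^sub>R \<rho>, z / \<rho>)"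

definition states :: "material \<Rightarrow> state set" where
  "states M = {conserved (\<rho>, \<eta>, j, v, F, Y, y) | \<rho> \<eta> j v F Y y.
     0 < \<rho> \<and> \<rho> < 1 / covol M \<and> invertible F \<and> spd Y \<and> 0 < y}"

definition C_mat :: "mat3 \<Rightarrow> mat3 \<Rightarrow> mat3" where
  "C_mat F Y = F ** inv_sqrt_mat Y ** transpose F"

definition G_mat :: "mat3 \<Rightarrow> mat3" where
  "G_mat F = matrix_inv F ** transpose (matrix_inv F)"

definition eta_hat :: "material \<Rightarrow> real \<Rightarrow> real \<Rightarrow> mat3 \<Rightarrow> mat3 \<Rightarrow> real \<Rightarrow> real" where
  "eta_hat M \<rho> \<eta> F Y y =
     \<eta> + alpha M / 2 * (K1 M * trace (C_mat F Y) - kB M * ln ((rhoR M / \<rho>)\<^sup>2 * y powr (1/2)))"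

definition temperature :: "material \<Rightarrow> real \<Rightarrow> real \<Rightarrow> mat3 \<Rightarrow> mat3 \<Rightarrow> real \<Rightarrow> real" where
  "temperature M \<rho> \<eta> F Y y = deriv (\<lambda>\<sigma>. e_s M \<rho> \<sigma>) (eta_hat M \<rho> \<eta> F Y y)"

definition pressure :: "material \<Rightarrow> real \<Rightarrow> real \<Rightarrow> mat3 \<Rightarrow> mat3 \<Rightarrow> real \<Rightarrow> real" where
  "pressure M \<rho> \<eta> F Y y = \<rho>\<^sup>2 * deriv (\<lambda>r. e_s M r (eta_hat M \<rho> \<eta> F Y y)) \<rho>"

definition K_of :: "material \<Rightarrow> real \<Rightarrow> real" where
  "K_of M \<theta> = K0 M + K1 M * \<theta>"

definition cauchy_stress :: "material \<Rightarrow> real \<Rightarrow> real \<Rightarrow> mat3 \<Rightarrow> mat3 \<Rightarrow> real \<Rightarrow> mat3" where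
  "cauchy_stress M \<rho> \<eta> F Y y =
     (let \<theta> = temperature M \<rho> \<eta> F Y y in
        - (pressure M \<rho> \<eta> F Y y *\<^sub>R mat 1)
        + (alpha M * \<rho>) *\<^sub>R (K_of M \<theta> *\<^sub>R C_mat F Y - (kB M * \<theta>) *\<^sub>R mat 1))"

text \<open>Below, \<open>zeta\<close> is the drag coefficient as a function of the temperature.\<close>

definition entropy_production ::
  "material \<Rightarrow> (real \<Rightarrow> real) \<Rightarrow> real \<Rightarrow> real \<Rightarrow> vec3 \<Rightarrow> mat3 \<Rightarrow> mat3 \<Rightarrow> real \<Rightarrow> real" where
  "entropy_production M zeta \<rho> \<eta> j F Y y =
     (let \<theta> = temperature M \<rho> \<eta> F Y y; C = C_mat F Y in
        (norm j)\<^sup>2 / (kappa M * \<theta>\<^sup>2)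
        + 2 * alpha M * \<rho> / (zeta \<theta> * \<theta>)
          * (norm (K_of M \<theta> *\<^sub>R sqrt_mat C - (kB M * \<theta>) *\<^sub>R inv_sqrt_mat C))\<^sup>2)"

definition relaxation_Y :: "material \<Rightarrow> (real \<Rightarrow> real) \<Rightarrow> real \<Rightarrow> mat3 \<Rightarrow> mat3 \<Rightarrow> mat3" where
  "relaxation_Y M zeta \<theta> F Y =
     (8 * K_of M \<theta> / zeta \<theta>) *\<^sub>R Y
     - (4 * kB M * \<theta> / zeta \<theta>) *\<^sub>R
         (Y ** (G_mat F ** inv_sqrt_mat Y + inv_sqrt_mat Y ** G_mat F) ** Y)"

definition relaxation_y :: "material \<Rightarrow> (real \<Rightarrow> real) \<Rightarrow> real \<Rightarrow> mat3 \<Rightarrow> mat3 \<Rightarrow> real \<Rightarrow> real" where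
  "relaxation_y M zeta \<theta> F Y y =
     4 / zeta \<theta> * y *
       trace ((kB M * \<theta>) *\<^sub>R ((G_mat F ** inv_sqrt_mat Y + inv_sqrt_mat Y ** G_mat F) ** Y)
              - (2 * K_of M \<theta>) *\<^sub>R mat 1)"


section \<open>The system and its energy\<close>

text \<open>Both functions take conserved variables. Row \<open>i\<close>, column \<open>a\<close> of the flux of \<open>\<rho>F\<close> in direction
  \<open>k\<close> is \<open>\<rho> (F\<^sup>i\<^sub>a v\<^sup>k - v\<^sup>i F\<^sup>k\<^sub>a)\<close>.\<close>

definition system_flux :: "material \<Rightarrow> 3 \<Rightarrow> state \<Rightarrow> state" where
  "system_flux M k u =
     (case primitive u of (\<rho>, \<eta>, j, v, F, Y, y) \<Rightarrow>
        let \<theta> = temperature M \<rho> \<eta> F Y y; T = cauchy_stress M \<rho> \<eta> F Y y in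
        (\<rho> * v $ k,
         \<rho> * \<eta> * v $ k + j $ k / \<theta>,
         (\<rho> * v $ k) *\<^sub>R j + (kappa M * ln \<theta> / tau0 M) *\<^sub>R axis k 1,
         (\<rho> * v $ k) *\<^sub>R v - column k T,
         (\<chi> i a. \<rho> * (F $ i $ a * v $ k - v $ i * F $ k $ a)),
         (\<rho> * v $ k) *\<^sub>R Y,
         \<rho> * y * v $ k))"

definition system_source ::
  "material \<Rightarrow> (real \<Rightarrow> real) \<Rightarrow> (state \<Rightarrow> vec3) \<Rightarrow> state \<Rightarrow> state" where
  "system_source M zeta force u =
     (case primitive u of (\<rho>, \<eta>, j, v, F, Y, y) \<Rightarrow>
        let \<theta> = temperature M \<rho> \<eta> F Y y in
        (0,
         entropy_production M zeta \<rho> \<eta> j F Y y,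
         - (j /\<^sub>R (tau0 M * \<theta>)),
         \<rho> *\<^sub>R force u,
         0,
         \<rho> *\<^sub>R relaxation_Y M zeta \<theta> F Y,
         \<rho> * relaxation_y M zeta \<theta> F Y y))"

definition density :: "state \<Rightarrow> real" where
  "density u = (case primitive u of (\<rho>, \<eta>, j, v, F, Y, y) \<Rightarrow> \<rho>)"

definition deformation_gradient :: "state \<Rightarrow> mat3" where
  "deformation_gradient u = (case primitive u of (\<rho>, \<eta>, j, v, F, Y, y) \<Rightarrow> F)"

text \<open>Homogeneity of the material and the Piola identity.\<close>

definition standing_assumptions ::
  "material \<Rightarrow> spacetime set \<Rightarrow> (spacetime \<Rightarrow> state) \<Rightarrow> bool" where
  "standing_assumptions M D u \<longleftrightarrow>
     (\<forall>p\<in>D. density (u p) * det (deformation_gradient (u p)) = rhoR M) \<and>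
     (\<forall>p\<in>D. \<forall>a. (\<Sum>i\<in>UNIV. dx i (\<lambda>q. deformation_gradient (u q) $ i $ a
                                       / det (deformation_gradient (u q))) p) = 0)"

definition e_s_tilde :: "material \<Rightarrow> real \<Rightarrow> real \<Rightarrow> mat3 \<Rightarrow> mat3 \<Rightarrow> real \<Rightarrow> real" where
  "e_s_tilde M \<rho> \<eta> F Y y = e_s M \<rho> (eta_hat M \<rho> \<eta> F Y y)"

definition E_tilde :: "material \<Rightarrow> state \<Rightarrow> real" where
  "E_tilde M w =
     (case w of (\<rho>, \<eta>, j, v, F, Y, y) \<Rightarrow>
        1 / 2 * (norm v)\<^sup>2 + e_s_tilde M \<rho> \<eta> F Y y + tau0 M / (2 * kappa M) * (norm j)\<^sup>2
        + alpha M / 2 * K0 M * trace (C_mat F Y) + eref M / 2 * (norm Y)\<^sup>2)"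

definition rho_E :: "material \<Rightarrow> state \<Rightarrow> real" where
  "rho_E M u = density u * E_tilde M (primitive u)"

end

theory Submission
  imports Defs
begin

text \<open>The quantity \<open>\<rho>E\<close> is the total energy plus the term \<open>e_ref/2 \<rho> |Y|\<^sup>2\<close>, which secures strict
  convexity in \<open>Y\<close> and is transported up to a source because \<open>Y\<close> is. The additional balance law is thus the
  balance of total energy. With \<open>\<theta>\<close> and \<open>p / \<rho>\<^sup>2\<close> the partial derivatives of the equation of
  state, the specific internal energy \<open>e\<close> (with its \<open>K0\<close> part) obeys a Gibbs relation
  \<open>de = \<theta> d\<eta> + (p / \<rho>\<^sup>2 + \<alpha> kB \<theta> / \<rho>) d\<rho> + \<alpha>/2 K(\<theta>) d(tr C) - \<alpha> kB \<theta> / 4 dy / y\<close>.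
  Take it along the flow. The Piola identity and the constancy of \<open>\<rho> det F\<close> turn the law for \<open>\<rho>F\<close>
  into \<open>DF = (grad v) F\<close>. For \<open>Z = Y^(-1/2)\<close> the relaxation law of \<open>Y\<close> means
  \<open>DZ = 4 kB \<theta> / \<zeta> G - 4 K / \<zeta> Z\<close> (\<open>inv_sqrt_rate\<close>). Hence the rates of \<open>tr C\<close> and of \<open>y\<close> produce
  the stress power and a dissipation, and this dissipation is exactly the second term of \<open>\<theta> \<xi>\<close>
  (\<open>dissipation_eq\<close>). The law for \<open>\<rho>j\<close> absorbs the first term of \<open>\<theta> \<xi>\<close> and reduces the heat flux to
  \<open>div j\<close>. What is left is the flux \<open>\<rho> E v + j - T v\<close> and the source
  \<open>\<rho> f \<bullet> v + e_ref \<rho> Y \<bullet> \<ff>\<close>, where \<open>\<ff>\<close> is the relaxation of \<open>Y\<close> (\<open>energy_balance\<close>).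

  Convexity of \<open>\<rho>E\<close> in the conserved variables is convexity of \<open>E\<close> in \<open>(1/\<rho>, \<eta>, j, v, F, Y, y)\<close>, because
  \<open>\<rho>E\<close> is a perspective function (\<open>rho_E_strictly_convex\<close>). The thermal part of \<open>E\<close> is a positive
  constant times the exponential of
  \<open>- (\<gamma> - 1) log (1/\<rho> - b) + \<eta> / c_V + a tr C - k log (1/\<rho>) - (k/4) log y\<close> up to an additive constant,
  with \<open>a, k > 0\<close>, so the logarithms only help and everything rests on the joint convexity of
  \<open>tr (F Y^(-1/2) F^T)\<close>. That follows from the operator concavity of the square root and the duality
  formula \<open>x \<bullet> S^(-1) x = max\<^sub>w (2 w \<bullet> x - w \<bullet> S w)\<close>. Strictness comes from a different summand according to
  the component in which two states differ (\<open>E_tilde_strictly_convex\<close>).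

  Smoothness reduces to the square root of positive definite matrices. Its derivative \<open>L\<close> in direction
  \<open>H\<close> solves the Sylvester equation \<open>S L + L S = H\<close>; since the solution depends smoothly on \<open>S\<close> and \<open>H\<close>,
  every degree of differentiability of the root yields the next one (\<open>sqrt_mat_smooth\<close>).\<close>

section \<open>Smooth functions\<close>

lemma Ck_on_subset: "Ck_on n U f \<Longrightarrow> V \<subseteq> U \<Longrightarrow> Ck_on n V f"
  by (induction n arbitrary: f) (auto intro: continuous_on_subset)

lemma Ck_on_imp_continuous_on: "Ck_on n U f \<Longrightarrow> continuous_on U f"
  by (cases n) (auto intro!: continuous_at_imp_continuous_on differentiable_imp_continuous_within)

lemma Ck_on_SucD: "Ck_on (Suc n) U f \<Longrightarrow> Ck_on n U f"
proof (induction n arbitrary: f)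
  case 0
  then show ?case using Ck_on_imp_continuous_on[of "Suc 0"] by simp
next
  case (Suc n)
  have "Ck_on n U (\<lambda>x. frechet_derivative f (at x) v)" for v
    using Suc.prems by (intro Suc.IH) simp
  then show ?case using Suc.prems by simp
qed

lemma Ck_on_cong:
  assumes "open U" "\<And>x. x \<in> U \<Longrightarrow> f x = g x" "Ck_on n U f"
  shows "Ck_on n U g"
  using assms(2,3)
proof (induction n arbitrary: f g)
  case 0
  then show ?case using continuous_on_cong by fastforce
next
  case (Suc n)
  have d: "(g has_derivative frechet_derivative f (at x)) (at x)" if "x \<in> U" for x
  proof -
    have "(f has_derivative frechet_derivative f (at x)) (at x)"
      using Suc.prems(2) that by (simp add: frechet_derivative_works)
    then show ?thesis
      by (rule has_derivative_transform_within_open[OF _ \<open>open U\<close> that]) (use Suc.prems in auto)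
  qed
  have e: "frechet_derivative g (at x) = frechet_derivative f (at x)" if "x \<in> U" for x
    using frechet_derivative_at[OF d[OF that]] by simp
  have "Ck_on n U (\<lambda>x. frechet_derivative g (at x) v)" for v
    by (rule Suc.IH[of "\<lambda>x. frechet_derivative f (at x) v"]) (use Suc.prems e in auto)
  then show ?case using d by (auto simp: differentiable_def)
qed

lemma Ck_on_SucI:
  assumes "open U" "\<And>x. x \<in> U \<Longrightarrow> (f has_derivative f' x) (at x)"
    and "\<And>v. Ck_on n U (\<lambda>x. f' x v)"
  shows "Ck_on (Suc n) U f"
proof -
  have "Ck_on n U (\<lambda>x. frechet_derivative f (at x) v)" for v
    by (rule Ck_on_cong[OF \<open>open U\<close> _ assms(3)[of v]]) (simp add: frechet_derivative_at[OF assms(2), symmetric])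
  then show ?thesis using assms(2) by (auto simp: differentiable_def)
qed

lemma Ck_on_has_derivative:
  assumes "Ck_on (Suc n) U f" "x \<in> U"
  shows "(f has_derivative frechet_derivative f (at x)) (at x)"
  using assms by (simp add: frechet_derivative_works)

lemma Ck_on_const: "open U \<Longrightarrow> Ck_on n U (\<lambda>x. c)"
proof (induction n arbitrary: c)
  case (Suc n)
  then show ?case by (intro Ck_on_SucI[where f' = "\<lambda>x v. 0"]) auto
qed simp

lemma Ck_on_bounded_linear:
  assumes L: "bounded_linear L" and "open U" "Ck_on n U f"
  shows "Ck_on n U (\<lambda>x. L (f x))"
  using assms(3)
proof (induction n arbitrary: f)
  case 0
  then show ?case by (simp add: bounded_linear.continuous_on[OF L])
next
  case (Suc n)
  show ?case
    by (rule Ck_on_SucI[OF \<open>open U\<close> bounded_linear.has_derivative[OF L Ck_on_has_derivative[OF Suc.prems]]])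
      (use Suc in auto)
qed

lemma Ck_on_add:
  assumes "open U" "Ck_on n U f" "Ck_on n U g"
  shows "Ck_on n U (\<lambda>x. f x + g x)"
  using assms(2,3)
proof (induction n arbitrary: f g)
  case 0
  then show ?case by (simp add: continuous_on_add)
next
  case (Suc n)
  show ?case
    by (rule Ck_on_SucI[OF \<open>open U\<close> has_derivative_add[OF Ck_on_has_derivative[OF Suc.prems(1)]
            Ck_on_has_derivative[OF Suc.prems(2)]]]) (use Suc in auto)
qed

lemma Ck_on_sum:
  assumes "open U" "finite I" "\<And>i. i \<in> I \<Longrightarrow> Ck_on n U (f i)"
  shows "Ck_on n U (\<lambda>x. \<Sum>i\<in>I. f i x)"
  using assms(2,3) by (induction I rule: finite_induct) (auto intro: Ck_on_const Ck_on_add assms)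

lemma Ck_on_bounded_bilinear:
  assumes B: "bounded_bilinear B" and "open U" "Ck_on n U f" "Ck_on n U g"
  shows "Ck_on n U (\<lambda>x. B (f x) (g x))"
  using assms(3,4)
proof (induction n arbitrary: f g)
  case 0
  then show ?case by (simp add: bounded_bilinear.continuous_on[OF B])
next
  case (Suc n)
  show ?case
    by (rule Ck_on_SucI[OF \<open>open U\<close> bounded_bilinear.FDERIV[OF B Ck_on_has_derivative[OF Suc.prems(1)]
            Ck_on_has_derivative[OF Suc.prems(2)]]])
      (use Suc Ck_on_SucD[OF Suc.prems(1)] Ck_on_SucD[OF Suc.prems(2)] in \<open>auto intro!: Ck_on_add \<open>open U\<close>\<close>)
qed

text \<open>The codomain of the inner function has to be Euclidean: \<open>Ck_on\<close> controls the derivative of \<open>g\<close> only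
  in fixed directions, so its value in the moving direction \<open>f' x v\<close> is expanded in a finite basis.\<close>

lemma Ck_on_compose:
  fixes f :: "'a::real_normed_vector \<Rightarrow> 'b::euclidean_space"
  assumes "open U" "Ck_on n U f" "open V" "Ck_on n V g" "f ` U \<subseteq> V"
  shows "Ck_on n U (\<lambda>x. g (f x))"
  using assms(2,4)
proof (induction n arbitrary: g)
  case 0
  then show ?case using assms(5) by (auto intro: continuous_on_compose2)
next
  case (Suc n)
  define f' where "f' x = frechet_derivative f (at x)" for x
  define g' where "g' x = frechet_derivative g (at x)" for x
  have f': "(f has_derivative f' x) (at x)" if "x \<in> U" for x
    unfolding f'_def using Ck_on_has_derivative Suc.prems(1) that by blast
  have g': "(g has_derivative g' y) (at y)" if "y \<in> V" for y
    unfolding g'_def using Ck_on_has_derivative Suc.prems(2) that by blast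
  have fU: "f x \<in> V" if "x \<in> U" for x using that assms(5) by blast
  have e: "g' y w = (\<Sum>b\<in>Basis. (w \<bullet> b) *\<^sub>R g' y b)" if "y \<in> V" for y w
  proof -
    have "bounded_linear (g' y)" using g'[OF that] by (rule has_derivative_bounded_linear)
    then have l: "linear (g' y)" by (rule bounded_linear.linear)
    have "g' y w = g' y (\<Sum>b\<in>Basis. (w \<bullet> b) *\<^sub>R b)" by (simp add: euclidean_representation)
    also have "\<dots> = (\<Sum>b\<in>Basis. (w \<bullet> b) *\<^sub>R g' y b)" by (simp add: linear_sum[OF l] linear_scale[OF l])
    finally show ?thesis .
  qed
  have Cn: "Ck_on n U (\<lambda>x. g' (f x) b)" for b
    using Suc.prems Ck_on_SucD[OF Suc.prems(1)] unfolding g'_def by (intro Suc.IH) auto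
  have Df: "Ck_on n U (\<lambda>x. f' x v)" for v
    using Suc.prems unfolding f'_def by auto
  show ?case
  proof (rule Ck_on_SucI[OF \<open>open U\<close>, where f' = "\<lambda>x v. \<Sum>b\<in>Basis. (f' x v \<bullet> b) *\<^sub>R g' (f x) b"])
    fix x assume x: "x \<in> U"
    have "((\<lambda>x. g (f x)) has_derivative (\<lambda>v. g' (f x) (f' x v))) (at x)"
      using has_derivative_compose[OF f'[OF x] g'[OF fU[OF x]]] .
    then show "((\<lambda>x. g (f x)) has_derivative (\<lambda>v. \<Sum>b\<in>Basis. (f' x v \<bullet> b) *\<^sub>R g' (f x) b)) (at x)"
      by (simp add: e[OF fU[OF x], symmetric])
  next
    fix v
    show "Ck_on n U (\<lambda>x. \<Sum>b\<in>Basis. (f' x v \<bullet> b) *\<^sub>R g' (f x) b)"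
      by (intro Ck_on_sum Ck_on_bounded_bilinear[OF bounded_bilinear_scaleR] \<open>open U\<close> Cn
          Ck_on_bounded_linear[OF bounded_linear_inner_left] Df) auto
  qed
qed

lemma Ck_on_realI:
  fixes f :: "real \<Rightarrow> real"
  assumes "open U" "\<And>x. x \<in> U \<Longrightarrow> (f has_real_derivative f' x) (at x)" "Ck_on n U f'"
  shows "Ck_on (Suc n) U f"
  by (rule Ck_on_SucI[OF \<open>open U\<close>, where f' = "\<lambda>x v. f' x * v"])
    (use assms in \<open>auto simp: has_field_derivative_def
        intro: Ck_on_bounded_linear[OF bounded_linear_mult_left]\<close>)

lemma Ck_on_exp: "Ck_on n UNIV (exp :: real \<Rightarrow> real)"
  by (induction n) (auto intro!: continuous_intros Ck_on_realI[where f' = exp] DERIV_exp simp del: Ck_on.simps(2))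

lemma Ck_on_inverse: "Ck_on n (-{0}) (inverse :: real \<Rightarrow> real)"
proof (induction n)
  case 0
  then show ?case by (auto intro!: continuous_intros)
next
  case (Suc n)
  have o: "open (-{0::real})" by auto
  have s: "Ck_on n (-{0}) (\<lambda>x::real. inverse x * inverse x)"
    by (rule Ck_on_bounded_bilinear[OF bounded_bilinear_mult o Suc Suc])
  have "Ck_on n (-{0}) (\<lambda>x::real. - (inverse x * inverse x))"
    by (rule Ck_on_bounded_linear[OF bounded_linear_minus[OF bounded_linear_ident] o s])
  then show ?case
    by (intro Ck_on_realI[OF o, where f' = "\<lambda>x. - (inverse x * inverse x)"])
      (auto intro!: derivative_eq_intros simp: power2_eq_square)
qed

lemma Ck_on_ln: "Ck_on n {0<..} (ln :: real \<Rightarrow> real)"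
proof (cases n)
  case 0
  then show ?thesis by (auto intro!: continuous_intros)
next
  case (Suc m)
  show ?thesis unfolding Suc
    by (rule Ck_on_realI[where f' = inverse])
      (auto intro: Ck_on_subset[OF Ck_on_inverse] DERIV_ln)
qed

lemma smooth_onI: "open U \<Longrightarrow> S \<subseteq> U \<Longrightarrow> (\<And>n. Ck_on n U f) \<Longrightarrow> smooth_on S f"
  unfolding smooth_on_def by auto

lemma smooth_onE:
  assumes "smooth_on S f"
  obtains U g where "open U" "S \<subseteq> U" "\<And>n. Ck_on n U g" "\<And>x. x \<in> S \<Longrightarrow> g x = f x"
  using assms unfolding smooth_on_def by metis

lemma smooth_on_cong: "(\<And>x. x \<in> S \<Longrightarrow> f x = g x) \<Longrightarrow> smooth_on S f \<Longrightarrow> smooth_on S g"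
  unfolding smooth_on_def by metis

named_theorems smooth_intros

lemma smooth_on_const [smooth_intros]: "smooth_on S (\<lambda>x. c)"
  by (rule smooth_onI[of UNIV]) (auto intro: Ck_on_const)

lemma smooth_on_bounded_linear:
  assumes "bounded_linear L" "smooth_on S f"
  shows "smooth_on S (\<lambda>x. L (f x))"
proof -
  from assms(2) obtain U g where "open U" "S \<subseteq> U" "\<And>n. Ck_on n U g" "\<And>x. x \<in> S \<Longrightarrow> g x = f x"
    by (rule smooth_onE) blast
  then show ?thesis using Ck_on_bounded_linear[OF assms(1), of U _ g]
    unfolding smooth_on_def by (intro exI[of _ U] exI[of _ "\<lambda>x. L (g x)"]) auto
qed

lemma smooth_on_bounded_bilinear:
  assumes "bounded_bilinear B" "smooth_on S f" "smooth_on S g"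
  shows "smooth_on S (\<lambda>x. B (f x) (g x))"
proof -
  from assms(2) obtain U f' where 1: "open U" "S \<subseteq> U" "\<And>n. Ck_on n U f'" "\<And>x. x \<in> S \<Longrightarrow> f' x = f x"
    by (rule smooth_onE) blast
  from assms(3) obtain V g' where 2: "open V" "S \<subseteq> V" "\<And>n. Ck_on n V g'" "\<And>x. x \<in> S \<Longrightarrow> g' x = g x"
    by (rule smooth_onE) blast
  have "Ck_on n (U \<inter> V) (\<lambda>x. B (f' x) (g' x))" for n
    by (rule Ck_on_bounded_bilinear[OF assms(1)])
      (auto intro: Ck_on_subset[OF 1(3)] Ck_on_subset[OF 2(3)] 1 2)
  then show ?thesis using 1 2
    unfolding smooth_on_def by (intro exI[of _ "U \<inter> V"] exI[of _ "\<lambda>x. B (f' x) (g' x)"]) auto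
qed

lemma smooth_on_ident [smooth_intros]: "smooth_on S (\<lambda>x. x)"
proof (rule smooth_onI[of UNIV])
  fix n show "Ck_on n UNIV (\<lambda>x::'a. x)"
  proof (cases n)
    case (Suc m)
    then show ?thesis
      using Ck_on_SucI[of UNIV "\<lambda>x::'a. x" "\<lambda>x v. v" m] by (auto intro: Ck_on_const)
  qed (auto intro!: continuous_intros)
qed auto

lemma smooth_on_add [smooth_intros]:
  assumes "smooth_on S f" "smooth_on S g"
  shows "smooth_on S (\<lambda>x. f x + g x)"
proof -
  from assms(1) obtain U f' where 1: "open U" "S \<subseteq> U" "\<And>n. Ck_on n U f'" "\<And>x. x \<in> S \<Longrightarrow> f' x = f x"
    by (rule smooth_onE) blast
  from assms(2) obtain V g' where 2: "open V" "S \<subseteq> V" "\<And>n. Ck_on n V g'" "\<And>x. x \<in> S \<Longrightarrow> g' x = g x"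
    by (rule smooth_onE) blast
  have "Ck_on n (U \<inter> V) (\<lambda>x. f' x + g' x)" for n
    by (rule Ck_on_add) (auto intro: Ck_on_subset[OF 1(3)] Ck_on_subset[OF 2(3)] 1 2)
  then show ?thesis using 1 2
    unfolding smooth_on_def by (intro exI[of _ "U \<inter> V"] exI[of _ "\<lambda>x. f' x + g' x"]) auto
qed

lemma smooth_on_compose:
  fixes f :: "'a::real_normed_vector \<Rightarrow> 'b::euclidean_space"
  assumes "smooth_on T g" "smooth_on S f" "\<And>x. x \<in> S \<Longrightarrow> f x \<in> T"
  shows "smooth_on S (\<lambda>x. g (f x))"
proof -
  from assms(2) obtain U f' where 1: "open U" "S \<subseteq> U" "\<And>n. Ck_on n U f'" "\<And>x. x \<in> S \<Longrightarrow> f' x = f x"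
    by (rule smooth_onE) blast
  from assms(1) obtain V g' where 2: "open V" "T \<subseteq> V" "\<And>n. Ck_on n V g'" "\<And>x. x \<in> T \<Longrightarrow> g' x = g x"
    by (rule smooth_onE) blast
  define W where "W = U \<inter> f' -` V"
  have "continuous_on U f'" using 1(3)[of 0] by simp
  then have W: "open W" unfolding W_def using 1 2 by (metis Int_commute continuous_on_open_vimage)
  have "Ck_on n W (\<lambda>x. g' (f' x))" for n
    by (rule Ck_on_compose[OF W _ \<open>open V\<close> 2(3)])
      (use 1 in \<open>auto intro: Ck_on_subset simp: W_def\<close>)
  moreover have "S \<subseteq> W" using 1 2 assms(3) by (force simp: W_def)
  ultimately show ?thesis using 1 2 W assms(3)
    unfolding smooth_on_def by (intro exI[of _ W] exI[of _ "\<lambda>x. g' (f' x)"]) auto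
qed

lemmas smooth_on_linear_intros [smooth_intros] =
  smooth_on_bounded_linear[OF bounded_linear_fst]
  smooth_on_bounded_linear[OF bounded_linear_snd]
  smooth_on_bounded_linear[OF bounded_linear_minus[OF bounded_linear_ident]]
  smooth_on_bounded_linear[OF bounded_linear_vec_nth]
  smooth_on_bounded_bilinear[OF bounded_bilinear_mult]
  smooth_on_bounded_bilinear[OF bounded_bilinear_scaleR]
  smooth_on_bounded_bilinear[OF bounded_bilinear_inner]

lemma smooth_on_diff [smooth_intros]:
  assumes "smooth_on S f" "smooth_on S g"
  shows "smooth_on S (\<lambda>x. f x - g x)"
proof -
  have "smooth_on S (\<lambda>x. f x + - g x)" by (intro smooth_intros assms)
  then show ?thesis by simp
qed

lemma smooth_on_sum [smooth_intros]:
  "(\<And>i. i \<in> I \<Longrightarrow> smooth_on S (f i)) \<Longrightarrow> smooth_on S (\<lambda>x. \<Sum>i\<in>I. f i x)"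
  by (induction I rule: infinite_finite_induct) (auto intro!: smooth_intros)

lemma smooth_on_Pair [smooth_intros]:
  assumes "smooth_on S f" "smooth_on S g"
  shows "smooth_on S (\<lambda>x. (f x, g x))"
proof -
  have "smooth_on S (\<lambda>x. (f x, 0) + (0, g x))"
    by (intro smooth_on_add smooth_on_bounded_linear[OF _ assms(1), of "\<lambda>y. (y, 0)"]
        smooth_on_bounded_linear[OF _ assms(2), of "\<lambda>y. (0, y)"] bounded_linear_intros)
  then show ?thesis by simp
qed

lemma smooth_on_power2 [smooth_intros]:
  fixes f :: "'a::real_normed_vector \<Rightarrow> real"
  shows "smooth_on S f \<Longrightarrow> smooth_on S (\<lambda>x. (f x)\<^sup>2)"
  unfolding power2_eq_square by (intro smooth_intros)

lemma smooth_on_inverse [smooth_intros]: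
  fixes f :: "'a::real_normed_vector \<Rightarrow> real"
  assumes "smooth_on S f" "\<And>x. x \<in> S \<Longrightarrow> f x \<noteq> 0"
  shows "smooth_on S (\<lambda>x. inverse (f x))"
  by (rule smooth_on_compose[OF smooth_onI[OF _ subset_refl Ck_on_inverse]]) (use assms in auto)

lemma smooth_on_divide [smooth_intros]:
  fixes f :: "'a::real_normed_vector \<Rightarrow> real"
  assumes "smooth_on S f" "smooth_on S g" "\<And>x. x \<in> S \<Longrightarrow> g x \<noteq> 0"
  shows "smooth_on S (\<lambda>x. f x / g x)"
  unfolding divide_inverse by (intro smooth_intros assms)

lemma smooth_on_exp [smooth_intros]:
  fixes f :: "'a::real_normed_vector \<Rightarrow> real"
  assumes "smooth_on S f"
  shows "smooth_on S (\<lambda>x. exp (f x))"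
  by (rule smooth_on_compose[OF smooth_onI[OF _ subset_refl Ck_on_exp]]) (use assms in auto)

lemma smooth_on_ln [smooth_intros]:
  fixes f :: "'a::real_normed_vector \<Rightarrow> real"
  assumes "smooth_on S f" "\<And>x. x \<in> S \<Longrightarrow> 0 < f x"
  shows "smooth_on S (\<lambda>x. ln (f x))"
  by (rule smooth_on_compose[OF smooth_onI[OF _ subset_refl Ck_on_ln]]) (use assms in auto)

lemma smooth_on_powr [smooth_intros]:
  fixes f :: "'a::real_normed_vector \<Rightarrow> real"
  assumes "smooth_on S f" "\<And>x. x \<in> S \<Longrightarrow> 0 < f x"
  shows "smooth_on S (\<lambda>x. f x powr c)"
  by (rule smooth_on_cong[of _ "\<lambda>x. exp (c * ln (f x))"])
    (use assms in \<open>force simp: powr_def intro!: smooth_intros\<close>)+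

text \<open>On a set that is not open the derivative within the set exists but need not be unique; the extension
  supplies one.\<close>

lemma smooth_on_imp_has_derivative:
  assumes "smooth_on S f" "x \<in> S"
  obtains f' where "(f has_derivative f') (at x within S)"
proof -
  from assms(1) obtain U g where 1: "open U" "S \<subseteq> U" "\<And>n. Ck_on n U g" "\<And>x. x \<in> S \<Longrightarrow> g x = f x"
    by (rule smooth_onE) blast
  have "(g has_derivative frechet_derivative g (at x)) (at x)"
    using Ck_on_has_derivative[OF 1(3)] 1(2) assms(2) by blast
  then have "(g has_derivative frechet_derivative g (at x)) (at x within S)"
    by (rule has_derivative_at_withinI)
  then have "(f has_derivative frechet_derivative g (at x)) (at x within S)"
    by (rule has_derivative_transform[OF assms(2), rotated]) (use 1 in auto)
  then show ?thesis by (rule that)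
qed

section \<open>Linear equations with smooth coefficients\<close>

text \<open>The solution \<open>x\<close> of \<open>B a x = h\<close> is smooth in \<open>(a, h)\<close>. Differentiability is the inverse function
  theorem for \<open>(a, x) \<mapsto> (a, B a x)\<close>, whose inverse is \<open>(a, h) \<mapsto> (a, sol a h)\<close>. The derivative is again a
  solution, with right hand side \<open>dh - B da x\<close>, so that \<open>C^n\<close> implies \<open>C^(n+1)\<close>. This covers both matrix
  inversion (\<open>A X = I\<close>) and the Sylvester equation (\<open>S L + L S = H\<close>).\<close>

lemma bilinear_solve:
  fixes B :: "'a::euclidean_space \<Rightarrow> 'e::euclidean_space \<Rightarrow> 'e"
  assumes B: "bounded_bilinear B" and U: "open U"
    and inj: "\<And>a x. a \<in> U \<Longrightarrow> B a x = 0 \<Longrightarrow> x = 0"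
    and sol: "\<And>a h. a \<in> U \<Longrightarrow> B a (sol a h) = h"
  shows bilinear_solve_has_derivative:
      "a \<in> U \<Longrightarrow> ((\<lambda>p. sol (fst p) (snd p)) has_derivative
          (\<lambda>d. sol a (snd d - B (fst d) (sol a h)))) (at (a, h))"
    and bilinear_solve_smooth: "smooth_on (U \<times> UNIV) (\<lambda>p. sol (fst p) (snd p))"
proof -
  interpret B: bounded_bilinear B by fact
  have solB: "sol a (B a x) = x" if "a \<in> U" for a x
    using inj[OF that, of "sol a (B a x) - x"] sol[OF that] by (simp add: B.diff_right)
  define f where "f p = (fst p, B (fst p) (snd p))" for p
  define g where "g p = (fst p, sol (fst p) (snd p))" for p
  define g' where "g' a h d = (fst d, sol a (snd d - B (fst d) (sol a h)))" for a h d
  have D: "(g has_derivative g' a h) (at (a, h))" if a: "a \<in> U" for a h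
  proof -
    have "(g has_derivative g' a h) (at (f (a, sol a h)))"
    proof (rule has_derivative_inverse_strong[where S = "U \<times> UNIV" and f = f and x = "(a, sol a h)"
          and f' = "\<lambda>d. (fst d, B a (snd d) + B (fst d) (sol a h))"])
      show "(f has_derivative (\<lambda>d. (fst d, B a (snd d) + B (fst d) (sol a h)))) (at (a, sol a h))"
        unfolding f_def by (auto intro!: derivative_eq_intros B.FDERIV)
    qed (use U a in \<open>auto simp: f_def g_def g'_def solB sol fun_eq_iff open_Times intro!: continuous_intros B.continuous_on\<close>)
    then show ?thesis using a by (simp add: f_def sol)
  qed
  have E: "((\<lambda>p. sol (fst p) (snd p)) has_derivative
          (\<lambda>d. sol a (snd d - B (fst d) (sol a h)))) (at (a, h))" if a: "a \<in> U" for a h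
    using has_derivative_snd[OF D[OF a, of h]] by (simp add: g_def[abs_def] g'_def)
  show "a \<in> U \<Longrightarrow> ((\<lambda>p. sol (fst p) (snd p)) has_derivative
          (\<lambda>d. sol a (snd d - B (fst d) (sol a h)))) (at (a, h))" by (rule E)
  have O: "open (U \<times> (UNIV :: 'e set))" using U by (simp add: open_Times)
  have "Ck_on n (U \<times> UNIV) (\<lambda>p. sol (fst p) (snd p))" for n
  proof (induction n)
    case 0
    have "continuous (at p) (\<lambda>p. sol (fst p) (snd p))" if "p \<in> U \<times> UNIV" for p
      using E[of "fst p" "snd p"] that by (auto dest: has_derivative_continuous)
    then show ?case by (simp add: continuous_at_imp_continuous_on)
  next
    case (Suc n)
    show ?case
    proof (rule Ck_on_SucI[OF O])
      fix p assume "p \<in> U \<times> (UNIV :: 'e set)"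
      then show "((\<lambda>p. sol (fst p) (snd p)) has_derivative
          (\<lambda>d. sol (fst p) (snd d - B (fst d) (sol (fst p) (snd p))))) (at p)"
        using E[of "fst p" "snd p"] by auto
    next
      fix d :: "'a \<times> 'e"
      have id: "Ck_on n (U \<times> UNIV) (\<lambda>p :: 'a \<times> 'e. p)"
        using Ck_on_SucI[of "U \<times> UNIV" "\<lambda>p :: 'a \<times> 'e. p" "\<lambda>x v. v" n, THEN Ck_on_SucD] O
        by (auto intro: Ck_on_const)
      have lin: "bounded_linear (\<lambda>x. (0 :: 'a, - B (fst d) x))"
        by (intro bounded_linear_Pair bounded_linear_minus B.bounded_linear_right bounded_linear_zero)
      have "Ck_on n (U \<times> UNIV) (\<lambda>p :: 'a \<times> 'e. (fst p, 0 :: 'e))"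
        by (rule Ck_on_bounded_linear[OF _ O id, of "\<lambda>p. (fst p, 0)"])
          (intro bounded_linear_Pair bounded_linear_fst bounded_linear_zero)
      then have "Ck_on n (U \<times> UNIV) (\<lambda>p. (fst p, 0) + (0, snd d) + (0, - B (fst d) (sol (fst p) (snd p))))"
        by (intro Ck_on_add O Ck_on_const Ck_on_bounded_linear[OF lin O Suc.IH])
      then have arg: "Ck_on n (U \<times> UNIV) (\<lambda>p. (fst p, snd d - B (fst d) (sol (fst p) (snd p))))"
        by simp
      show "Ck_on n (U \<times> UNIV) (\<lambda>p. sol (fst p) (snd d - B (fst d) (sol (fst p) (snd p))))"
        by (rule Ck_on_compose[OF O arg O Suc.IH, unfolded fst_conv snd_conv]) auto
    qed
  qed
  then show "smooth_on (U \<times> UNIV) (\<lambda>p. sol (fst p) (snd p))"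
    by (intro smooth_onI[OF O]) auto
qed

lemma bilinear_solve_exists:
  fixes B :: "'a::euclidean_space \<Rightarrow> 'e::euclidean_space \<Rightarrow> 'e"
  assumes B: "bounded_bilinear B" and inj: "\<And>x. B a x = 0 \<Longrightarrow> x = 0"
  shows "\<exists>x. B a x = h"
proof -
  interpret B: bounded_bilinear B by fact
  have "linear (B a)" using B.bounded_linear_right by (rule bounded_linear.linear)
  moreover from this have "inj (B a)" using inj by (simp add: linear_injective_0)
  ultimately have "surj (B a)" by (rule linear_inj_imp_surj)
  then show ?thesis by (metis surjD)
qed

section \<open>Matrix algebra\<close>

lemma bounded_bilinear_matrix_mult:
  "bounded_bilinear ((**) :: real ^ 'n ^ 'm \<Rightarrow> real ^ 'p ^ 'n \<Rightarrow> real ^ 'p ^ 'm)"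
  unfolding bilinear_conv_bounded_bilinear[symmetric] bilinear_def
  by (auto intro!: linearI simp: vec_eq_iff matrix_matrix_mult_def algebra_simps sum.distrib sum_distrib_left)

lemma bounded_bilinear_matrix_vector_mult:
  "bounded_bilinear ((*v) :: real ^ 'n ^ 'm \<Rightarrow> real ^ 'n \<Rightarrow> real ^ 'm)"
  unfolding bilinear_conv_bounded_bilinear[symmetric] bilinear_def
  by (auto intro!: linearI simp: vec_eq_iff matrix_vector_mult_def algebra_simps sum.distrib sum_distrib_left)

lemma bounded_linear_transpose: "bounded_linear (transpose :: real ^ 'n ^ 'm \<Rightarrow> real ^ 'm ^ 'n)"
  unfolding linear_conv_bounded_linear[symmetric]
  by (auto intro!: linearI simp: vec_eq_iff transpose_def)

lemma bounded_linear_trace: "bounded_linear (trace :: real ^ 'n ^ 'n \<Rightarrow> real)"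
  unfolding linear_conv_bounded_linear[symmetric]
  by (auto intro!: linearI simp: trace_def sum.distrib sum_distrib_left)

interpretation mat_mult: bounded_bilinear "(**) :: real ^ 'n ^ 'm \<Rightarrow> real ^ 'p ^ 'n \<Rightarrow> real ^ 'p ^ 'm"
  by (rule bounded_bilinear_matrix_mult)
interpretation mat_vec: bounded_bilinear "(*v) :: real ^ 'n ^ 'm \<Rightarrow> real ^ 'n \<Rightarrow> real ^ 'm"
  by (rule bounded_bilinear_matrix_vector_mult)

lemmas transpose_add = linear_add[OF bounded_linear.linear[OF bounded_linear_transpose]]
  and transpose_diff = linear_diff[OF bounded_linear.linear[OF bounded_linear_transpose]]
  and transpose_scaleR = linear_scale[OF bounded_linear.linear[OF bounded_linear_transpose]]
  and transpose_zero = linear_0[OF bounded_linear.linear[OF bounded_linear_transpose]]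


lemmas trace_add = linear_add[OF bounded_linear.linear[OF bounded_linear_trace]]
  and trace_diff = linear_diff[OF bounded_linear.linear[OF bounded_linear_trace]]
  and trace_scaleR = linear_scale[OF bounded_linear.linear[OF bounded_linear_trace]]

lemma inner_matrix_eq_trace: "A \<bullet> B = trace (A ** transpose B)" for A B :: "real ^ 'n ^ 'm"
  by (simp add: inner_vec_def trace_def matrix_matrix_mult_def transpose_def)

lemma inner_transpose: "transpose A \<bullet> transpose B = A \<bullet> B" for A B :: "real ^ 'n ^ 'm"
  unfolding inner_vec_def transpose_def by simp (rule sum.swap)

lemma inner_matrix_columns: "A \<bullet> B = (\<Sum>j\<in>UNIV. column j A \<bullet> column j B)" for A B :: "real ^ 'n ^ 'm"
  unfolding inner_vec_def column_def by (simp add: sum.swap[of _ "UNIV :: 'n set"])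

lemma column_matrix_mult: "column j (A ** B) = A *v column j B"
  by (simp add: column_def matrix_matrix_mult_def matrix_vector_mult_def vec_eq_iff)

section \<open>Positive definite matrices and the Sylvester equation\<close>

text \<open>Symmetry is left out so that the set is open in the space of all matrices (\<open>open_pos_def\<close>) and
  can serve as the domain on which smoothness is proved.\<close>

definition pos_def :: "real ^ 'n ^ 'n \<Rightarrow> bool" where
  "pos_def A \<longleftrightarrow> (\<forall>x. x \<noteq> 0 \<longrightarrow> 0 < x \<bullet> (A *v x))"

lemma spd_iff: "spd A \<longleftrightarrow> transpose A = A \<and> pos_def A"
  by (simp add: spd_def pos_def_def)

lemma inner_matrix_vector_transpose: "x \<bullet> (transpose A *v y) = (A *v x) \<bullet> y" for A :: "real ^ 'n ^ 'm"
  by (metis dot_lmul_matrix inner_commute transpose_matrix_vector)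

lemma pos_def_transpose: "pos_def (transpose A) \<longleftrightarrow> pos_def A"
  by (simp add: pos_def_def dot_lmul_matrix inner_commute[of x "x v* A" for x])

lemma pos_def_mult_eq_0: "pos_def A \<Longrightarrow> A *v x = 0 \<Longrightarrow> x = 0"
  unfolding pos_def_def by force

lemma pos_def_invertible: "pos_def A \<Longrightarrow> invertible A"
  by (metis invertible_left_inverse matrix_left_invertible_ker pos_def_mult_eq_0)

lemma pos_def_convex_combination:
  fixes A B :: "real ^ 'n ^ 'n"
  shows "pos_def A \<Longrightarrow> pos_def B \<Longrightarrow> 0 \<le> s \<Longrightarrow> s \<le> 1 \<Longrightarrow> pos_def ((1 - s) *\<^sub>R A + s *\<^sub>R B)"
proof (cases "s = 0")
  case False
  assume AB: "pos_def A" "pos_def B" "0 \<le> s" "s \<le> 1"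
  show ?thesis unfolding pos_def_def
  proof (intro allI impI)
    fix x :: "real ^ 'n" assume "x \<noteq> 0"
    with AB have "0 < x \<bullet> (A *v x)" "0 < x \<bullet> (B *v x)" by (auto simp: pos_def_def)
    then have "0 < (1 - s) * (x \<bullet> (A *v x)) + s * (x \<bullet> (B *v x))"
      using AB False by (intro add_nonneg_pos mult_nonneg_nonneg mult_pos_pos) auto
    then show "0 < x \<bullet> (((1 - s) *\<^sub>R A + s *\<^sub>R B) *v x)"
      by (simp add: mat_vec.add_left mat_vec.scaleR_left inner_add_right)
  qed
qed simp

lemma spd_convex_combination:
  "spd A \<Longrightarrow> spd B \<Longrightarrow> 0 \<le> s \<Longrightarrow> s \<le> 1 \<Longrightarrow> spd ((1 - s) *\<^sub>R A + s *\<^sub>R B)"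
  unfolding spd_iff by (simp add: pos_def_convex_combination transpose_add transpose_scaleR)

lemma pos_def_lower_bound:
  fixes A :: "real ^ 'n ^ 'n"
  assumes "pos_def A"
  obtains c where "c > 0" "\<And>x. c * (norm x)\<^sup>2 \<le> x \<bullet> (A *v x)"
proof -
  have "continuous_on (sphere 0 1) (\<lambda>x. x \<bullet> (A *v x))"
    by (intro continuous_intros)
  moreover have "sphere 0 1 \<noteq> ({} :: (real ^ 'n) set)" by simp
  ultimately obtain u where u: "u \<in> sphere 0 1" "\<And>x. x \<in> sphere 0 1 \<Longrightarrow> u \<bullet> (A *v u) \<le> x \<bullet> (A *v x)"
    using continuous_attains_inf[of "sphere 0 1" "\<lambda>x. x \<bullet> (A *v x)"] compact_sphere by blast
  have "u \<bullet> (A *v u) * (norm x)\<^sup>2 \<le> x \<bullet> (A *v x)" for x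
  proof (cases "x = 0")
    case False
    have "u \<bullet> (A *v u) \<le> (x /\<^sub>R norm x) \<bullet> (A *v (x /\<^sub>R norm x))"
      using False by (intro u) simp
    also have "\<dots> = x \<bullet> (A *v x) / (norm x)\<^sup>2"
      by (simp add: mat_vec.scaleR_right power2_eq_square divide_inverse)
    finally show ?thesis using False by (simp add: field_simps)
  qed simp
  moreover have "0 < u \<bullet> (A *v u)" using assms u(1) unfolding pos_def_def by (metis mem_sphere_0 norm_zero zero_neq_one)
  ultimately show ?thesis using that by blast
qed

lemma open_pos_def: "open {A :: real ^ 'n ^ 'n. pos_def A}"
  unfolding open_dist
proof safe
  fix A :: "real ^ 'n ^ 'n" assume "pos_def A"
  then obtain c where c: "c > 0" "\<And>x. c * (norm x)\<^sup>2 \<le> x \<bullet> (A *v x)"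
    by (rule pos_def_lower_bound) blast
  obtain K where K: "K > 0" "\<And>A :: real ^ 'n ^ 'n. \<And>x. norm (A *v x) \<le> norm A * norm x * K"
    using mat_vec.pos_bounded by blast
  show "\<exists>e>0. \<forall>B. dist B A < e \<longrightarrow> B \<in> {A. pos_def A}"
  proof (intro exI[of _ "c / K"] conjI allI impI)
    show "0 < c / K" using c K by simp
    fix B assume B: "dist B A < c / K"
    show "B \<in> {A. pos_def A}" unfolding pos_def_def mem_Collect_eq
    proof (intro allI impI)
      fix x :: "real ^ 'n" assume x: "x \<noteq> 0"
      have "\<bar>x \<bullet> ((B - A) *v x)\<bar> \<le> norm x * norm ((B - A) *v x)" by (rule Cauchy_Schwarz_ineq2)
      also have "\<dots> \<le> norm x * (norm (B - A) * norm x * K)" by (intro mult_left_mono K) simp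
      also have "\<dots> = (norm (B - A) * K) * (norm x)\<^sup>2" by (simp add: power2_eq_square)
      also have "\<dots> < c * (norm x)\<^sup>2"
        using B K x by (intro mult_strict_right_mono) (auto simp: dist_norm field_simps)
      finally show "0 < x \<bullet> (B *v x)"
        using c(2)[of x] by (simp add: mat_vec.diff_left inner_diff_right)
    qed
  qed
qed

lemma pos_def_inner_pos:
  fixes A L :: "real ^ 'n ^ 'n"
  assumes "pos_def A" "L \<noteq> 0"
  shows "0 < (A ** L) \<bullet> L"
proof -
  have nn: "0 \<le> column j L \<bullet> (A *v column j L)" for j
    using assms(1) unfolding pos_def_def by (cases "column j L = 0") (auto simp: less_imp_le)
  obtain i j where "L $ i $ j \<noteq> 0" using assms(2) by (auto simp: vec_eq_iff)
  then have "column j L \<noteq> 0" by (auto simp: column_def vec_eq_iff)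
  then have "0 < column j L \<bullet> (A *v column j L)" using assms(1) by (simp add: pos_def_def)
  then have "0 < (\<Sum>j\<in>UNIV. column j L \<bullet> (A *v column j L))"
    using nn by (intro sum_pos2[of _ j]) auto
  then show ?thesis by (simp add: inner_matrix_columns column_matrix_mult inner_commute)
qed

text \<open>The Frobenius product of the left hand side with \<open>L\<close> is the sum of the quadratic forms of \<open>A\<close> on the
  columns and of \<open>B\<close> on the rows of \<open>L\<close>, hence positive unless \<open>L = 0\<close>.\<close>

lemma sylvester_eq_0:
  fixes A B L :: "real ^ 'n ^ 'n"
  assumes "pos_def A" "pos_def B" "A ** L + L ** B = 0"
  shows "L = 0"
proof (rule ccontr)
  assume L: "L \<noteq> 0"
  then have "transpose L \<noteq> 0" by (metis transpose_transpose transpose_zero)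
  then have "0 < (transpose B ** transpose L) \<bullet> transpose L"
    using assms(2) by (intro pos_def_inner_pos) (auto simp: pos_def_transpose)
  also have "\<dots> = (L ** B) \<bullet> L" by (metis inner_transpose matrix_transpose_mul)
  finally have "0 < (A ** L + L ** B) \<bullet> L"
    using pos_def_inner_pos[OF assms(1) L] by (simp add: inner_add_left)
  then show False using assms(3) by simp
qed

definition sylvester :: "real ^ 'n ^ 'n \<Rightarrow> real ^ 'n ^ 'n \<Rightarrow> real ^ 'n ^ 'n" where
  "sylvester S H = (SOME L. S ** L + L ** S = H)"

lemma bounded_bilinear_sylvester:
  "bounded_bilinear (\<lambda>S L :: real ^ 'n ^ 'n. S ** L + L ** S)"
  unfolding bilinear_conv_bounded_bilinear[symmetric] bilinear_def
  by (auto intro!: linearI simp: mat_mult.add_left mat_mult.add_right mat_mult.scaleR_left mat_mult.scaleR_right scaleR_add_right)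

lemma sylvester_solves:
  assumes "pos_def S"
  shows "S ** sylvester S H + sylvester S H ** S = H"
  unfolding sylvester_def
  by (rule someI_ex) (rule bilinear_solve_exists[OF bounded_bilinear_sylvester sylvester_eq_0[OF assms assms]])

lemma sylvester_unique:
  assumes "pos_def S" "S ** L + L ** S = S ** M + M ** S"
  shows "L = M"
  using sylvester_eq_0[OF assms(1,1), of "L - M"] assms(2)
  by (simp add: mat_mult.diff_left mat_mult.diff_right algebra_simps)

lemma sylvester_symmetric:
  assumes "spd S" "transpose H = H"
  shows "transpose (sylvester S H) = sylvester S H"
proof (rule sylvester_unique)
  show "pos_def S" using assms by (simp add: spd_iff)
  have "S ** transpose (sylvester S H) + transpose (sylvester S H) ** S
      = transpose (S ** sylvester S H + sylvester S H ** S)"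
    using assms by (simp add: transpose_add matrix_transpose_mul spd_iff add.commute)
  also have "\<dots> = S ** sylvester S H + sylvester S H ** S"
    using assms by (simp add: sylvester_solves spd_iff)
  finally show "S ** transpose (sylvester S H) + transpose (sylvester S H) ** S
      = S ** sylvester S H + sylvester S H ** S" .
qed

lemma sylvester_smooth: "smooth_on ({S. pos_def S} \<times> UNIV) (\<lambda>p. sylvester (fst p) (snd p))"
  by (rule bilinear_solve_smooth[OF bounded_bilinear_sylvester open_pos_def])
    (auto intro: sylvester_eq_0 sylvester_solves)

section \<open>The square root of a positive definite matrix\<close>

definition sym_part :: "real ^ 'n ^ 'n \<Rightarrow> real ^ 'n ^ 'n" where
  "sym_part A = (1 / 2) *\<^sub>R (A + transpose A)"

lemma bounded_linear_sym_part: "bounded_linear (sym_part :: real ^ 'n ^ 'n \<Rightarrow> _)"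
  unfolding sym_part_def[abs_def]
  by (intro bounded_linear_intros bounded_linear_compose[OF bounded_linear_scaleR_right] bounded_linear_add
      bounded_linear_ident bounded_linear_transpose)


lemmas sym_part_add = linear_add[OF bounded_linear.linear[OF bounded_linear_sym_part]]
  and sym_part_diff = linear_diff[OF bounded_linear.linear[OF bounded_linear_sym_part]]
  and sym_part_scaleR = linear_scale[OF bounded_linear.linear[OF bounded_linear_sym_part]]

lemma transpose_sym_part: "transpose (sym_part A) = sym_part A"
  by (simp add: sym_part_def transpose_scaleR transpose_add add.commute)

lemma sym_part_eq: "transpose A = A \<Longrightarrow> sym_part A = A"
  by (simp add: sym_part_def)

lemma sym_part_sym_part [simp]: "sym_part (sym_part A) = sym_part A"
  by (rule sym_part_eq) (rule transpose_sym_part)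

lemma pos_def_sym_part: "pos_def (sym_part A) \<longleftrightarrow> pos_def A"
  by (simp add: pos_def_def sym_part_def mat_vec.scaleR_left mat_vec.add_left inner_add_right
      dot_lmul_matrix inner_commute[of x "x v* A" for x])

lemma spd_sym_part: "spd (sym_part A) \<longleftrightarrow> pos_def A"
  by (simp add: spd_iff transpose_sym_part pos_def_sym_part)

lemma spd_square:
  assumes "spd S"
  shows "spd (S ** S)"
proof -
  have "0 < x \<bullet> ((S ** S) *v x)" if "x \<noteq> 0" for x
  proof -
    have "S *v x \<noteq> 0" using that assms pos_def_mult_eq_0 by (auto simp: spd_iff)
    moreover have "x \<bullet> ((S ** S) *v x) = (S *v x) \<bullet> (S *v x)"
      using assms by (metis inner_matrix_vector_transpose matrix_vector_mul_assoc spd_iff)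
    ultimately show ?thesis by simp
  qed
  then show ?thesis using assms by (simp add: spd_iff pos_def_def matrix_transpose_mul)
qed

text \<open>\<open>S - T\<close> solves a homogeneous Sylvester equation, as \<open>S S - T T = S (S - T) + (S - T) T\<close>.\<close>

lemma spd_sqrt_unique:
  assumes "spd S" "spd T" "S ** S = T ** T"
  shows "S = T"
proof -
  have "S ** (S - T) + (S - T) ** T = 0"
    using assms(3) by (simp add: mat_mult.diff_left mat_mult.diff_right)
  then have "S - T = 0" using assms sylvester_eq_0[of S T "S - T"] by (simp add: spd_iff)
  then show ?thesis by simp
qed

text \<open>A zero of a nonnegative quadratic form is a minimum, so the gradient vanishes there. Concretely, with
  \<open>z = A x\<close> the form at \<open>x - t z\<close> is negative for small \<open>t > 0\<close> unless \<open>z = 0\<close>.\<close>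

lemma psd_inner_eq_0:
  fixes A :: "real ^ 'n ^ 'n"
  assumes "transpose A = A" "\<And>z. 0 \<le> z \<bullet> (A *v z)" "x \<bullet> (A *v x) = 0"
  shows "A *v x = 0"
proof -
  define z where "z = A *v x"
  have sy: "x \<bullet> (A *v z) = z \<bullet> z"
    by (metis assms(1) inner_matrix_vector_transpose z_def)
  have q: "0 \<le> - 2 * t * (z \<bullet> z) + t\<^sup>2 * (z \<bullet> (A *v z))" for t
    using assms(2)[of "x - t *\<^sub>R z"] assms(3) sy
    by (simp add: mat_vec.diff_right mat_vec.scaleR_right inner_diff_left inner_diff_right
        z_def[symmetric] power2_eq_square algebra_simps)
  define m where "m = z \<bullet> (A *v z)"
  have m: "0 \<le> m" using assms(2) by (simp add: m_def)
  have "z \<bullet> z \<le> 0"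
  proof (rule ccontr)
    assume "\<not> z \<bullet> z \<le> 0"
    then have zz: "0 < z \<bullet> z" by linarith
    define t where "t = (z \<bullet> z) / (m + 1)"
    have t: "0 < t" using zz m by (simp add: t_def)
    have "t * (2 * (z \<bullet> z)) \<le> t * (t * m)" using q[of t] by (simp add: m_def power2_eq_square algebra_simps)
    then have "2 * (z \<bullet> z) \<le> t * m" using t by (simp add: mult_le_cancel_left_pos)
    also have "\<dots> \<le> z \<bullet> z" using zz m by (simp add: t_def field_simps)
    finally show False using zz by simp
  qed
  then have "z \<bullet> z = 0" by (metis inner_ge_zero order_antisym)
  then show ?thesis by (simp add: z_def)
qed

text \<open>Squaring the symmetric part and keeping the skew part extends the square of symmetric matrices to a
  self-map of the open set of matrices with positive definite form. Topological and differential
  arguments that need open domains then apply to the square root.\<close>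

definition sym_part_square :: "real ^ 'n ^ 'n \<Rightarrow> real ^ 'n ^ 'n" where
  "sym_part_square Q = sym_part Q ** sym_part Q + (Q - sym_part Q)"

lemma sym_part_sym_part_square: "sym_part (sym_part_square Q) = sym_part Q ** sym_part Q"
  by (simp add: sym_part_square_def sym_part_add sym_part_diff sym_part_eq matrix_transpose_mul transpose_sym_part)

lemma continuous_on_sym_part_square: "continuous_on S sym_part_square"
  unfolding sym_part_square_def[abs_def]
  by (intro continuous_intros mat_mult.continuous_on bounded_linear.continuous_on[OF bounded_linear_sym_part])

text \<open>Surjectivity gives existence of square roots and is a connectedness argument: the image is open by
  invariance of domain and closed by compactness, and the set of matrices with positive definite form is
  convex.\<close>

lemma sym_part_square_bij: "bij_betw sym_part_square {Q :: real ^ 'n ^ 'n. pos_def Q} {Q. pos_def Q}"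
proof -
  let ?U = "{Q :: real ^ 'n ^ 'n. pos_def Q}"
  have into: "sym_part_square ` ?U \<subseteq> ?U"
  proof safe
    fix Q :: "real ^ 'n ^ 'n" assume "pos_def Q"
    then have "pos_def (sym_part (sym_part_square Q))"
      using spd_square[of "sym_part Q"] by (simp add: sym_part_sym_part_square spd_sym_part) (simp add: spd_iff)
    then show "pos_def (sym_part_square Q)" by (simp add: pos_def_sym_part)
  qed
  have inj: "inj_on sym_part_square ?U"
  proof (rule inj_onI)
    fix P Q :: "real ^ 'n ^ 'n" assume PQ: "P \<in> ?U" "Q \<in> ?U" "sym_part_square P = sym_part_square Q"
    have "sym_part P ** sym_part P = sym_part Q ** sym_part Q"
      using arg_cong[OF PQ(3), of sym_part] by (simp add: sym_part_sym_part_square)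
    then have "sym_part P = sym_part Q"
      by (rule spd_sqrt_unique[rotated 2]) (use PQ in \<open>simp_all add: spd_sym_part\<close>)
    then show "P = Q" using PQ(3)[unfolded sym_part_square_def] by simp
  qed
  have "open (sym_part_square ` ?U)"
    by (rule invariance_of_domain[OF continuous_on_sym_part_square open_pos_def inj])
  then have op: "openin (top_of_set ?U) (sym_part_square ` ?U)"
    using into by (simp add: openin_open_eq open_pos_def)
  have "closedin (top_of_set ?U) (sym_part_square ` ?U)"
    unfolding closedin_limpt
  proof (intro conjI allI impI into)
    fix Y assume "Y islimpt sym_part_square ` ?U \<and> Y \<in> ?U"
    then obtain X where X: "\<And>n. X n \<in> sym_part_square ` ?U" "X \<longlonglongrightarrow> Y" and Y: "pos_def Y"
      unfolding islimpt_sequential by auto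
    then have "\<exists>Q. \<forall>n. pos_def (Q n) \<and> X n = sym_part_square (Q n)" by (intro choice) blast
    then obtain Q where Q: "\<And>n. pos_def (Q n)" "\<And>n. X n = sym_part_square (Q n)" by blast
    define P where "P n = sym_part (Q n)" for n
    have P: "spd (P n)" for n using Q by (simp add: P_def spd_sym_part)
    have PP: "(\<lambda>n. P n ** P n) \<longlonglongrightarrow> sym_part Y"
      using bounded_linear.tendsto[OF bounded_linear_sym_part X(2)] by (simp add: Q(2) sym_part_sym_part_square P_def)
    \<comment> \<open>The square controls the root: the Frobenius norm of \<open>P\<close> is the trace of \<open>P P\<close>.\<close>
    have nP: "(norm (P n))\<^sup>2 = trace (P n ** P n)" for n
      using P[of n] by (simp add: power2_norm_eq_inner inner_matrix_eq_trace spd_iff)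
    have "(\<lambda>n. (norm (P n))\<^sup>2) \<longlonglongrightarrow> trace (sym_part Y)"
      unfolding nP by (rule bounded_linear.tendsto[OF bounded_linear_trace PP])
    then have "Bseq (\<lambda>n. (norm (P n))\<^sup>2)" by (rule convergent_imp_Bseq[OF convergentI])
    then obtain K where K: "\<And>n. norm ((norm (P n))\<^sup>2) \<le> K" by (rule BseqE) blast
    have "norm (P n) \<le> sqrt K" for n
      using K[of n] by (intro real_le_rsqrt) simp
    then have "bounded (range P)" unfolding bounded_iff by blast
    then obtain L r where r: "strict_mono r" "(P \<circ> r) \<longlonglongrightarrow> L"
      using bounded_imp_convergent_subsequence by blast
    have "(\<lambda>n. P (r n) ** P (r n)) \<longlonglongrightarrow> L ** L"
      using mat_mult.tendsto[OF r(2) r(2)] by (simp only: o_def)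
    moreover have "(\<lambda>n. P (r n) ** P (r n)) \<longlonglongrightarrow> sym_part Y"
      using LIMSEQ_subseq_LIMSEQ[OF PP r(1)] by (simp only: o_def)
    ultimately have LL: "L ** L = sym_part Y" by (rule LIMSEQ_unique)
    have "(\<lambda>n. transpose ((P \<circ> r) n)) \<longlonglongrightarrow> transpose L"
      by (rule bounded_linear.tendsto[OF bounded_linear_transpose r(2)])
    moreover have "(\<lambda>n. transpose ((P \<circ> r) n)) = P \<circ> r"
      using P by (auto simp: spd_iff)
    ultimately have Lt: "transpose L = L" using LIMSEQ_unique r(2) by metis
    have psd: "0 \<le> z \<bullet> (L *v z)" for z
    proof (rule LIMSEQ_le_const)
      show "(\<lambda>n. z \<bullet> ((P \<circ> r) n *v z)) \<longlonglongrightarrow> z \<bullet> (L *v z)"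
        by (intro tendsto_inner tendsto_const mat_vec.tendsto r(2))
      show "\<exists>N. \<forall>n\<ge>N. 0 \<le> z \<bullet> ((P \<circ> r) n *v z)"
        using P by (cases "z = 0") (auto simp: spd_def less_imp_le)
    qed
    \<comment> \<open>The limit of the roots cannot degenerate, because its square is the positive definite \<open>sym_part Y\<close>.\<close>
    have "pos_def L" unfolding pos_def_def
    proof (intro allI impI)
      fix x :: "real ^ 'n" assume x: "x \<noteq> 0"
      have "x \<bullet> (L *v x) \<noteq> 0"
      proof
        assume "x \<bullet> (L *v x) = 0"
        then have "L *v x = 0" by (rule psd_inner_eq_0[OF Lt psd])
        then have "sym_part Y *v x = 0" by (metis LL matrix_vector_mul_assoc mat_vec.zero_right)
        then show False using pos_def_mult_eq_0[of "sym_part Y" x] Y x by (simp add: pos_def_sym_part)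
      qed
      then show "0 < x \<bullet> (L *v x)" using psd[of x] by simp
    qed
    define R where "R = L + (Y - sym_part Y)"
    have sR: "sym_part R = L" by (simp add: R_def sym_part_add sym_part_diff sym_part_eq[OF Lt])
    then have "pos_def R" using \<open>pos_def L\<close> pos_def_sym_part by metis
    moreover have "sym_part_square R = Y" unfolding sym_part_square_def sR LL by (simp add: R_def)
    ultimately show "Y \<in> sym_part_square ` ?U" by auto
  qed
  moreover have "connected ?U"
    by (intro convex_connected) (auto simp: convex_alt pos_def_convex_combination)
  moreover have "sym_part_square ` ?U \<noteq> {}"
  proof -
    have "pos_def (mat 1 :: real ^ 'n ^ 'n)" by (simp add: pos_def_def)
    then show ?thesis by auto
  qed
  ultimately have "sym_part_square ` ?U = ?U" using op unfolding connected_clopen by blast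
  with inj show ?thesis by (simp add: bij_betw_def)
qed

lemma spd_sqrt_exists:
  assumes "spd A"
  obtains S where "spd S" "S ** S = A"
proof -
  have "A \<in> sym_part_square ` {Q. pos_def Q}" using assms sym_part_square_bij by (auto simp: spd_iff bij_betw_def)
  then obtain Q where Q: "pos_def Q" "A = sym_part_square Q" by auto
  then have "A = sym_part Q ** sym_part Q" using assms by (metis sym_part_sym_part_square sym_part_eq spd_iff)
  then show ?thesis using that[of "sym_part Q"] Q by (simp add: spd_sym_part)
qed

lemma sqrt_mat:
  assumes "spd A"
  shows spd_sqrt_mat: "spd (sqrt_mat A)" and sqrt_mat_square: "sqrt_mat A ** sqrt_mat A = A"
proof -
  have "\<exists>!S. spd S \<and> S ** S = A" using assms by (metis spd_sqrt_exists spd_sqrt_unique)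
  from theI'[OF this] show "spd (sqrt_mat A)" "sqrt_mat A ** sqrt_mat A = A"
    unfolding sqrt_mat_def by auto
qed

lemma sqrt_mat_eqI: "spd S \<Longrightarrow> S ** S = A \<Longrightarrow> sqrt_mat A = S"
  by (metis spd_square spd_sqrt_mat sqrt_mat_square spd_sqrt_unique)

text \<open>Differentiating \<open>S S = Y\<close> gives the Sylvester equation \<open>S L + L S = H\<close> for the derivative \<open>L\<close>; that the
  derivative exists is the inverse function theorem for \<open>sym_part_square\<close>.\<close>

lemma sqrt_sym_part_has_derivative:
  fixes Y :: "real ^ 'n ^ 'n"
  assumes "pos_def Y"
  shows "((\<lambda>Y. sqrt_mat (sym_part Y)) has_derivative (\<lambda>H. sylvester (sqrt_mat (sym_part Y)) (sym_part H))) (at Y)"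
proof -
  define S where "S = sqrt_mat (sym_part Y)"
  have S: "spd S" "S ** S = sym_part Y" using assms by (simp_all add: S_def sqrt_mat spd_sym_part)
  define Q where "Q = S + (Y - sym_part Y)"
  have sQ: "sym_part Q = S" using S by (simp add: Q_def sym_part_add sym_part_diff sym_part_eq spd_iff)
  have Q: "pos_def Q" "sym_part_square Q = Y"
    using S sQ by (metis pos_def_sym_part spd_iff) (simp add: sym_part_square_def sQ S, simp add: Q_def)
  define g where "g Y = sqrt_mat (sym_part Y) + (Y - sym_part Y)" for Y :: "real ^ 'n ^ 'n"
  define g' where "g' H = sylvester S (sym_part H) + (H - sym_part H)" for H
  define f' where "f' H = (sym_part Q ** sym_part H + sym_part H ** sym_part Q) + (H - sym_part H)" for H
  have "(g has_derivative g') (at (sym_part_square Q))"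
  proof (rule has_derivative_inverse_strong[OF open_pos_def _ continuous_on_sym_part_square, where f' = f'])
    show "Q \<in> {Q. pos_def Q}" using Q by simp
    show "g (sym_part_square x) = x" if "x \<in> {Q. pos_def Q}" for x
    proof -
      have "sqrt_mat (sym_part x ** sym_part x) = sym_part x"
        using that by (intro sqrt_mat_eqI) (auto simp: spd_sym_part)
      then show ?thesis by (simp add: g_def sym_part_sym_part_square) (simp add: sym_part_square_def)
    qed
    show "(sym_part_square has_derivative f') (at Q)"
      unfolding sym_part_square_def[abs_def] f'_def
      by (intro has_derivative_add has_derivative_diff has_derivative_ident
          mat_mult.FDERIV bounded_linear.has_derivative[OF bounded_linear_sym_part])
    show "f' \<circ> g' = id"
    proof
      fix H :: "real ^ 'n ^ 'n"
      have "sym_part (g' H) = sylvester S (sym_part H)"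
        using S by (simp add: g'_def sym_part_add sym_part_diff sym_part_eq[OF sylvester_symmetric] transpose_sym_part)
      moreover have "g' H - sylvester S (sym_part H) = H - sym_part H" by (simp add: g'_def)
      ultimately show "(f' \<circ> g') H = id H"
        using sylvester_solves[of S "sym_part H"] S by (simp add: f'_def sQ spd_iff)
    qed
  qed
  then have "(g has_derivative g') (at Y)" by (simp add: Q)
  then have "((\<lambda>Y. g Y - (Y - sym_part Y)) has_derivative (\<lambda>H. g' H - (H - sym_part H))) (at Y)"
    by (intro has_derivative_diff has_derivative_ident bounded_linear.has_derivative[OF bounded_linear_sym_part])
  then show ?thesis by (simp add: g_def g'_def S_def)
qed

text \<open>Induction on the degree: by \<open>sqrt_sym_part_has_derivative\<close> the derivative is the smooth function
  \<open>sylvester\<close> of the root itself, so a root of class \<open>C\<^sup>n\<close> has a derivative of class \<open>C\<^sup>n\<close>.\<close>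

lemma sqrt_mat_smooth: "smooth_on {Y :: real ^ 'n ^ 'n. spd Y} sqrt_mat"
proof -
  have "Ck_on n {Y :: real ^ 'n ^ 'n. pos_def Y} (\<lambda>Y. sqrt_mat (sym_part Y))" for n
  proof (induction n)
    case 0
    show ?case
      by (auto intro!: continuous_at_imp_continuous_on has_derivative_continuous sqrt_sym_part_has_derivative)
  next
    case (Suc n)
    show ?case
    proof (rule Ck_on_SucI[OF open_pos_def])
      fix H :: "real ^ 'n ^ 'n"
      have lin: "bounded_linear (\<lambda>S :: real ^ 'n ^ 'n. (S, 0 :: real ^ 'n ^ 'n))"
        by (intro bounded_linear_Pair bounded_linear_ident bounded_linear_zero)
      have "Ck_on n {Y :: real ^ 'n ^ 'n. pos_def Y} (\<lambda>Y. (sqrt_mat (sym_part Y), 0) + (0, sym_part H))"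
        by (rule Ck_on_add[OF open_pos_def Ck_on_bounded_linear[OF lin open_pos_def Suc.IH] Ck_on_const[OF open_pos_def]])
      then have 1: "Ck_on n {Y :: real ^ 'n ^ 'n. pos_def Y} (\<lambda>Y. (sqrt_mat (sym_part Y), sym_part H))" by simp
      obtain U g where U: "open U" "{S. pos_def S} \<times> UNIV \<subseteq> U" "\<And>n. Ck_on n U g"
        "\<And>p. p \<in> {S :: real ^ 'n ^ 'n. pos_def S} \<times> UNIV \<Longrightarrow> g p = sylvester (fst p) (snd p)"
        using sylvester_smooth by (rule smooth_onE) blast
      have pds: "pos_def (sqrt_mat (sym_part Y))" if "pos_def Y" for Y :: "real ^ 'n ^ 'n"
        using that spd_sqrt_mat[of "sym_part Y"] by (simp add: spd_sym_part) (simp add: spd_iff)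
      have "Ck_on n {Y :: real ^ 'n ^ 'n. pos_def Y} (\<lambda>Y. g (sqrt_mat (sym_part Y), sym_part H))"
        by (rule Ck_on_compose[OF open_pos_def 1 U(1) U(3)]) (use U(2) pds in auto)
      then show "Ck_on n {Y :: real ^ 'n ^ 'n. pos_def Y} (\<lambda>Y. sylvester (sqrt_mat (sym_part Y)) (sym_part H))"
        by (rule Ck_on_cong[OF open_pos_def, rotated]) (subst U(4), auto simp: pds)
    qed (rule sqrt_sym_part_has_derivative, simp)
  qed
  moreover have "{Y :: real ^ 'n ^ 'n. spd Y} \<subseteq> {Y. pos_def Y}" by (auto simp: spd_iff)
  ultimately have "smooth_on {Y :: real ^ 'n ^ 'n. spd Y} (\<lambda>Y. sqrt_mat (sym_part Y))"
    by (intro smooth_onI[OF open_pos_def])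
  then show ?thesis
    by (rule smooth_on_cong[rotated]) (simp add: sym_part_eq spd_def)
qed

lemma sqrt_mat_has_derivative:
  fixes Y :: "real ^ 'n ^ 'n"
  assumes "spd Y"
  shows "(sqrt_mat has_derivative (\<lambda>H. sylvester (sqrt_mat Y) (sym_part H))) (at Y within {Y. spd Y})"
proof -
  have "((\<lambda>Y. sqrt_mat (sym_part Y)) has_derivative (\<lambda>H. sylvester (sqrt_mat (sym_part Y)) (sym_part H)))
      (at Y within {Y. spd Y})"
    by (rule has_derivative_at_withinI[OF sqrt_sym_part_has_derivative]) (use assms in \<open>simp add: spd_iff\<close>)
  moreover have e: "sym_part X = X" if "spd X" for X :: "real ^ 'n ^ 'n"
    using that by (simp add: sym_part_eq spd_def)
  ultimately have "((\<lambda>Y. sqrt_mat (sym_part Y)) has_derivative (\<lambda>H. sylvester (sqrt_mat Y) (sym_part H)))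
      (at Y within {Y. spd Y})"
    using e[OF assms] by (simp only:)
  then show ?thesis
    by (rule has_derivative_transform[rotated 2]) (use assms e in auto)
qed

section \<open>Inverse matrices\<close>

lemma matrix_inv_left: "invertible A \<Longrightarrow> matrix_inv A ** A = mat 1"
  and matrix_inv_right: "invertible A \<Longrightarrow> A ** matrix_inv A = mat 1"
  unfolding invertible_def matrix_inv_def by (metis (mono_tags, lifting) someI_ex)+

lemma open_invertible: "open {A :: real ^ 'n ^ 'n. invertible A}"
proof -
  have "continuous_on UNIV (det :: real ^ 'n ^ 'n \<Rightarrow> real)"
    unfolding det_def by (intro continuous_intros)
  then have "open (det -` (- {0 :: real}) :: (real ^ 'n ^ 'n) set)"
    by (rule open_vimage[rotated]) auto
  moreover have "det -` (- {0 :: real}) = {A :: real ^ 'n ^ 'n. invertible A}"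
    by (auto simp: invertible_det_nz)
  ultimately show ?thesis by simp
qed

lemma matrix_inv_smooth: "smooth_on {A :: real ^ 'n ^ 'n. invertible A} matrix_inv"
  and matrix_inv_has_derivative: "invertible A \<Longrightarrow>
    (matrix_inv has_derivative (\<lambda>H. - (matrix_inv A ** H ** matrix_inv A))) (at (A :: real ^ 'n ^ 'n))"
proof -
  let ?U = "{A :: real ^ 'n ^ 'n. invertible A}"
  have inj: "x = 0" if "A \<in> ?U" "A ** x = 0" for A x :: "real ^ 'n ^ 'n"
  proof -
    have "x = (matrix_inv A ** A) ** x" using that by (simp add: matrix_inv_left)
    also have "\<dots> = matrix_inv A ** (A ** x)" by (simp only: matrix_mul_assoc)
    finally show ?thesis using that by simp
  qed
  have sol: "A ** (matrix_inv A ** h) = h" if "A \<in> ?U" for A h :: "real ^ 'n ^ 'n"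
    using that by (simp add: matrix_mul_assoc matrix_inv_right)
  have sm: "smooth_on (?U \<times> UNIV) (\<lambda>p. matrix_inv (fst p) ** snd p :: real ^ 'n ^ 'n)"
    by (rule bilinear_solve_smooth[OF bounded_bilinear_matrix_mult open_invertible inj sol])
  have "smooth_on ?U (\<lambda>A. (A, mat 1 :: real ^ 'n ^ 'n))" by (intro smooth_intros)
  then have "smooth_on ?U (\<lambda>A. matrix_inv (fst (A, mat 1 :: real ^ 'n ^ 'n)) ** snd (A, mat 1 :: real ^ 'n ^ 'n))"
    by (rule smooth_on_compose[OF sm]) simp
  then show "smooth_on ?U matrix_inv" by simp
  assume A: "invertible A"
  have d: "((\<lambda>p. matrix_inv (fst p) ** snd p :: real ^ 'n ^ 'n) has_derivative
      (\<lambda>d. matrix_inv A ** (snd d - fst d ** (matrix_inv A ** mat 1)))) (at (A, mat 1))"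
    by (rule bilinear_solve_has_derivative[OF bounded_bilinear_matrix_mult open_invertible inj sol]) (use A in auto)
  have "((\<lambda>A :: real ^ 'n ^ 'n. (A, mat 1 :: real ^ 'n ^ 'n)) has_derivative (\<lambda>H. (H, 0))) (at A)"
    by (auto intro!: derivative_eq_intros)
  from has_derivative_compose[OF this d]
  show "(matrix_inv has_derivative (\<lambda>H. - (matrix_inv A ** H ** matrix_inv A))) (at A)"
    by (simp add: mat_mult.minus_right matrix_mul_assoc)
qed

lemma invertible_sqrt_mat: "spd Y \<Longrightarrow> invertible (sqrt_mat Y)"
  using spd_sqrt_mat pos_def_invertible spd_iff by blast

lemma inv_sqrt_mat_smooth: "smooth_on {Y :: real ^ 'n ^ 'n. spd Y} inv_sqrt_mat"
  unfolding inv_sqrt_mat_def[abs_def]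
  by (rule smooth_on_compose[OF matrix_inv_smooth sqrt_mat_smooth])
    (auto intro: invertible_sqrt_mat)

lemma inv_sqrt_mat_has_derivative:
  fixes Y :: "real ^ 'n ^ 'n"
  assumes "spd Y"
  shows "(inv_sqrt_mat has_derivative
    (\<lambda>H. - (inv_sqrt_mat Y ** sylvester (sqrt_mat Y) (sym_part H) ** inv_sqrt_mat Y))) (at Y within {Y. spd Y})"
  unfolding inv_sqrt_mat_def[abs_def]
  by (rule has_derivative_compose[OF sqrt_mat_has_derivative matrix_inv_has_derivative])
    (use assms in \<open>auto intro: invertible_sqrt_mat\<close>)

section \<open>Strict convexity of the energy\<close>

lemma symmetric_inner:
  fixes A :: "real ^ 'n ^ 'n"
  shows "transpose A = A \<Longrightarrow> x \<bullet> (A *v y) = (A *v x) \<bullet> y"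
  by (metis inner_matrix_vector_transpose)

lemma spd_inner: "spd A \<Longrightarrow> x \<bullet> (A *v y) = (A *v x) \<bullet> y"
  by (simp add: spd_def symmetric_inner)

text \<open>The least eigenvalue \<open>m\<close> of \<open>D = Q - P\<close>, with unit eigenvector \<open>u\<close>, cannot be negative: since
  \<open>Q Q - P P = D Q + P D\<close>, the hypothesis at \<open>u\<close> says \<open>0 \<le> m (u \<bullet> Q u + u \<bullet> P u)\<close>.\<close>

lemma sqrt_operator_monotone:
  fixes P Q :: "real ^ 'n ^ 'n"
  assumes P: "spd P" and Q: "spd Q"
    and le: "\<And>x. x \<bullet> ((P ** P) *v x) \<le> x \<bullet> ((Q ** Q) *v x)"
  shows "x \<bullet> (P *v x) \<le> x \<bullet> (Q *v x)"
proof -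
  define D where "D = Q - P"
  have Dt: "transpose D = D" using P Q by (simp add: D_def transpose_diff spd_iff)
  have "continuous_on (sphere 0 1) (\<lambda>x. x \<bullet> (D *v x))" by (intro continuous_intros)
  moreover have "sphere 0 1 \<noteq> ({} :: (real ^ 'n) set)" by simp
  ultimately obtain u where u: "u \<in> sphere 0 1" "\<And>x. x \<in> sphere 0 1 \<Longrightarrow> u \<bullet> (D *v u) \<le> x \<bullet> (D *v x)"
    using continuous_attains_inf[of "sphere 0 1" "\<lambda>x. x \<bullet> (D *v x)"] compact_sphere by blast
  define m where "m = u \<bullet> (D *v u)"
  have min: "m * (x \<bullet> x) \<le> x \<bullet> (D *v x)" for x
  proof (cases "x = 0")
    case False
    have "m \<le> (x /\<^sub>R norm x) \<bullet> (D *v (x /\<^sub>R norm x))"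
      using False unfolding m_def by (intro u) simp
    also have "\<dots> = x \<bullet> (D *v x) / (x \<bullet> x)"
      using False by (simp add: mat_vec.scaleR_right divide_inverse power2_norm_eq_inner[symmetric] power2_eq_square)
    finally show ?thesis using False by (simp add: field_simps)
  qed simp
  have uu: "u \<bullet> u = 1" using u(1) by (simp add: norm_eq_1)
  then have u0: "u \<noteq> 0" by auto
  define A where "A = D - m *\<^sub>R mat 1"
  have Ax: "A *v x = D *v x - m *\<^sub>R x" for x
    by (simp add: A_def mat_vec.diff_left mat_vec.scaleR_left)
  \<comment> \<open>The minimiser of the Rayleigh quotient is an eigenvector.\<close>
  have "A *v u = 0"
  proof (rule psd_inner_eq_0)
    show "transpose A = A" by (simp add: A_def transpose_diff transpose_scaleR Dt transpose_mat)
    show "0 \<le> z \<bullet> (A *v z)" for z using min[of z] by (simp add: Ax inner_diff_right)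
    show "u \<bullet> (A *v u) = 0" using uu by (simp add: Ax inner_diff_right m_def)
  qed
  then have Du: "D *v u = m *\<^sub>R u" by (simp add: Ax)
  have "0 \<le> m"
  proof (rule ccontr)
    assume "\<not> 0 \<le> m"
    have sP: "x \<bullet> (P *v y) = (P *v x) \<bullet> y" for x y using P by (rule spd_inner)
    have sD: "x \<bullet> (D *v y) = (D *v x) \<bullet> y" for x y using Dt by (rule symmetric_inner)
    have "Q ** Q - P ** P = D ** Q + P ** D"
      by (simp add: D_def mat_mult.diff_left mat_mult.diff_right)
    then have "u \<bullet> ((Q ** Q) *v u) - u \<bullet> ((P ** P) *v u) = u \<bullet> (D *v (Q *v u)) + u \<bullet> (P *v (D *v u))"
      by (simp add: inner_diff_right[symmetric] mat_vec.diff_left[symmetric] inner_add_right[symmetric]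
          matrix_vector_mul_assoc mat_vec.add_left[symmetric])
    also have "\<dots> = m * (u \<bullet> (Q *v u) + u \<bullet> (P *v u))"
      by (subst sD) (simp add: Du mat_vec.scaleR_right algebra_simps)
    also have "\<dots> < 0"
      using P Q u0 \<open>\<not> 0 \<le> m\<close> by (intro mult_neg_pos add_pos_pos) (auto simp: spd_def)
    finally show False using le[of u] by simp
  qed
  then have "0 \<le> x \<bullet> (D *v x)" using min[of x] by (metis inner_ge_zero mult_nonneg_nonneg order_trans)
  then show ?thesis by (simp add: D_def mat_vec.diff_left inner_diff_right)
qed

lemma norm_convex_combination:
  fixes a b :: "'a::real_inner"
  shows "(norm ((1 - s) *\<^sub>R a + s *\<^sub>R b))\<^sup>2
    = (1 - s) * (norm a)\<^sup>2 + s * (norm b)\<^sup>2 - s * (1 - s) * (norm (a - b))\<^sup>2"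
  unfolding power2_norm_eq_inner
  by (simp add: inner_add_left inner_add_right inner_diff_left inner_diff_right inner_commute algebra_simps)

text \<open>Squaring is operator convex because the square of a symmetric matrix has the form \<open>y \<mapsto> |S y|\<^sup>2\<close>;
  monotonicity of the root transfers this to concavity of the root.\<close>

lemma sqrt_operator_concave:
  fixes A B :: "real ^ 'n ^ 'n"
  assumes A: "spd A" and B: "spd B" and s: "0 \<le> s" "s \<le> 1"
  shows "(1 - s) * (x \<bullet> (sqrt_mat A *v x)) + s * (x \<bullet> (sqrt_mat B *v x))
    \<le> x \<bullet> (sqrt_mat ((1 - s) *\<^sub>R A + s *\<^sub>R B) *v x)"
proof -
  define P where "P = (1 - s) *\<^sub>R sqrt_mat A + s *\<^sub>R sqrt_mat B"
  have P: "spd P" unfolding P_def by (intro spd_convex_combination spd_sqrt_mat assms)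
  have sq: "y \<bullet> ((S ** S) *v y) = (norm (S *v y))\<^sup>2" if "spd S" for S :: "real ^ 'n ^ 'n" and y
    using spd_inner[OF that, of y "S *v y"] by (simp add: power2_norm_eq_inner matrix_vector_mul_assoc)
  have "x \<bullet> (P *v x) \<le> x \<bullet> (sqrt_mat ((1 - s) *\<^sub>R A + s *\<^sub>R B) *v x)"
  proof (rule sqrt_operator_monotone[OF P spd_sqrt_mat])
    show AB: "spd ((1 - s) *\<^sub>R A + s *\<^sub>R B)" by (intro spd_convex_combination assms)
    fix y
    have "y \<bullet> ((P ** P) *v y) = (norm ((1 - s) *\<^sub>R (sqrt_mat A *v y) + s *\<^sub>R (sqrt_mat B *v y)))\<^sup>2"
      by (simp add: sq[OF P]) (simp add: P_def mat_vec.add_left mat_vec.scaleR_left)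
    also have "\<dots> \<le> (1 - s) * (norm (sqrt_mat A *v y))\<^sup>2 + s * (norm (sqrt_mat B *v y))\<^sup>2"
      unfolding norm_convex_combination using s by simp
    also have "\<dots> = y \<bullet> (((1 - s) *\<^sub>R A + s *\<^sub>R B) *v y)"
      using A B by (simp add: sq[symmetric] spd_sqrt_mat sqrt_mat_square mat_vec.add_left mat_vec.scaleR_left inner_add_right)
    finally show "y \<bullet> ((P ** P) *v y) \<le> y \<bullet> ((sqrt_mat ((1 - s) *\<^sub>R A + s *\<^sub>R B) **
        sqrt_mat ((1 - s) *\<^sub>R A + s *\<^sub>R B)) *v y)"
      by (simp add: sqrt_mat_square[OF AB])
  qed
  then show ?thesis by (simp add: P_def mat_vec.add_left mat_vec.scaleR_left inner_add_right)
qed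

lemma matrix_inv_symmetric:
  fixes A :: "real ^ 'n ^ 'n"
  assumes "invertible A" "transpose A = A"
  shows "transpose (matrix_inv A) = matrix_inv A"
proof -
  have "transpose (matrix_inv A) = transpose (matrix_inv A) ** (A ** matrix_inv A)"
    using assms by (simp add: matrix_inv_right)
  also have "\<dots> = transpose (A ** matrix_inv A) ** matrix_inv A"
    using assms by (simp add: matrix_transpose_mul matrix_mul_assoc)
  also have "\<dots> = matrix_inv A" using assms by (simp add: matrix_inv_right transpose_mat)
  finally show ?thesis .
qed

lemma spd_matrix_inv:
  fixes A :: "real ^ 'n ^ 'n"
  assumes "spd A"
  shows "spd (matrix_inv A)"
proof -
  have A: "invertible A" using assms pos_def_invertible by (auto simp: spd_iff)
  have "0 < x \<bullet> (matrix_inv A *v x)" if "x \<noteq> 0" for x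
  proof -
    define w where "w = matrix_inv A *v x"
    have x: "x = A *v w" unfolding w_def by (simp add: matrix_vector_mul_assoc matrix_inv_right[OF A])
    then have "w \<noteq> 0" using that by auto
    then have "0 < w \<bullet> (A *v w)" using assms by (simp add: spd_def)
    then show ?thesis unfolding w_def[symmetric] by (subst x) (simp add: inner_commute)
  qed
  then show ?thesis using A assms by (simp add: spd_iff pos_def_def matrix_inv_symmetric)
qed

lemma spd_inv_sqrt_mat: "spd Y \<Longrightarrow> spd (inv_sqrt_mat Y)"
  by (simp add: inv_sqrt_mat_def spd_matrix_inv spd_sqrt_mat)

lemma sqrt_mat_inv_sqrt_mat: "spd Y \<Longrightarrow> sqrt_mat Y ** inv_sqrt_mat Y = mat 1"
  and inv_sqrt_mat_sqrt_mat: "spd Y \<Longrightarrow> inv_sqrt_mat Y ** sqrt_mat Y = mat 1"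
  by (simp_all add: inv_sqrt_mat_def matrix_inv_left matrix_inv_right invertible_sqrt_mat)

text \<open>By duality \<open>x \<bullet> S^(-1) x\<close> is the maximum over \<open>w\<close> of \<open>2 w \<bullet> x - w \<bullet> S w\<close>. For \<open>S\<close> the square root of a
  matrix, each of these functions is jointly convex by concavity of the root. The proof uses the maximiser
  \<open>w\<close> of the convex combination as a competitor at both end points.\<close>

lemma inv_sqrt_form_convex:
  fixes A B :: "real ^ 'n ^ 'n" and x y :: "real ^ 'n"
  assumes A: "spd A" and B: "spd B" and s: "0 \<le> s" "s \<le> 1"
  defines "Y \<equiv> (1 - s) *\<^sub>R A + s *\<^sub>R B" and "z \<equiv> (1 - s) *\<^sub>R x + s *\<^sub>R y"
  shows "z \<bullet> (inv_sqrt_mat Y *v z)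
    \<le> (1 - s) * (x \<bullet> (inv_sqrt_mat A *v x)) + s * (y \<bullet> (inv_sqrt_mat B *v y))"
proof -
  have Y: "spd Y" unfolding Y_def by (intro spd_convex_combination assms)
  define w where "w = inv_sqrt_mat Y *v z"
  have z: "sqrt_mat Y *v w = z" by (simp add: w_def matrix_vector_mul_assoc sqrt_mat_inv_sqrt_mat[OF Y])
  have fenchel: "2 * (w \<bullet> x) - w \<bullet> (sqrt_mat X *v w) \<le> x \<bullet> (inv_sqrt_mat X *v x)" if X: "spd X" for X :: "real ^ 'n ^ 'n" and x
  proof -
    define p where "p = inv_sqrt_mat X *v x"
    have x: "sqrt_mat X *v p = x" by (simp add: p_def matrix_vector_mul_assoc sqrt_mat_inv_sqrt_mat[OF X])
    have S: "spd (sqrt_mat X)" by (rule spd_sqrt_mat[OF X])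
    have "p \<bullet> (sqrt_mat X *v w) = x \<bullet> w"
      using spd_inner[OF S, of p w] x by simp
    moreover have "0 \<le> (w - p) \<bullet> (sqrt_mat X *v (w - p))"
      using S by (cases "w - p = 0") (auto simp: spd_def less_imp_le simp del: right_minus_eq)
    ultimately show ?thesis
      by (simp add: mat_vec.diff_right inner_diff_left inner_diff_right x inner_commute p_def[symmetric])
  qed
  have "z \<bullet> (inv_sqrt_mat Y *v z) = 2 * (w \<bullet> z) - w \<bullet> (sqrt_mat Y *v w)"
    by (simp add: z) (simp add: w_def inner_commute)
  also have "\<dots> \<le> 2 * (w \<bullet> z) - ((1 - s) * (w \<bullet> (sqrt_mat A *v w)) + s * (w \<bullet> (sqrt_mat B *v w)))"
    unfolding Y_def using sqrt_operator_concave[OF A B s, of w] by simp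
  also have "\<dots> = (1 - s) * (2 * (w \<bullet> x) - w \<bullet> (sqrt_mat A *v w))
      + s * (2 * (w \<bullet> y) - w \<bullet> (sqrt_mat B *v w))"
    by (simp add: z_def inner_add_right algebra_simps)
  also have "\<dots> \<le> (1 - s) * (x \<bullet> (inv_sqrt_mat A *v x)) + s * (y \<bullet> (inv_sqrt_mat B *v y))"
    using s by (intro add_mono mult_left_mono fenchel A B) auto
  finally show ?thesis .
qed

lemma trace_C_mat: "trace (C_mat F Y) = (\<Sum>i\<in>UNIV. row i F \<bullet> (inv_sqrt_mat Y *v row i F))"
  unfolding C_mat_def trace_def
proof (rule sum.cong)
  fix i :: 3
  have "(F ** (inv_sqrt_mat Y ** transpose F)) $ i $ i = (\<Sum>k\<in>UNIV. F $ i $ k * (inv_sqrt_mat Y ** transpose F) $ k $ i)"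
    by (simp add: matrix_matrix_mult_def)
  also have "\<dots> = row i F \<bullet> (inv_sqrt_mat Y *v row i F)"
    by (simp add: inner_vec_def row_def matrix_vector_mult_def matrix_matrix_mult_def transpose_def)
  finally show "(F ** inv_sqrt_mat Y ** transpose F) $ i $ i = row i F \<bullet> (inv_sqrt_mat Y *v row i F)"
    by (simp add: matrix_mul_assoc)
qed simp

lemma row_linear: "row i ((1 - s) *\<^sub>R F + s *\<^sub>R G) = (1 - s) *\<^sub>R row i F + s *\<^sub>R row i G" for F G :: mat3
  by (simp add: row_def vec_eq_iff)

lemma trace_C_mat_convex:
  assumes "spd A" "spd B" "0 \<le> s" "s \<le> 1"
  shows "trace (C_mat ((1 - s) *\<^sub>R F + s *\<^sub>R G) ((1 - s) *\<^sub>R A + s *\<^sub>R B))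
    \<le> (1 - s) * trace (C_mat F A) + s * trace (C_mat G B)"
  unfolding trace_C_mat row_linear sum_distrib_left sum.distrib[symmetric]
  by (intro sum_mono inv_sqrt_form_convex assms)

text \<open>For fixed \<open>Y\<close> the trace is a positive definite quadratic form in the rows of \<open>F\<close>. Between states with
  different \<open>Y\<close> the term \<open>|Y|\<^sup>2\<close> of the energy provides strictness.\<close>

lemma trace_C_mat_strictly_convex:
  assumes Y: "spd Y" and s: "0 < s" "s < 1" and FG: "F \<noteq> G"
  shows "trace (C_mat ((1 - s) *\<^sub>R F + s *\<^sub>R G) Y) < (1 - s) * trace (C_mat F Y) + s * trace (C_mat G Y)"
proof -
  define q where "q x = x \<bullet> (inv_sqrt_mat Y *v x)" for x
  have Z: "spd (inv_sqrt_mat Y)" by (rule spd_inv_sqrt_mat[OF Y])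
  have sy: "x \<bullet> (inv_sqrt_mat Y *v y) = y \<bullet> (inv_sqrt_mat Y *v x)" for x y
    using spd_inner[OF Z, of x y] by (simp add: inner_commute)
  have id: "q ((1 - s) *\<^sub>R x + s *\<^sub>R y) = (1 - s) * q x + s * q y - s * (1 - s) * q (x - y)" for x y
    unfolding q_def using sy[of x y]
    by (simp add: mat_vec.add_right mat_vec.diff_right mat_vec.scaleR_right inner_add_left inner_add_right
        inner_diff_left inner_diff_right algebra_simps)
  have nn: "0 \<le> q x" for x using Z unfolding q_def spd_def by (cases "x = 0") (auto simp: less_imp_le)
  obtain i where i: "row i F \<noteq> row i G" using FG by (auto simp: row_def vec_eq_iff)
  then have "0 < q (row i F - row i G)" using Z unfolding q_def spd_def by simp
  then have "0 < (\<Sum>i\<in>UNIV. s * (1 - s) * q (row i F - row i G))"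
    using s nn by (intro sum_pos2[of _ i]) auto
  then show ?thesis
    unfolding trace_C_mat row_linear q_def[symmetric] id by (simp add: sum.distrib sum_subtractf sum_distrib_left)
qed

lemma ln_concave_strict:
  fixes a b s :: real
  assumes "0 < a" "0 < b" "0 < s" "s < 1"
  shows ln_concave_le: "(1 - s) * ln a + s * ln b \<le> ln ((1 - s) * a + s * b)"
    and ln_concave_less: "a \<noteq> b \<Longrightarrow> (1 - s) * ln a + s * ln b < ln ((1 - s) * a + s * b)"
proof -
  define m where "m = (1 - s) * a + s * b"
  have m: "0 < m" unfolding m_def using assms by (intro add_pos_pos mult_pos_pos) auto
  have z: "(1 - s) * (a / m - 1) + s * (b / m - 1) = 0"
    using m by (simp add: field_simps) (simp add: m_def algebra_simps)
  have l: "ln x - ln m \<le> x / m - 1" if "0 < x" for x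
    using ln_le_minus_one[of "x / m"] that m by (simp add: ln_div)
  have "(1 - s) * (ln a - ln m) + s * (ln b - ln m) \<le> (1 - s) * (a / m - 1) + s * (b / m - 1)"
    using assms by (intro add_mono mult_left_mono l) auto
  then show "(1 - s) * ln a + s * ln b \<le> ln m" using z by (simp add: algebra_simps)
  assume ab: "a \<noteq> b"
  have "a \<noteq> m" using ab assms unfolding m_def by (simp add: algebra_simps)
  then have "ln a - ln m < a / m - 1"
    using l[OF assms(1)] ln_eq_minus_one[of "a / m"] assms m by (auto simp: ln_div order.order_iff_strict)
  then have "(1 - s) * (ln a - ln m) + s * (ln b - ln m) < (1 - s) * (a / m - 1) + s * (b / m - 1)"
    using assms by (intro add_less_le_mono mult_left_mono mult_strict_left_mono l) auto
  then show "(1 - s) * ln a + s * ln b < ln m" using z by (simp add: algebra_simps)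
qed

lemma exp_convex_strict:
  fixes a b s :: real
  assumes "0 < s" "s < 1"
  shows exp_convex_le: "exp ((1 - s) * a + s * b) \<le> (1 - s) * exp a + s * exp b"
    and exp_convex_less: "a \<noteq> b \<Longrightarrow> exp ((1 - s) * a + s * b) < (1 - s) * exp a + s * exp b"
proof -
  have e: "(1 - s) * exp a + s * exp b > 0" using assms by (intro add_pos_pos mult_pos_pos) auto
  have "(1 - s) * a + s * b \<le> ln ((1 - s) * exp a + s * exp b)"
    using ln_concave_le[of "exp a" "exp b" s] assms by simp
  then show "exp ((1 - s) * a + s * b) \<le> (1 - s) * exp a + s * exp b" using e by (simp add: ln_ge_iff)
  assume "a \<noteq> b"
  then have "(1 - s) * a + s * b < ln ((1 - s) * exp a + s * exp b)"
    using ln_concave_less[of "exp a" "exp b" s] assms by simp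
  then show "exp ((1 - s) * a + s * b) < (1 - s) * exp a + s * exp b" using e by (metis exp_less_mono exp_ln)
qed

text \<open>The logarithm of the first summand of the equation of state at the modified entropy, divided by its
  constant prefactor \<open>cV \<theta>_ref\<close>, as a function of the specific volume \<open>V\<close>, with \<open>c\<close> standing for \<open>tr C\<close> (see \<open>e_s_tilde_eq\<close>).\<close>

definition thermal_exponent :: "material \<Rightarrow> real \<Rightarrow> real \<Rightarrow> real \<Rightarrow> real \<Rightarrow> real" where
  "thermal_exponent M V \<eta> c y =
     (gam M - 1) * (- ln (V - covol M) - ln (rho_ref M))
     + (\<eta> + alpha M / 2 * (K1 M * c - kB M * (2 * ln (rhoR M) + 2 * ln V + ln y / 2))) / cV M"

text \<open>The exponent is increasing in \<open>c\<close>, so an upper bound for the trace of the convex combination is enough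
  in place of the trace itself.\<close>

lemma thermal_exponent_convex:
  assumes "alpha M > 0" "K1 M > 0" "kB M > 0" "cV M > 0" "gam M > 1" "covol M > 0" "0 < s" "s < 1"
    and "covol M < V" "covol M < W" "0 < y" "0 < z"
    and c: "c \<le> (1 - s) * c0 + s * c1"
  shows thermal_exponent_le: "thermal_exponent M ((1 - s) * V + s * W) ((1 - s) * \<eta> + s * \<sigma>) c ((1 - s) * y + s * z)
      \<le> (1 - s) * thermal_exponent M V \<eta> c0 y + s * thermal_exponent M W \<sigma> c1 z"
    and thermal_exponent_less: "V \<noteq> W \<or> y \<noteq> z \<Longrightarrow>
      thermal_exponent M ((1 - s) * V + s * W) ((1 - s) * \<eta> + s * \<sigma>) c ((1 - s) * y + s * z)
      < (1 - s) * thermal_exponent M V \<eta> c0 y + s * thermal_exponent M W \<sigma> c1 z"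
proof -
  define a where "a = gam M - 1"
  define k where "k = alpha M * kB M / cV M"
  define h where "h = alpha M * K1 M / (2 * cV M)"
  have pos: "0 < a" "0 < k" "0 < h" using assms by (simp_all add: a_def k_def h_def)
  have form: "thermal_exponent M V \<eta> c y = - (a * ln (V - covol M)) + (\<eta> / cV M + h * c - k * ln V - k / 4 * ln y)
     - (a * ln (rho_ref M) + k * ln (rhoR M))" for V \<eta> c y
    using \<open>cV M > 0\<close> by (simp add: thermal_exponent_def a_def k_def h_def field_simps)
  define d1 where "d1 = ln ((1 - s) * (V - covol M) + s * (W - covol M)) - ((1 - s) * ln (V - covol M) + s * ln (W - covol M))"
  define d2 where "d2 = ln ((1 - s) * V + s * W) - ((1 - s) * ln V + s * ln W)"
  define d3 where "d3 = ln ((1 - s) * y + s * z) - ((1 - s) * ln y + s * ln z)"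
  define d4 where "d4 = (1 - s) * c0 + s * c1 - c"
  have d: "0 \<le> d1" "0 \<le> d2" "0 \<le> d3" "0 \<le> d4"
    unfolding d1_def d2_def d3_def d4_def using assms by (simp_all add: ln_concave_le)
  have V: "(1 - s) * V + s * W - covol M = (1 - s) * (V - covol M) + s * (W - covol M)"
    by (simp add: algebra_simps)
  \<comment> \<open>The convexity defect is a positive combination of the nonnegative defects of three logarithms and of \<open>c\<close>.\<close>
  have gap: "(1 - s) * thermal_exponent M V \<eta> c0 y + s * thermal_exponent M W \<sigma> c1 z
     - thermal_exponent M ((1 - s) * V + s * W) ((1 - s) * \<eta> + s * \<sigma>) c ((1 - s) * y + s * z)
     = a * d1 + k * d2 + k / 4 * d3 + h * d4"
    unfolding form V d1_def d2_def d3_def d4_def by (simp add: algebra_simps add_divide_distrib diff_divide_distrib)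
  have "0 \<le> a * d1 + k * d2 + k / 4 * d3 + h * d4" using d pos by simp
  then show "thermal_exponent M ((1 - s) * V + s * W) ((1 - s) * \<eta> + s * \<sigma>) c ((1 - s) * y + s * z)
      \<le> (1 - s) * thermal_exponent M V \<eta> c0 y + s * thermal_exponent M W \<sigma> c1 z"
    using gap by linarith
  assume "V \<noteq> W \<or> y \<noteq> z"
  then have "0 < a * d1 + k * d2 + k / 4 * d3 + h * d4"
  proof
    assume "V \<noteq> W"
    then have "0 < d2" unfolding d2_def using assms ln_concave_less[of V W s] by simp
    then have "0 < k * d2" using pos by simp
    moreover have "0 \<le> a * d1" "0 \<le> k / 4 * d3" "0 \<le> h * d4" using d pos by simp_all
    ultimately show ?thesis by linarith
  next
    assume "y \<noteq> z"
    then have "0 < d3" unfolding d3_def using assms ln_concave_less[of y z s] by simp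
    then have "0 < k / 4 * d3" using pos by simp
    moreover have "0 \<le> a * d1" "0 \<le> k * d2" "0 \<le> h * d4" using d pos by simp_all
    ultimately show ?thesis by linarith
  qed
  then show "thermal_exponent M ((1 - s) * V + s * W) ((1 - s) * \<eta> + s * \<sigma>) c ((1 - s) * y + s * z)
      < (1 - s) * thermal_exponent M V \<eta> c0 y + s * thermal_exponent M W \<sigma> c1 z"
    using gap by linarith
qed

lemma e_s_tilde_eq:
  assumes "rhoR M > 0" "cV M > 0" "rho_ref M > 0" "covol M > 0"
    and "0 < \<rho>" "\<rho> < 1 / covol M" "0 < y"
  shows "e_s_tilde M \<rho> \<eta> F Y y = cV M * theta_ref M * exp (thermal_exponent M (1 / \<rho>) \<eta> (trace (C_mat F Y)) y)
     + (1 / \<rho> - covol M) * pinf M + qref M"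
proof -
  have b: "0 < 1 - covol M * \<rho>" using assms by (simp add: field_simps)
  define r where "r = \<rho> / rho_ref M * (1 / (1 - covol M * \<rho>))"
  have r: "0 < r" using assms b by (simp add: r_def)
  have V: "1 / \<rho> - covol M = (1 - covol M * \<rho>) / \<rho>" using assms by (simp add: field_simps)
  have lnr: "ln r = - ln (1 / \<rho> - covol M) - ln (rho_ref M)"
    using assms b by (simp add: r_def V ln_mult ln_div)
  have lny: "ln ((rhoR M / \<rho>)\<^sup>2 * y powr (1 / 2)) = 2 * ln (rhoR M) + 2 * ln (1 / \<rho>) + ln y / 2"
    using assms by (simp add: ln_mult ln_div ln_realpow ln_powr)
  have "thermal_exponent M (1 / \<rho>) \<eta> (trace (C_mat F Y)) y = (gam M - 1) * ln r + eta_hat M \<rho> \<eta> F Y y / cV M"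
    unfolding thermal_exponent_def eta_hat_def lny lnr by simp
  then show ?thesis
    unfolding e_s_tilde_def e_s_def r_def[symmetric] using r by (simp add: powr_def exp_add)
qed

text \<open>All summands are convex. Strictness is due to the squares if \<open>v\<close>, \<open>j\<close> or \<open>Y\<close> differ, to
  \<open>K0 tr C\<close> if only \<open>F\<close> differs among \<open>F\<close> and \<open>Y\<close>, to the logarithms if \<open>\<rho>\<close> or \<open>y\<close> differ, and to the
  exponential function if \<open>\<eta>\<close> alone differs. The variable in place of \<open>\<rho>\<close> is \<open>1/\<rho>\<close>.\<close>

lemma E_tilde_strictly_convex:
  fixes s :: real
  assumes M: "alpha M > 0" "K0 M > 0" "K1 M > 0" "kB M > 0" "tau0 M > 0" "kappa M > 0" "rhoR M > 0" "eref M > 0"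
    "cV M > 0" "theta_ref M > 0" "rho_ref M > 0" "gam M > 1" "covol M > 0"
    and s: "0 < s" "s < 1"
    and r: "0 < \<rho>0" "\<rho>0 < 1 / covol M" "0 < \<rho>1" "\<rho>1 < 1 / covol M" "0 < \<rho>" "\<rho> < 1 / covol M"
    and V: "1 / \<rho> = (1 - s) * (1 / \<rho>0) + s * (1 / \<rho>1)"
    and Y: "spd Y0" "spd Y1" and y: "0 < y0" "0 < y1"
    and ne: "(\<rho>0, \<eta>0, j0, v0, F0, Y0, y0) \<noteq> (\<rho>1, \<eta>1, j1, v1, F1, Y1, y1)"
  shows "E_tilde M (\<rho>, (1 - s) * \<eta>0 + s * \<eta>1, (1 - s) *\<^sub>R j0 + s *\<^sub>R j1, (1 - s) *\<^sub>R v0 + s *\<^sub>R v1,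
      (1 - s) *\<^sub>R F0 + s *\<^sub>R F1, (1 - s) *\<^sub>R Y0 + s *\<^sub>R Y1, (1 - s) * y0 + s * y1)
    < (1 - s) * E_tilde M (\<rho>0, \<eta>0, j0, v0, F0, Y0, y0) + s * E_tilde M (\<rho>1, \<eta>1, j1, v1, F1, Y1, y1)"
proof -
  define c where "c = trace (C_mat ((1 - s) *\<^sub>R F0 + s *\<^sub>R F1) ((1 - s) *\<^sub>R Y0 + s *\<^sub>R Y1))"
  define c0 where "c0 = trace (C_mat F0 Y0)"
  define c1 where "c1 = trace (C_mat F1 Y1)"
  define L where "L = thermal_exponent M (1 / \<rho>) ((1 - s) * \<eta>0 + s * \<eta>1) c ((1 - s) * y0 + s * y1)"
  define L0 where "L0 = thermal_exponent M (1 / \<rho>0) \<eta>0 c0 y0"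
  define L1 where "L1 = thermal_exponent M (1 / \<rho>1) \<eta>1 c1 y1"
  define A where "A = cV M * theta_ref M"
  have A: "0 < A" using M by (simp add: A_def)
  have V': "covol M < 1 / \<rho>0" "covol M < 1 / \<rho>1" using r M by (simp_all add: field_simps)
  have ys: "0 < (1 - s) * y0 + s * y1" using s y by (intro add_pos_pos mult_pos_pos) auto
  \<comment> \<open>The convexity defects of the individual summands of \<open>E\<close>; the exponential contributes two, one of
    its argument and one of \<open>exp\<close> itself.\<close>
  define gv where "gv = 1 / 2 * (s * (1 - s) * (norm (v0 - v1))\<^sup>2)"
  define gj where "gj = tau0 M / (2 * kappa M) * (s * (1 - s) * (norm (j0 - j1))\<^sup>2)"
  define gY where "gY = eref M / 2 * (s * (1 - s) * (norm (Y0 - Y1))\<^sup>2)"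
  define gc where "gc = alpha M / 2 * K0 M * ((1 - s) * c0 + s * c1 - c)"
  define gL where "gL = A * (exp ((1 - s) * L0 + s * L1) - exp L)"
  define ge where "ge = A * ((1 - s) * exp L0 + s * exp L1 - exp ((1 - s) * L0 + s * L1))"
  have cc: "c \<le> (1 - s) * c0 + s * c1"
    unfolding c_def c0_def c1_def using s by (intro trace_C_mat_convex Y) auto
  have LL: "L \<le> (1 - s) * L0 + s * L1"
    unfolding L_def L0_def L1_def V by (rule thermal_exponent_le) (use M s V' y cc in auto)
  have nn: "0 \<le> gv" "0 \<le> gj" "0 \<le> gY" "0 \<le> gc" "0 \<le> gL" "0 \<le> ge"
    unfolding gv_def gj_def gY_def gc_def gL_def ge_def
    using M s A cc LL exp_convex_le[OF s, of L0 L1] by simp_all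
  have gap: "(1 - s) * E_tilde M (\<rho>0, \<eta>0, j0, v0, F0, Y0, y0) + s * E_tilde M (\<rho>1, \<eta>1, j1, v1, F1, Y1, y1)
     - E_tilde M (\<rho>, (1 - s) * \<eta>0 + s * \<eta>1, (1 - s) *\<^sub>R j0 + s *\<^sub>R j1, (1 - s) *\<^sub>R v0 + s *\<^sub>R v1,
      (1 - s) *\<^sub>R F0 + s *\<^sub>R F1, (1 - s) *\<^sub>R Y0 + s *\<^sub>R Y1, (1 - s) * y0 + s * y1)
     = gv + gj + gY + gc + gL + ge"
  proof -
    have e0: "E_tilde M (\<rho>0, \<eta>0, j0, v0, F0, Y0, y0) = 1 / 2 * (norm v0)\<^sup>2 + (A * exp L0 + (1 / \<rho>0 - covol M) * pinf M + qref M)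
       + tau0 M / (2 * kappa M) * (norm j0)\<^sup>2 + alpha M / 2 * K0 M * c0 + eref M / 2 * (norm Y0)\<^sup>2"
      using M r y by (simp add: E_tilde_def e_s_tilde_eq L0_def c0_def A_def)
    have e1: "E_tilde M (\<rho>1, \<eta>1, j1, v1, F1, Y1, y1) = 1 / 2 * (norm v1)\<^sup>2 + (A * exp L1 + (1 / \<rho>1 - covol M) * pinf M + qref M)
       + tau0 M / (2 * kappa M) * (norm j1)\<^sup>2 + alpha M / 2 * K0 M * c1 + eref M / 2 * (norm Y1)\<^sup>2"
      using M r y by (simp add: E_tilde_def e_s_tilde_eq L1_def c1_def A_def)
    have e: "E_tilde M (\<rho>, (1 - s) * \<eta>0 + s * \<eta>1, (1 - s) *\<^sub>R j0 + s *\<^sub>R j1, (1 - s) *\<^sub>R v0 + s *\<^sub>R v1,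
      (1 - s) *\<^sub>R F0 + s *\<^sub>R F1, (1 - s) *\<^sub>R Y0 + s *\<^sub>R Y1, (1 - s) * y0 + s * y1)
      = 1 / 2 * (norm ((1 - s) *\<^sub>R v0 + s *\<^sub>R v1))\<^sup>2 + (A * exp L + (1 / \<rho> - covol M) * pinf M + qref M)
       + tau0 M / (2 * kappa M) * (norm ((1 - s) *\<^sub>R j0 + s *\<^sub>R j1))\<^sup>2 + alpha M / 2 * K0 M * c
       + eref M / 2 * (norm ((1 - s) *\<^sub>R Y0 + s *\<^sub>R Y1))\<^sup>2"
      using M r ys by (simp add: E_tilde_def e_s_tilde_eq L_def c_def A_def)
    show ?thesis
      unfolding e0 e1 e norm_convex_combination V gv_def gj_def gY_def gc_def gL_def ge_def
      by (simp add: algebra_simps add_divide_distrib diff_divide_distrib)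
  qed
  have "0 < gv + gj + gY + gc + gL + ge"
  proof -
    consider "v0 \<noteq> v1" | "j0 \<noteq> j1" | "Y0 \<noteq> Y1" | "Y0 = Y1" "F0 \<noteq> F1" | "\<rho>0 \<noteq> \<rho>1 \<or> y0 \<noteq> y1"
      | "\<rho>0 = \<rho>1" "y0 = y1" "F0 = F1" "Y0 = Y1" "\<eta>0 \<noteq> \<eta>1"
      using ne by blast
    then have "0 < gv \<or> 0 < gj \<or> 0 < gY \<or> 0 < gc \<or> 0 < gL \<or> 0 < ge"
    proof cases
      case 1
      then show ?thesis using s by (simp add: gv_def)
    next
      case 2
      then show ?thesis using s M by (simp add: gj_def)
    next
      case 3
      then show ?thesis using s M by (simp add: gY_def)
    next
      case 4
      have "(1 - s) *\<^sub>R Y1 + s *\<^sub>R Y1 = Y1" by (simp flip: scaleR_add_left)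
      then have "c < (1 - s) * c0 + s * c1"
        unfolding c_def c0_def c1_def using 4 trace_C_mat_strictly_convex[OF Y(2) s 4(2)] by simp
      then show ?thesis using M by (simp add: gc_def)
    next
      case 5
      then have "1 / \<rho>0 \<noteq> 1 / \<rho>1 \<or> y0 \<noteq> y1" by simp
      then have "L < (1 - s) * L0 + s * L1"
        unfolding L_def L0_def L1_def V by (intro thermal_exponent_less) (use M s V' y cc in auto)
      then show ?thesis using A by (simp add: gL_def)
    next
      case 6
      then have "L0 \<noteq> L1" using M by (simp add: L0_def L1_def c0_def c1_def thermal_exponent_def)
      then show ?thesis using A exp_convex_less[OF s, of L0 L1] by (simp add: ge_def)
    qed
    then show ?thesis using nn by linarith
  qed
  then show ?thesis using gap by linarith
qed

text \<open>Dropping invertibility of \<open>F\<close> makes the set of states convex. On conserved variables, definiteness of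
  \<open>\<rho>Y\<close> and positivity of \<open>\<rho>y\<close> express those of \<open>Y\<close> and \<open>y\<close>.\<close>

definition convex_states :: "material \<Rightarrow> state set" where
  "convex_states M = {(\<rho>, m, J, P, A, B, z). 0 < \<rho> \<and> \<rho> < 1 / covol M \<and> spd B \<and> 0 < z}"

lemma spd_scaleR: "0 < r \<Longrightarrow> spd B \<Longrightarrow> spd (r *\<^sub>R B)"
  by (simp add: spd_def transpose_scaleR mat_vec.scaleR_left)

lemma states_subset: "states M \<subseteq> convex_states M"
  by (auto simp: states_def convex_states_def intro: spd_scaleR)

lemma convex_convex_states: "convex (convex_states M)"
  unfolding convex_alt
proof (intro ballI allI impI)
  fix u w :: state and t :: real
  assume u: "u \<in> convex_states M" and w: "w \<in> convex_states M" and t: "0 \<le> t \<and> t \<le> 1"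
  obtain \<rho>0 m0 J0 P0 A0 B0 z0 where u': "u = (\<rho>0, m0, J0, P0, A0, B0, z0)" by (metis prod.exhaust)
  obtain \<rho>1 m1 J1 P1 A1 B1 z1 where w': "w = (\<rho>1, m1, J1, P1, A1, B1, z1)" by (metis prod.exhaust)
  have iv: "(1 - t) * a + t * b \<in> {0<..}" if "0 < a" "0 < b" for a b :: real
    using convexD_alt[OF convex_real_interval(3)[of 0], of a b t] that t by simp
  have iv2: "(1 - t) * a + t * b \<in> {..<c}" if "a < c" "b < c" for a b c :: real
    using convexD_alt[OF convex_real_interval(4)[of c], of a b t] that t by simp
  show "(1 - t) *\<^sub>R u + t *\<^sub>R w \<in> convex_states M"
    using u w t iv[of \<rho>0 \<rho>1] iv[of z0 z1] iv2[of \<rho>0 "1 / covol M" \<rho>1]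
    by (simp add: convex_states_def u' w' spd_convex_combination)
qed

text \<open>A point dividing a segment of conserved variables in the ratio given by \<open>t\<close> has primitive variables,
  with \<open>1/\<rho>\<close> for \<open>\<rho>\<close>, dividing the corresponding segment in the ratio given by the mass fraction
  \<open>s = t \<rho>\<^sub>1 / \<rho>\<close>.\<close>

lemma rho_E_strictly_convex:
  assumes M: "alpha M > 0" "K0 M > 0" "K1 M > 0" "kB M > 0" "tau0 M > 0" "kappa M > 0" "rhoR M > 0" "eref M > 0"
    "cV M > 0" "theta_ref M > 0" "rho_ref M > 0" "gam M > 1" "covol M > 0"
  shows "strictly_convex_on (convex hull (states M)) (rho_E M)"
proof -
  have sub: "convex hull (states M) \<subseteq> convex_states M"
    by (intro hull_minimal states_subset convex_convex_states)
  have "rho_E M ((1 - t) *\<^sub>R u + t *\<^sub>R w) < (1 - t) * rho_E M u + t * rho_E M w"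
    if uw: "u \<in> convex_states M" "w \<in> convex_states M" "u \<noteq> w" and t: "0 < t" "t < 1" for u w t
  proof -
    obtain \<rho>0 m0 J0 P0 A0 B0 z0 where u: "u = (\<rho>0, m0, J0, P0, A0, B0, z0)" by (metis prod.exhaust)
    obtain \<rho>1 m1 J1 P1 A1 B1 z1 where w: "w = (\<rho>1, m1, J1, P1, A1, B1, z1)" by (metis prod.exhaust)
    define \<rho> where "\<rho> = (1 - t) * \<rho>0 + t * \<rho>1"
    define s where "s = t * \<rho>1 / \<rho>"
    have r: "0 < \<rho>0" "\<rho>0 < 1 / covol M" "0 < \<rho>1" "\<rho>1 < 1 / covol M" "spd B0" "spd B1" "0 < z0" "0 < z1"
      using uw by (simp_all add: u w convex_states_def)
    have "(1 - t) *\<^sub>R u + t *\<^sub>R w \<in> convex_states M"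
      using convexD_alt[OF convex_convex_states uw(1,2)] t by simp
    then have r': "0 < \<rho>" "\<rho> < 1 / covol M" by (simp_all add: u w convex_states_def \<rho>_def)
    have s1: "1 - s = (1 - t) * \<rho>0 / \<rho>" using r' by (simp add: s_def \<rho>_def field_simps)
    have s: "0 < s" "s < 1"
    proof -
      show "0 < s" using t r r' by (simp add: s_def)
      have "0 < 1 - s" unfolding s1 using t r r' by simp
      then show "s < 1" by simp
    qed
    have c: "(1 - s) * inverse \<rho>0 = inverse \<rho> * (1 - t)" "s * inverse \<rho>1 = inverse \<rho> * t"
      unfolding s1 using r r' by (simp_all add: s_def divide_inverse)
    have mix: "((1 - t) *\<^sub>R a + t *\<^sub>R b) /\<^sub>R \<rho> = (1 - s) *\<^sub>R (a /\<^sub>R \<rho>0) + s *\<^sub>R (b /\<^sub>R \<rho>1)"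
      for a b :: "'b::real_vector"
      by (simp add: scaleR_add_right c)
    have mixr: "((1 - t) * a + t * b) / \<rho> = (1 - s) * (a / \<rho>0) + s * (b / \<rho>1)" for a b :: real
      using mix[of a b] by (simp add: divide_inverse mult.commute)
    have V: "1 / \<rho> = (1 - s) * (1 / \<rho>0) + s * (1 / \<rho>1)" using mixr[of 1 1] by simp
    have ne: "(\<rho>0, m0 / \<rho>0, J0 /\<^sub>R \<rho>0, P0 /\<^sub>R \<rho>0, A0 /\<^sub>R \<rho>0, B0 /\<^sub>R \<rho>0, z0 / \<rho>0)
        \<noteq> (\<rho>1, m1 / \<rho>1, J1 /\<^sub>R \<rho>1, P1 /\<^sub>R \<rho>1, A1 /\<^sub>R \<rho>1, B1 /\<^sub>R \<rho>1, z1 / \<rho>1)"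
      using uw(3) r by (auto simp: u w)
    have "E_tilde M (primitive ((1 - t) *\<^sub>R u + t *\<^sub>R w))
      < (1 - s) * E_tilde M (primitive u) + s * E_tilde M (primitive w)"
      unfolding u w scaleR_Pair add_Pair primitive.simps real_scaleR_def \<rho>_def[symmetric] mix mixr
      by (rule E_tilde_strictly_convex[OF M s]) (use r r' V ne in \<open>auto intro: spd_scaleR\<close>)
    then have "\<rho> * E_tilde M (primitive ((1 - t) *\<^sub>R u + t *\<^sub>R w))
      < \<rho> * ((1 - s) * E_tilde M (primitive u) + s * E_tilde M (primitive w))"
      using r' by (intro mult_strict_left_mono)
    also have "\<dots> = (1 - t) * (\<rho>0 * E_tilde M (primitive u)) + t * (\<rho>1 * E_tilde M (primitive w))"
    proof -
      have "\<rho> * (1 - s) = (1 - t) * \<rho>0" "\<rho> * s = t * \<rho>1" unfolding s1 using r' by (simp_all add: s_def)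
      then show ?thesis by (simp only: distrib_left mult.assoc[symmetric])
    qed
    finally show ?thesis by (simp add: rho_E_def density_def u w \<rho>_def)
  qed
  then show ?thesis
    unfolding strictly_convex_on_def using subsetD[OF sub]
    by (intro conjI ballI allI impI convex_convex_hull) blast
qed

section \<open>Smoothness of the constitutive functions\<close>

lemmas smooth_on_matrix_intros [smooth_intros] =
  smooth_on_bounded_bilinear[OF bounded_bilinear_matrix_mult]
  smooth_on_bounded_linear[OF bounded_linear_transpose]
  smooth_on_bounded_linear[OF bounded_linear_trace]

text \<open>A vector is the sum of its components, each embedded linearly.\<close>

lemma smooth_on_vec_lambda [smooth_intros]:
  fixes f :: "'a::real_normed_vector \<Rightarrow> 'n::finite \<Rightarrow> 'b::real_normed_vector"
  assumes "\<And>i. smooth_on S (\<lambda>x. f x i)"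
  shows "smooth_on S (\<lambda>x. \<chi> i. f x i)"
proof -
  have l: "bounded_linear (\<lambda>y :: 'b. \<chi> j. if j = i then y else 0)" for i :: 'n
  proof (rule bounded_linear_intro[where K = 1])
    fix y :: 'b
    have "norm (\<chi> j. if j = i then y else 0) \<le> (\<Sum>j\<in>UNIV. norm (if j = i then y else 0))"
      unfolding norm_vec_def by (rule order_trans[OF L2_set_le_sum]) auto
    also have "\<dots> = (\<Sum>j\<in>UNIV. if j = i then norm y else 0)" by (intro sum.cong) auto
    finally show "norm (\<chi> j. if j = i then y else 0) \<le> norm y * 1" by simp
  qed (simp_all add: vec_eq_iff)
  have "smooth_on S (\<lambda>x. \<Sum>i\<in>UNIV. \<chi> j. if j = i then f x i else 0)"
    by (intro smooth_on_sum smooth_on_bounded_linear[OF l] assms)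
  moreover have "(\<Sum>i\<in>UNIV. \<chi> j. if j = i then f x i else 0) = (\<chi> i. f x i)" for x
    by (simp add: vec_eq_iff)
  ultimately show ?thesis by simp
qed

definition specific_entropy :: "state \<Rightarrow> real" where "specific_entropy u = fst (snd u) / fst u"
definition energy_flux :: "state \<Rightarrow> vec3" where "energy_flux u = fst (snd (snd u)) /\<^sub>R fst u"
definition velocity :: "state \<Rightarrow> vec3" where "velocity u = fst (snd (snd (snd u))) /\<^sub>R fst u"
definition Y_of :: "state \<Rightarrow> mat3" where "Y_of u = fst (snd (snd (snd (snd (snd u))))) /\<^sub>R fst u"
definition y_of :: "state \<Rightarrow> real" where "y_of u = snd (snd (snd (snd (snd (snd u))))) / fst u"

lemma density_eq: "density u = fst u"
  by (cases u) (auto simp: density_def)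

lemma deformation_gradient_eq: "deformation_gradient u = fst (snd (snd (snd (snd u)))) /\<^sub>R fst u"
  by (cases u) (auto simp: deformation_gradient_def)

lemma primitive_eq: "primitive u = (density u, specific_entropy u, energy_flux u, velocity u,
    deformation_gradient u, Y_of u, y_of u)"
  by (cases u) (auto simp: density_eq deformation_gradient_eq specific_entropy_def energy_flux_def velocity_def
      Y_of_def y_of_def)

lemma statesD:
  assumes "u \<in> states M"
  shows "0 < density u" "density u < 1 / covol M" "invertible (deformation_gradient u)" "spd (Y_of u)" "0 < y_of u"
  using assms by (auto simp: states_def density_eq deformation_gradient_eq Y_of_def y_of_def)

lemma density_times:
  assumes "u \<in> states M"
  shows "density u * specific_entropy u = fst (snd u)"
    and "density u *\<^sub>R energy_flux u = fst (snd (snd u))"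
    and "density u *\<^sub>R velocity u = fst (snd (snd (snd u)))"
    and "density u *\<^sub>R deformation_gradient u = fst (snd (snd (snd (snd u))))"
    and "density u *\<^sub>R Y_of u = fst (snd (snd (snd (snd (snd u)))))"
    and "density u * y_of u = snd (snd (snd (snd (snd (snd u)))))"
  using statesD(1)[OF assms] by (simp_all add: density_eq specific_entropy_def energy_flux_def velocity_def
      deformation_gradient_eq Y_of_def y_of_def)

lemma smooth_density: "smooth_on S density"
  unfolding density_eq[abs_def] by (intro smooth_intros)

lemma smooth_fields:
  shows "smooth_on (states M) specific_entropy" "smooth_on (states M) energy_flux" "smooth_on (states M) velocity"
    "smooth_on (states M) deformation_gradient" "smooth_on (states M) Y_of" "smooth_on (states M) y_of"
proof -
  have nz: "fst u \<noteq> 0" if "u \<in> states M" for u using statesD(1)[OF that] by (simp add: density_eq)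
  show "smooth_on (states M) specific_entropy" "smooth_on (states M) energy_flux" "smooth_on (states M) velocity"
    "smooth_on (states M) deformation_gradient" "smooth_on (states M) Y_of" "smooth_on (states M) y_of"
    unfolding specific_entropy_def[abs_def] energy_flux_def[abs_def] velocity_def[abs_def]
      deformation_gradient_eq[abs_def] Y_of_def[abs_def] y_of_def[abs_def]
    by (intro smooth_intros nz; assumption)+
qed

text \<open>Up to a term affine in \<open>1/\<rho>\<close>, the equation of state is this function of \<open>\<rho>\<close> times \<open>exp (\<eta> / c_V)\<close>.\<close>

definition heat_factor :: "material \<Rightarrow> real \<Rightarrow> real" where
  "heat_factor M \<rho> = cV M * theta_ref M * (\<rho> / rho_ref M * (1 / (1 - covol M * \<rho>))) powr (gam M - 1)"

definition heat_factor_deriv :: "material \<Rightarrow> real \<Rightarrow> real" where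
  "heat_factor_deriv M \<rho> = heat_factor M \<rho> * ((gam M - 1) / (\<rho> * (1 - covol M * \<rho>)))"

lemma e_s_eq: "e_s M \<rho> \<sigma> = heat_factor M \<rho> * exp (\<sigma> / cV M) + ((1 / \<rho> - covol M) * pinf M + qref M)"
  by (simp add: e_s_def heat_factor_def)

lemma heat_factor_pos:
  assumes "cV M > 0" "theta_ref M > 0" "rho_ref M > 0" "covol M > 0" "0 < \<rho>" "\<rho> < 1 / covol M"
  shows "0 < heat_factor M \<rho>"
proof -
  have "0 < 1 - covol M * \<rho>" using assms by (simp add: field_simps)
  then show ?thesis using assms by (simp add: heat_factor_def)
qed

lemma heat_factor_has_derivative:
  assumes "rho_ref M > 0" "covol M > 0" "0 < \<rho>" "\<rho> < 1 / covol M"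
  shows "(heat_factor M has_real_derivative heat_factor_deriv M \<rho>) (at \<rho>)"
proof -
  have b: "0 < 1 - covol M * \<rho>" using assms by (simp add: field_simps)
  define r where "r x = x / rho_ref M * (1 / (1 - covol M * x))" for x
  have rp: "0 < r \<rho>" using assms b by (simp add: r_def)
  have "(r has_real_derivative 1 / (rho_ref M * (1 - covol M * \<rho>)\<^sup>2)) (at \<rho>)"
  proof -
    have "((\<lambda>x. x / (1 - covol M * x)) has_real_derivative 1 / (1 - covol M * \<rho>)\<^sup>2) (at \<rho>)"
      using b by (auto intro!: derivative_eq_intros simp: power2_eq_square)
    from DERIV_cmult[OF this, of "1 / rho_ref M"] show ?thesis by (simp add: r_def[abs_def])
  qed
  from DERIV_powr[OF this rp DERIV_const, of "gam M - 1"]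
  have "((\<lambda>x. r x powr (gam M - 1)) has_real_derivative
      r \<rho> powr (gam M - 1) * ((gam M - 1) * (1 / (rho_ref M * (1 - covol M * \<rho>)\<^sup>2) / r \<rho>))) (at \<rho>)"
    by (simp add: mult.commute)
  from DERIV_cmult[OF this, of "cV M * theta_ref M"]
  have "((\<lambda>x. cV M * theta_ref M * r x powr (gam M - 1)) has_real_derivative
      heat_factor M \<rho> * ((gam M - 1) * (1 / (rho_ref M * (1 - covol M * \<rho>)\<^sup>2) / r \<rho>))) (at \<rho>)"
    by (simp add: heat_factor_def r_def mult.assoc)
  moreover have "(gam M - 1) * (1 / (rho_ref M * (1 - covol M * \<rho>)\<^sup>2) / r \<rho>) = (gam M - 1) / (\<rho> * (1 - covol M * \<rho>))"
  proof -
    have "g * (1 / (c * w\<^sup>2) / (x / c * (1 / w))) = g / (x * w)" if "c \<noteq> 0" "w \<noteq> 0" "x \<noteq> 0" for g c w x :: real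
      using that by (simp add: field_simps power2_eq_square)
    then show ?thesis unfolding r_def by this (use assms b in auto)
  qed
  moreover have "heat_factor M = (\<lambda>x. cV M * theta_ref M * r x powr (gam M - 1))"
    by (simp add: heat_factor_def[abs_def] r_def)
  ultimately show ?thesis by (simp only: heat_factor_deriv_def)
qed

lemma temperature_eq:
  assumes "cV M > 0"
  shows "temperature M \<rho> \<eta> F Y y = heat_factor M \<rho> * exp (eta_hat M \<rho> \<eta> F Y y / cV M) / cV M"
proof -
  have "((\<lambda>\<sigma>. e_s M \<rho> \<sigma>) has_real_derivative heat_factor M \<rho> * exp (\<sigma> / cV M) / cV M) (at \<sigma>)" for \<sigma>
    unfolding e_s_eq using assms by (auto intro!: derivative_eq_intros)
  then show ?thesis unfolding temperature_def by (rule DERIV_imp_deriv)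
qed

lemma pressure_eq:
  assumes "rho_ref M > 0" "covol M > 0" "0 < \<rho>" "\<rho> < 1 / covol M"
  shows "pressure M \<rho> \<eta> F Y y
    = \<rho>\<^sup>2 * (heat_factor_deriv M \<rho> * exp (eta_hat M \<rho> \<eta> F Y y / cV M) - pinf M / \<rho>\<^sup>2)"
proof -
  have "((\<lambda>r. e_s M r \<sigma>) has_real_derivative heat_factor_deriv M \<rho> * exp (\<sigma> / cV M) - pinf M / \<rho>\<^sup>2) (at \<rho>)" for \<sigma>
    unfolding e_s_eq using assms
    by (auto intro!: derivative_eq_intros heat_factor_has_derivative[OF assms] simp: field_simps power2_eq_square)
  from DERIV_imp_deriv[OF this] show ?thesis unfolding pressure_def by simp
qed

lemma temperature_pos:
  assumes "cV M > 0" "theta_ref M > 0" "rho_ref M > 0" "covol M > 0" "0 < \<rho>" "\<rho> < 1 / covol M"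
  shows "0 < temperature M \<rho> \<eta> F Y y"
  using heat_factor_pos[OF assms] assms(1) by (simp add: temperature_eq)

definition temperature_of :: "material \<Rightarrow> state \<Rightarrow> real" where
  "temperature_of M u = temperature M (density u) (specific_entropy u) (deformation_gradient u) (Y_of u) (y_of u)"

definition stress_of :: "material \<Rightarrow> state \<Rightarrow> mat3" where
  "stress_of M u = cauchy_stress M (density u) (specific_entropy u) (deformation_gradient u) (Y_of u) (y_of u)"

lemma system_flux_eq:
  "system_flux M k u = (density u * velocity u $ k,
      density u * specific_entropy u * velocity u $ k + energy_flux u $ k / temperature_of M u,
      (density u * velocity u $ k) *\<^sub>R energy_flux u + (kappa M * ln (temperature_of M u) / tau0 M) *\<^sub>R axis k 1,
      (density u * velocity u $ k) *\<^sub>R velocity u - column k (stress_of M u),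
      (\<chi> i a. density u * (deformation_gradient u $ i $ a * velocity u $ k - velocity u $ i * deformation_gradient u $ k $ a)),
      (density u * velocity u $ k) *\<^sub>R Y_of u,
      density u * y_of u * velocity u $ k)"
  by (simp add: system_flux_def primitive_eq Let_def temperature_of_def stress_of_def)

lemma smooth_on_heat_factor [smooth_intros]:
  assumes "cV M > 0" "rho_ref M > 0" "covol M > 0" "smooth_on S f"
    "\<And>x. x \<in> S \<Longrightarrow> 0 < f x" "\<And>x. x \<in> S \<Longrightarrow> f x < 1 / covol M"
  shows "smooth_on S (\<lambda>x. heat_factor M (f x))" "smooth_on S (\<lambda>x. heat_factor_deriv M (f x))"
proof -
  have b: "0 < 1 - covol M * f x" if "x \<in> S" for x using assms(3) assms(6)[OF that] by (simp add: field_simps)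
  have b': "1 - covol M * f x \<noteq> 0" "f x * (1 - covol M * f x) \<noteq> 0" if "x \<in> S" for x
    using b[OF that] assms(5)[OF that] by auto
  have r: "0 < f x / rho_ref M * (1 / (1 - covol M * f x))" if "x \<in> S" for x
    using b[OF that] assms(2) assms(5)[OF that] by simp
  have rr: "rho_ref M \<noteq> 0" using assms by simp
  show h: "smooth_on S (\<lambda>x. heat_factor M (f x))"
    unfolding heat_factor_def by (intro smooth_intros assms b' r rr)
  show "smooth_on S (\<lambda>x. heat_factor_deriv M (f x))"
    unfolding heat_factor_deriv_def by (intro smooth_intros h assms b')
qed

context
  fixes M :: material
  assumes M: "cV M > 0" "theta_ref M > 0" "rho_ref M > 0" "covol M > 0" "tau0 M > 0" "kappa M > 0" "rhoR M > 0"
begin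

lemma temperature_of_pos: "u \<in> states M \<Longrightarrow> 0 < temperature_of M u"
  unfolding temperature_of_def by (intro temperature_pos M statesD)

lemma smooth_C: "smooth_on (states M) (\<lambda>u. C_mat (deformation_gradient u) (Y_of u))"
  unfolding C_mat_def
  by (intro smooth_intros smooth_fields smooth_on_compose[OF inv_sqrt_mat_smooth])
    (auto intro: statesD)

lemma smooth_eta_hat:
  "smooth_on (states M) (\<lambda>u. eta_hat M (density u) (specific_entropy u) (deformation_gradient u) (Y_of u) (y_of u))"
  unfolding eta_hat_def
proof (intro smooth_intros smooth_fields smooth_C smooth_density)
  fix u assume "u \<in> states M"
  note u = statesD[OF this]
  show "density u \<noteq> 0" "0 < y_of u" using u by auto
  show "0 < (rhoR M / density u)\<^sup>2 * y_of u powr (1 / 2)" using u M by simp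
qed

lemma smooth_temperature: "smooth_on (states M) (temperature_of M)"
  unfolding temperature_of_def[abs_def] temperature_eq[OF M(1)]
  by (intro smooth_intros M smooth_density smooth_eta_hat statesD; (use M in auto)?)

lemma smooth_pressure:
  "smooth_on (states M) (\<lambda>u. pressure M (density u) (specific_entropy u) (deformation_gradient u) (Y_of u) (y_of u))"
proof (rule smooth_on_cong)
  fix u assume "u \<in> states M"
  note u = statesD[OF this]
  show "(density u)\<^sup>2 * (heat_factor_deriv M (density u) * exp (eta_hat M (density u) (specific_entropy u)
      (deformation_gradient u) (Y_of u) (y_of u) / cV M) - pinf M / (density u)\<^sup>2)
    = pressure M (density u) (specific_entropy u) (deformation_gradient u) (Y_of u) (y_of u)"
    by (rule pressure_eq[symmetric]) (use M u in auto)
next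
  show "smooth_on (states M) (\<lambda>u. (density u)\<^sup>2 * (heat_factor_deriv M (density u) * exp (eta_hat M (density u) (specific_entropy u)
      (deformation_gradient u) (Y_of u) (y_of u) / cV M) - pinf M / (density u)\<^sup>2))"
    by (intro smooth_intros M smooth_density smooth_eta_hat statesD; (use M in \<open>auto dest: statesD\<close>)?)
qed

lemma smooth_stress: "smooth_on (states M) (stress_of M)"
  unfolding stress_of_def[abs_def] cauchy_stress_def Let_def K_of_def
  by (intro smooth_intros smooth_C smooth_density smooth_pressure
      smooth_temperature[unfolded temperature_of_def[abs_def]])

lemma smooth_column_stress: "smooth_on (states M) (\<lambda>u. column k (stress_of M u))"
  unfolding column_def by (intro smooth_intros smooth_stress)

lemma smooth_E: "smooth_on (states M) (\<lambda>u. E_tilde M (primitive u))"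
proof -
  have es: "smooth_on (states M) (\<lambda>u. e_s_tilde M (density u) (specific_entropy u) (deformation_gradient u) (Y_of u) (y_of u))"
    unfolding e_s_tilde_def e_s_eq
    by (intro smooth_intros M smooth_density smooth_eta_hat statesD; (use M in \<open>auto dest: statesD\<close>)?)
  show ?thesis
    unfolding E_tilde_def primitive_eq prod.case power2_norm_eq_inner
    by (intro smooth_intros es smooth_C smooth_density smooth_fields) (use M in auto)
qed

lemma smooth_rho_E: "smooth_on (states M) (rho_E M)"
  unfolding rho_E_def[abs_def] by (intro smooth_intros smooth_density smooth_E)

lemma smooth_flux: "smooth_on (states M) (system_flux M k)"
proof -
  have "temperature_of M u \<noteq> 0" if "u \<in> states M" for u using temperature_of_pos[OF that] by simp
  then show ?thesis
    unfolding system_flux_eq[abs_def]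
    by (intro smooth_intros smooth_density smooth_fields smooth_temperature smooth_column_stress temperature_of_pos)
      (use M in auto)
qed

lemma smooth_relaxation_Y:
  assumes "smooth_on {0<..} zeta" "\<And>\<theta>. \<theta> > 0 \<Longrightarrow> zeta \<theta> > 0"
  shows "smooth_on (states M) (\<lambda>u. relaxation_Y M zeta (temperature_of M u) (deformation_gradient u) (Y_of u))"
proof -
  have z: "smooth_on (states M) (\<lambda>u. zeta (temperature_of M u))"
    by (rule smooth_on_compose[OF assms(1) smooth_temperature]) (simp add: temperature_of_pos)
  have nz: "zeta (temperature_of M u) \<noteq> 0" if "u \<in> states M" for u
    using assms(2)[OF temperature_of_pos[OF that]] by simp
  have i: "smooth_on (states M) (\<lambda>u. matrix_inv (deformation_gradient u))"
    by (rule smooth_on_compose[OF matrix_inv_smooth]) (auto intro: smooth_fields statesD)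
  have s: "smooth_on (states M) (\<lambda>u. inv_sqrt_mat (Y_of u))"
    by (rule smooth_on_compose[OF inv_sqrt_mat_smooth]) (auto intro: smooth_fields statesD)
  show ?thesis
    unfolding relaxation_Y_def G_mat_def K_of_def
    by (intro smooth_intros smooth_fields smooth_temperature z i s nz)
qed

end

section \<open>Derivatives along solutions\<close>

text \<open>All fields along a solution are differentiated as functions of space-time within \<open>D\<close>, and the partial
  derivatives are the values of this derivative on coordinate vectors. Near a point of \<open>D\<close> the coordinate
  lines, or the half line \<open>t \<ge> 0\<close>, stay in \<open>D\<close>, because \<open>D\<close> is relatively open. The derivative in the
  direction \<open>(1, v)\<close> is then the material derivative.\<close>

lemma dt_eq:
  assumes D: "openin (top_of_set space_time) D" "p \<in> D"
    and a: "(a has_derivative a') (at p within D)"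
  shows "dt a p = a' (1, 0)"
proof -
  obtain T where T: "open T" "D = space_time \<inter> T" using D(1) by (auto simp: openin_open)
  define c where "c s = (s, snd p)" for s :: real
  define X where "X = {0..} \<inter> c -` T"
  have "open (c -` T)"
    by (rule open_vimage[OF T(1)]) (auto simp: c_def intro!: continuous_intros)
  moreover have "fst p \<in> c -` T" using D T by (auto simp: c_def)
  ultimately have at: "at (fst p) within X = at (fst p) within {0..}"
    unfolding X_def by (intro at_within_nhd[of _ "c -` T"]) auto
  have cX: "c ` X \<subseteq> D" by (auto simp: X_def T c_def space_time_def)
  have ac: "(a has_derivative a') (at (c (fst p)) within D)" using a by (simp add: c_def)
  have "(c has_derivative (\<lambda>h. (h, 0))) (at (fst p) within X)"
    unfolding c_def by (auto intro!: derivative_eq_intros)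
  from has_derivative_in_compose[OF this has_derivative_subset[OF ac cX]]
  have "((\<lambda>s. a (c s)) has_derivative (\<lambda>h. a' (h, 0))) (at (fst p) within {0..})"
    unfolding at .
  moreover have "(\<lambda>h. a' (h, 0)) = (\<lambda>h. h *\<^sub>R a' (1, 0))"
    by (rule ext) (simp flip: linear_scale[OF has_derivative_linear[OF a]])
  ultimately have "((\<lambda>s. a (s, snd p)) has_vector_derivative a' (1, 0)) (at (fst p) within {0..})"
    unfolding has_vector_derivative_def c_def by (rule has_derivative_eq_rhs)
  moreover have "at (fst p) within {0..} \<noteq> bot"
  proof -
    have "fst p \<ge> 0" using D T by (auto simp: space_time_def)
    then have "{fst p<..fst p + 1} \<subseteq> {0..}" by auto
    moreover have "fst p islimpt {fst p<..fst p + 1}" by (simp add: islimpt_Ioc)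
    ultimately have "fst p islimpt {0..}" by (rule islimpt_subset[rotated])
    then show ?thesis by (simp add: trivial_limit_within)
  qed
  ultimately show ?thesis unfolding dt_def by (intro vector_derivative_within)
qed

lemma dx_eq:
  assumes D: "openin (top_of_set space_time) D" "p \<in> D"
    and a: "(a has_derivative a') (at p within D)"
  shows "dx k a p = a' (0, axis k 1)"
proof -
  obtain T where T: "open T" "D = space_time \<inter> T" using D(1) by (auto simp: openin_open)
  define c where "c h = (fst p, snd p + h *\<^sub>R axis k (1::real))" for h :: real
  define X where "X = c -` T"
  have "open X"
    unfolding X_def by (rule open_vimage[OF T(1)]) (auto simp: c_def intro!: continuous_intros)
  moreover have "0 \<in> X" using D T by (auto simp: c_def X_def)
  ultimately have at: "at 0 within X = at 0" by (rule at_within_open[rotated])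
  have cX: "c ` X \<subseteq> D" using D T by (auto simp: X_def c_def space_time_def)
  have ac: "(a has_derivative a') (at (c 0) within D)" using a by (simp add: c_def)
  have "(c has_derivative (\<lambda>h. (0, h *\<^sub>R axis k 1))) (at 0 within X)"
    unfolding c_def by (auto intro!: derivative_eq_intros)
  from has_derivative_in_compose[OF this has_derivative_subset[OF ac cX]]
  have "((\<lambda>s. a (c s)) has_derivative (\<lambda>h. a' (0, h *\<^sub>R axis k 1))) (at 0)"
    unfolding at .
  moreover have "(\<lambda>h. a' (0, h *\<^sub>R axis k 1)) = (\<lambda>h. h *\<^sub>R a' (0, axis k 1))"
    by (rule ext) (simp flip: linear_scale[OF has_derivative_linear[OF a]])
  ultimately have "((\<lambda>s. a (fst p, snd p + s *\<^sub>R axis k 1)) has_vector_derivative a' (0, axis k 1)) (at 0)"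
    unfolding has_vector_derivative_def c_def by (rule has_derivative_eq_rhs)
  then show ?thesis unfolding dx_def by (rule vector_derivative_at)
qed

lemma material_derivative:
  fixes a' :: "spacetime \<Rightarrow> 'b::real_normed_vector"
  assumes "linear a'"
  shows "a' (1, v) = a' (1, 0) + (\<Sum>k\<in>UNIV. v $ k *\<^sub>R a' (0, axis k 1))"
proof -
  have "(1, v) = (1, 0) + (\<Sum>k\<in>UNIV. v $ k *\<^sub>R (0 :: real, axis k 1 :: vec3))"
    by (simp add: prod_eq_iff fst_sum snd_sum basis_expansion[of v, unfolded scalar_mult_eq_scaleR])
  then show ?thesis by (simp only: linear_add[OF assms] linear_sum[OF assms] linear_scale[OF assms])
qed

text \<open>Given conservation of mass, the conservative form of the transport of \<open>\<rho> a\<close> is \<open>\<rho>\<close> times the material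
  derivative of \<open>a\<close>.\<close>

lemma transport_with_flux:
  fixes a :: "spacetime \<Rightarrow> 'b::real_normed_vector"
  assumes D: "openin (top_of_set space_time) D" "p \<in> D"
    and R: "(R has_derivative R') (at p within D)"
    and v: "(v has_derivative v') (at p within D)"
    and a: "(a has_derivative a') (at p within D)"
    and b: "\<And>k. (b k has_derivative b' k) (at p within D)"
    and mass: "R' (1, v p) + R p * (\<Sum>k\<in>UNIV. v' (0, axis k 1) $ k) = (0 :: real)"
  shows "dt (\<lambda>q. R q *\<^sub>R a q) p + (\<Sum>k\<in>UNIV. dx k (\<lambda>q. (R q * v q $ k) *\<^sub>R a q + b k q) p)
    = R p *\<^sub>R a' (1, v p) + (\<Sum>k\<in>UNIV. b' k (0, axis k 1))"
proof -
  note vk = bounded_linear.has_derivative[OF bounded_linear_vec_nth v]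
  have t: "dt (\<lambda>q. R q *\<^sub>R a q) p = R p *\<^sub>R a' (1, 0) + R' (1, 0) *\<^sub>R a p"
    by (rule dt_eq[OF D has_derivative_scaleR[OF R a]])
  have x: "dx k (\<lambda>q. (R q * v q $ k) *\<^sub>R a q + b k q) p
     = (R p * v p $ k) *\<^sub>R a' (0, axis k 1) + (R p * v' (0, axis k 1) $ k + R' (0, axis k 1) * v p $ k) *\<^sub>R a p
       + b' k (0, axis k 1)" for k
    by (rule dx_eq[OF D has_derivative_add[OF has_derivative_scaleR[OF has_derivative_mult[OF R vk] a] b]])
  have l: "linear a'" "linear R'" using a R by (auto intro: has_derivative_linear)
  have "R p *\<^sub>R a' (1, 0) + R' (1, 0) *\<^sub>R a p + (\<Sum>k\<in>UNIV. (R p * v p $ k) *\<^sub>R a' (0, axis k 1)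
       + (R p * v' (0, axis k 1) $ k + R' (0, axis k 1) * v p $ k) *\<^sub>R a p + b' k (0, axis k 1))
    = R p *\<^sub>R a' (1, v p) + (R' (1, v p) + R p * (\<Sum>k\<in>UNIV. v' (0, axis k 1) $ k)) *\<^sub>R a p
      + (\<Sum>k\<in>UNIV. b' k (0, axis k 1))"
    unfolding material_derivative[OF l(1), of "v p"] material_derivative[OF l(2), of "v p"]
    by (simp add: sum.distrib scaleR_add_right scaleR_add_left scaleR_sum_left scaleR_sum_right sum_distrib_left
        mult.commute[of "v p $ _"] add_ac)
  then show ?thesis unfolding t x using mass by simp
qed

lemma solution_component:
  fixes \<pi> :: "'u::real_normed_vector \<Rightarrow> 'b::real_normed_vector"
  assumes sol: "smooth_solution \<Omega> flux src D u" and p: "p \<in> D"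
    and \<pi>: "bounded_linear \<pi>"
    and u: "(u has_derivative u') (at p within D)"
    and f: "\<And>k. ((\<lambda>q. flux k (u q)) has_derivative f' k) (at p within D)"
  shows "dt (\<lambda>q. \<pi> (u q)) p + (\<Sum>k\<in>UNIV. dx k (\<lambda>q. \<pi> (flux k (u q))) p) = \<pi> (src (u p))"
proof -
  have D: "openin (top_of_set space_time) D" and eq: "dt u p + (\<Sum>k\<in>UNIV. dx k (\<lambda>q. flux k (u q)) p) = src (u p)"
    using sol p by (auto simp: smooth_solution_def)
  have "linear \<pi>" using \<pi> by (rule bounded_linear.linear)
  then show ?thesis
    unfolding eq[symmetric] dt_eq[OF D p u] dx_eq[OF D p f]
      dt_eq[OF D p bounded_linear.has_derivative[OF \<pi> u]] dx_eq[OF D p bounded_linear.has_derivative[OF \<pi> f]]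
    by (simp add: linear_add linear_sum)
qed

lemma dt_cong:
  assumes D: "openin (top_of_set space_time) D" "p \<in> D"
    and b: "(b has_derivative b') (at p within D)" and ab: "\<And>q. q \<in> D \<Longrightarrow> a q = b q"
  shows "dt a p = dt b p"
  using dt_eq[OF D b] dt_eq[OF D has_derivative_transform[OF D(2) ab b]] by simp

lemma dx_cong:
  assumes D: "openin (top_of_set space_time) D" "p \<in> D"
    and b: "(b has_derivative b') (at p within D)" and ab: "\<And>q. q \<in> D \<Longrightarrow> a q = b q"
  shows "dx k a p = dx k b p"
  using dx_eq[OF D b] dx_eq[OF D has_derivative_transform[OF D(2) ab b]] by simp

section \<open>Matrix identities of the relaxation\<close>

lemma trace_cyclic: "trace (A ** B ** C) = trace (C ** A ** B)" for A B C :: "real ^ 'n ^ 'n"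
  by (metis matrix_mul_assoc trace_mul_sym)

lemma trace_mat_3: "trace (mat 1 :: mat3) = 3"
  by (simp add: trace_def mat_def)

lemma C_mat_symmetric: "spd Y \<Longrightarrow> transpose (C_mat F Y) = C_mat F Y"
  using spd_inv_sqrt_mat[of Y] by (simp add: C_mat_def matrix_transpose_mul matrix_mul_assoc spd_iff)

lemma spd_C_mat:
  assumes Y: "spd Y" and F: "invertible F"
  shows "spd (C_mat F Y)"
proof -
  have "0 < x \<bullet> (C_mat F Y *v x)" if "x \<noteq> 0" for x
  proof -
    have "invertible (transpose F)" using F by (simp add: invertible_det_nz det_transpose)
    then have "transpose F *v x \<noteq> 0"
      using that by (metis inj_matrix_vector_mult injD mat_vec.zero_right)
    then have "0 < (transpose F *v x) \<bullet> (inv_sqrt_mat Y *v (transpose F *v x))"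
      using spd_inv_sqrt_mat[OF Y] by (simp add: spd_def)
    also have "\<dots> = x \<bullet> (F *v (inv_sqrt_mat Y *v (transpose F *v x)))"
      using inner_matrix_vector_transpose[of x "transpose F" "inv_sqrt_mat Y *v (transpose F *v x)"]
      by (simp only: transpose_transpose)
    also have "\<dots> = x \<bullet> (C_mat F Y *v x)" by (simp only: C_mat_def matrix_vector_mul_assoc matrix_mul_assoc)
    finally show ?thesis .
  qed
  then show ?thesis using C_mat_symmetric[OF Y] by (simp add: spd_iff pos_def_def)
qed

text \<open>The product \<open>C^(-1/2) C^(-1/2)\<close> is \<open>C^(-1) = F^(-T) Y^(1/2) F^(-1)\<close>; the trace is invariant
  under cyclic permutations.\<close>

lemma trace_C_inverse:
  assumes Y: "spd Y" and F: "invertible F"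
  shows "trace (inv_sqrt_mat (C_mat F Y) ** inv_sqrt_mat (C_mat F Y)) = trace (G_mat F ** sqrt_mat Y)"
proof -
  define C where "C = C_mat F Y"
  define W where "W = inv_sqrt_mat C"
  define H where "H = transpose (matrix_inv F) ** sqrt_mat Y ** matrix_inv F"
  have C: "spd C" unfolding C_def by (rule spd_C_mat[OF Y F])
  have WC: "(W ** W) ** C = mat 1"
  proof -
    have "(W ** W) ** C = (W ** W) ** (sqrt_mat C ** sqrt_mat C)" by (simp add: sqrt_mat_square[OF C])
    also have "\<dots> = W ** (W ** sqrt_mat C) ** sqrt_mat C" by (simp only: matrix_mul_assoc)
    finally show ?thesis by (simp add: W_def inv_sqrt_mat_sqrt_mat[OF C])
  qed
  have "C ** H = F ** inv_sqrt_mat Y ** (transpose F ** transpose (matrix_inv F)) ** sqrt_mat Y ** matrix_inv F"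
    by (simp only: C_def C_mat_def H_def matrix_mul_assoc)
  also have "transpose F ** transpose (matrix_inv F) = mat 1"
    using matrix_inv_left[OF F] by (metis matrix_transpose_mul transpose_mat)
  also have "F ** inv_sqrt_mat Y ** mat 1 ** sqrt_mat Y ** matrix_inv F = F ** (inv_sqrt_mat Y ** sqrt_mat Y) ** matrix_inv F"
    by (simp add: matrix_mul_assoc)
  also have "\<dots> = mat 1" by (simp add: inv_sqrt_mat_sqrt_mat[OF Y] matrix_inv_right[OF F])
  finally have CH: "C ** H = mat 1" .
  have "W ** W = (W ** W) ** (C ** H)" by (simp add: CH)
  also have "\<dots> = (W ** W) ** C ** H" by (simp only: matrix_mul_assoc)
  also have "\<dots> = H" by (simp add: WC)
  finally have "trace (W ** W) = trace H" by simp
  also have "\<dots> = trace (matrix_inv F ** transpose (matrix_inv F) ** sqrt_mat Y)"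
    unfolding H_def by (rule trace_cyclic)
  finally show ?thesis by (simp add: W_def C_def G_mat_def)
qed

text \<open>The mixed term is \<open>- 2 a b\<close> times the trace of the \<open>3 \<times> 3\<close> identity.\<close>

lemma dissipation_eq:
  fixes a b :: real
  assumes Y: "spd Y" and F: "invertible F"
  shows "(norm (a *\<^sub>R sqrt_mat (C_mat F Y) - b *\<^sub>R inv_sqrt_mat (C_mat F Y)))\<^sup>2
    = a\<^sup>2 * trace (C_mat F Y) - 6 * a * b + b\<^sup>2 * trace (G_mat F ** sqrt_mat Y)"
proof -
  define C where "C = C_mat F Y"
  have C: "spd C" unfolding C_def by (rule spd_C_mat[OF Y F])
  have s: "transpose (sqrt_mat C) = sqrt_mat C" "transpose (inv_sqrt_mat C) = inv_sqrt_mat C"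
    using spd_sqrt_mat[OF C] spd_inv_sqrt_mat[OF C] by (simp_all add: spd_iff)
  have 1: "sqrt_mat C \<bullet> sqrt_mat C = trace C" by (simp add: inner_matrix_eq_trace s sqrt_mat_square[OF C])
  have 2: "sqrt_mat C \<bullet> inv_sqrt_mat C = 3"
    by (simp add: inner_matrix_eq_trace s sqrt_mat_inv_sqrt_mat[OF C] trace_mat_3)
  have 3: "inv_sqrt_mat C \<bullet> inv_sqrt_mat C = trace (G_mat F ** sqrt_mat Y)"
    using trace_C_inverse[OF Y F] by (simp add: inner_matrix_eq_trace s C_def[symmetric])
  have "(norm (a *\<^sub>R sqrt_mat C - b *\<^sub>R inv_sqrt_mat C))\<^sup>2
      = a\<^sup>2 * (sqrt_mat C \<bullet> sqrt_mat C) - 2 * a * b * (sqrt_mat C \<bullet> inv_sqrt_mat C)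
        + b\<^sup>2 * (inv_sqrt_mat C \<bullet> inv_sqrt_mat C)"
    unfolding power2_norm_eq_inner by (simp add: inner_diff_left inner_diff_right inner_commute power2_eq_square algebra_simps)
  then show ?thesis unfolding 1 2 3 by (simp add: C_def)
qed

lemma inv_sqrt_mat_commutes:
  assumes "spd Y"
  shows "inv_sqrt_mat Y ** Y = sqrt_mat Y" "Y ** inv_sqrt_mat Y = sqrt_mat Y"
proof -
  have "inv_sqrt_mat Y ** Y = (inv_sqrt_mat Y ** sqrt_mat Y) ** sqrt_mat Y"
    by (subst (2) sqrt_mat_square[OF assms, symmetric]) (simp only: matrix_mul_assoc)
  then show "inv_sqrt_mat Y ** Y = sqrt_mat Y" by (simp add: inv_sqrt_mat_sqrt_mat[OF assms])
  have "Y ** inv_sqrt_mat Y = sqrt_mat Y ** (sqrt_mat Y ** inv_sqrt_mat Y)"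
    by (subst (1) sqrt_mat_square[OF assms, symmetric]) (simp only: matrix_mul_assoc)
  then show "Y ** inv_sqrt_mat Y = sqrt_mat Y" by (simp add: sqrt_mat_inv_sqrt_mat[OF assms])
qed

lemma relaxation_y_eq:
  assumes Y: "spd Y"
  shows "relaxation_y M zeta \<theta> F Y y
    = 4 / zeta \<theta> * y * (2 * kB M * \<theta> * trace (G_mat F ** sqrt_mat Y) - 6 * K_of M \<theta>)"
proof -
  have 1: "trace (G_mat F ** inv_sqrt_mat Y ** Y) = trace (G_mat F ** sqrt_mat Y)"
    by (simp add: inv_sqrt_mat_commutes[OF Y] flip: matrix_mul_assoc)
  have "trace (inv_sqrt_mat Y ** G_mat F ** Y) = trace (G_mat F ** (Y ** inv_sqrt_mat Y))"
    by (metis trace_cyclic matrix_mul_assoc)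
  then have 2: "trace (inv_sqrt_mat Y ** G_mat F ** Y) = trace (G_mat F ** sqrt_mat Y)"
    by (simp add: inv_sqrt_mat_commutes[OF Y])
  show ?thesis
    by (simp add: relaxation_y_def trace_diff trace_scaleR trace_add mat_mult.add_left 1 2 trace_mat_3)
qed

lemma G_mat_symmetric: "transpose (G_mat F) = G_mat F"
  by (simp add: G_mat_def matrix_transpose_mul)

lemma relaxation_Y_symmetric:
  assumes Y: "spd Y"
  shows "transpose (relaxation_Y M zeta \<theta> F Y) = relaxation_Y M zeta \<theta> F Y"
  using Y spd_inv_sqrt_mat[OF Y]
  by (simp add: relaxation_Y_def transpose_diff transpose_scaleR transpose_add matrix_transpose_mul
      G_mat_symmetric spd_iff mat_mult.add_left mat_mult.add_right matrix_mul_assoc add.commute)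

text \<open>The rate of \<open>Z = Y^(-1/2)\<close> under the relaxation of \<open>Y\<close>. Since \<open>DZ = - Z (DS) Z\<close> for the root \<open>S\<close> of \<open>Y\<close>,
  it suffices to see that \<open>a S - b S G S\<close> solves the Sylvester equation for \<open>DS\<close>, where \<open>a\<close> and \<open>b\<close> are the
  coefficients of \<open>- Z\<close> and \<open>G\<close> on the right. The relaxation term is designed such that this holds.\<close>

lemma inv_sqrt_rate:
  assumes Y: "spd Y"
  shows "- (inv_sqrt_mat Y ** sylvester (sqrt_mat Y) (sym_part (relaxation_Y M zeta \<theta> F Y)) ** inv_sqrt_mat Y)
    = (4 * kB M * \<theta> / zeta \<theta>) *\<^sub>R G_mat F - (4 * K_of M \<theta> / zeta \<theta>) *\<^sub>R inv_sqrt_mat Y"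
proof -
  define S Z G where "S = sqrt_mat Y" and "Z = inv_sqrt_mat Y" and "G = G_mat F"
  define a b where "a = 4 * K_of M \<theta> / zeta \<theta>" and "b = 4 * kB M * \<theta> / zeta \<theta>"
  have SZ: "S ** Z = mat 1" "Z ** S = mat 1" "Y ** Z = S" "Z ** Y = S" "S ** S = Y"
    by (simp_all add: S_def Z_def sqrt_mat_inv_sqrt_mat[OF Y] inv_sqrt_mat_sqrt_mat[OF Y] inv_sqrt_mat_commutes[OF Y]
        sqrt_mat_square[OF Y])
  have H: "relaxation_Y M zeta \<theta> F Y = (2 * a) *\<^sub>R Y - b *\<^sub>R (Y ** G ** S + S ** G ** Y)"
  proof -
    have "Y ** (G ** Z + Z ** G) ** Y = Y ** G ** (Z ** Y) + (Y ** Z) ** G ** Y"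
      by (simp add: mat_mult.add_left mat_mult.add_right matrix_mul_assoc)
    then show ?thesis by (simp add: relaxation_Y_def a_def b_def SZ flip: Z_def G_def)
  qed
  have "sylvester S (relaxation_Y M zeta \<theta> F Y) = a *\<^sub>R S - b *\<^sub>R (S ** G ** S)"
  proof (rule sylvester_unique)
    show pS: "pos_def S" using spd_sqrt_mat[OF Y] by (simp add: S_def spd_iff)
    have "S ** (a *\<^sub>R S - b *\<^sub>R (S ** G ** S)) + (a *\<^sub>R S - b *\<^sub>R (S ** G ** S)) ** S
      = a *\<^sub>R (S ** S) + a *\<^sub>R (S ** S) - b *\<^sub>R ((S ** S) ** G ** S + S ** G ** (S ** S))"
      by (simp add: mat_mult.diff_left mat_mult.diff_right mat_mult.scaleR_left mat_mult.scaleR_right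
          matrix_mul_assoc scaleR_add_right)
    also have "\<dots> = relaxation_Y M zeta \<theta> F Y"
      unfolding SZ H by (simp flip: scaleR_add_left)
    finally show "S ** sylvester S (relaxation_Y M zeta \<theta> F Y) + sylvester S (relaxation_Y M zeta \<theta> F Y) ** S
      = S ** (a *\<^sub>R S - b *\<^sub>R (S ** G ** S)) + (a *\<^sub>R S - b *\<^sub>R (S ** G ** S)) ** S"
      by (simp add: sylvester_solves[OF pS])
  qed
  moreover have "Z ** (a *\<^sub>R S - b *\<^sub>R (S ** G ** S)) ** Z = a *\<^sub>R ((Z ** S) ** Z) - b *\<^sub>R ((Z ** S) ** G ** (S ** Z))"
    by (simp add: mat_mult.diff_left mat_mult.diff_right mat_mult.scaleR_left mat_mult.scaleR_right matrix_mul_assoc)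
  ultimately have "- (Z ** sylvester S (relaxation_Y M zeta \<theta> F Y) ** Z) = b *\<^sub>R G - a *\<^sub>R Z"
    by (simp add: SZ)
  then show ?thesis
    by (simp add: sym_part_eq[OF relaxation_Y_symmetric[OF Y]] S_def Z_def G_def a_def b_def)
qed

text \<open>The rate of \<open>tr C\<close> splits into the stress power, from \<open>DF = L F\<close>, and the relaxation, in which
  \<open>F G F^T = I\<close> makes the thermal term constant.\<close>

lemma trace_C_rate:
  assumes Y: "spd Y" and F: "invertible F"
  shows "trace ((L ** F) ** inv_sqrt_mat Y ** transpose F + F ** (b *\<^sub>R G_mat F - a *\<^sub>R inv_sqrt_mat Y) ** transpose F
      + F ** inv_sqrt_mat Y ** transpose (L ** F))
    = 2 * (L \<bullet> C_mat F Y) - a * trace (C_mat F Y) + 3 * b"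
proof -
  have 1: "trace ((L ** F) ** inv_sqrt_mat Y ** transpose F) = L \<bullet> C_mat F Y"
    by (simp add: inner_matrix_eq_trace C_mat_symmetric[OF Y]) (simp add: C_mat_def matrix_mul_assoc)
  have 2: "trace (F ** inv_sqrt_mat Y ** transpose (L ** F)) = L \<bullet> C_mat F Y"
    by (subst inner_commute) (simp add: inner_matrix_eq_trace C_mat_def matrix_transpose_mul matrix_mul_assoc)
  have "F ** G_mat F ** transpose F = (F ** matrix_inv F) ** transpose (F ** matrix_inv F)"
    by (simp only: G_mat_def matrix_transpose_mul matrix_mul_assoc)
  then have 3: "trace (F ** G_mat F ** transpose F) = 3"
    by (simp add: matrix_inv_right[OF F] trace_mat_3 transpose_mat)
  have 4: "trace (F ** (b *\<^sub>R G_mat F - a *\<^sub>R inv_sqrt_mat Y) ** transpose F) = 3 * b - a * trace (C_mat F Y)"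
    by (simp add: mat_mult.diff_left mat_mult.diff_right mat_mult.scaleR_left mat_mult.scaleR_right
        trace_diff trace_scaleR 3 C_mat_def)
  show ?thesis unfolding trace_add 1 2 4 by simp
qed

section \<open>The energy balance\<close>

text \<open>The balance of energy at one point as an identity between numbers. The digit 1 at the end of a name
  marks a material derivative, in \<open>vv1\<close>, \<open>jj1\<close>, \<open>YY1\<close> contracted with the field itself; \<open>divj\<close>, \<open>divT\<close>,
  \<open>dv\<close> are \<open>div j\<close>, \<open>v \<bullet> div T\<close>, \<open>div v\<close>; \<open>LT\<close> is the stress power and \<open>lc\<close> is \<open>grad v \<bullet> C\<close>, \<open>jgth\<close> is
  \<open>j \<bullet> grad \<theta>\<close>, \<open>nj\<close> is \<open>|j|\<^sup>2\<close>, and \<open>c\<close>, \<open>ci\<close> are the traces of \<open>C\<close> and \<open>C^(-1)\<close>.\<close>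

lemma energy_identity:
  fixes r th z y kap t0 eta1 divj jgth nj al K c k ci jj1 r1 dv vv1 divT fv c1 lc y1 Ka Kb LT p E1 e YY1 :: real
  assumes pos: "0 < r" "0 < th" "0 < z" "0 < y" "0 < kap" "0 < t0"
    and eta: "r * eta1 + (divj / th - jgth / th\<^sup>2) = nj / (kap * th\<^sup>2)
        + 2 * al * r / (z * th) * (K\<^sup>2 * c - 6 * K * (k * th) + (k * th)\<^sup>2 * ci)"
    and j: "r * jj1 + kap / t0 * (jgth / th) = - (nj / (t0 * th))"
    and mass: "r1 + r * dv = 0"
    and v: "r * vv1 - divT = r * fv"
    and c: "c1 = 2 * lc - 4 * K / z * c + 3 * (4 * k * th / z)"
    and y: "y1 = 4 / z * y * (2 * k * th * ci - 6 * K)"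
    and K: "K = Ka + Kb * th"
    and LT: "LT = - (p * dv) + al * r * (K * lc - k * th * dv)"
    and E: "E1 = vv1 + (p / r\<^sup>2 * r1 + th * (eta1 + al / 2 * (Kb * c1 - k * (- 2 * (r1 / r) + y1 / (2 * y)))))
        + t0 / kap * jj1 + al / 2 * Ka * c1 + e * YY1"
  shows "r * E1 + (divj - LT - divT) = r * fv + e * (r * YY1)"
proof -
  define Q where "Q = K\<^sup>2 * c - 6 * K * (k * th) + (k * th)\<^sup>2 * ci"
  have A: "th * (r * eta1) = nj / (kap * th) + 2 * al * r / z * Q - divj + jgth / th"
  proof -
    have "r * eta1 = nj / (kap * th\<^sup>2) + 2 * al * r / (z * th) * Q - (divj / th - jgth / th\<^sup>2)"
      using eta by (simp add: Q_def)
    then have "th * (r * eta1) = th * (nj / (kap * th\<^sup>2)) + th * (2 * al * r / (z * th)) * Q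
        - (th * (divj / th) - th * (jgth / th\<^sup>2))"
      by (simp add: right_diff_distrib distrib_left mult.assoc)
    moreover have m: "th * (nj / (kap * th\<^sup>2)) = nj / (kap * th)" "th * (2 * al * r / (z * th)) = 2 * al * r / z"
        "th * (divj / th) = divj" "th * (jgth / th\<^sup>2) = jgth / th"
      using pos by (simp_all add: power2_eq_square)
    ultimately show ?thesis unfolding m by simp
  qed
  have B: "t0 / kap * (r * jj1) = - (jgth / th) - nj / (kap * th)"
  proof -
    have "r * jj1 = - (nj / (t0 * th)) - kap / t0 * (jgth / th)" using j by linarith
    then show ?thesis using pos by (simp add: field_simps)
  qed
  have r1: "r1 = - (r * dv)" using mass by linarith
  have C: "r * (p / r\<^sup>2 * r1) = - (p * dv)" using pos by (simp add: r1 power2_eq_square)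
  have D: "r1 / r = - dv" using pos by (simp add: r1)
  have Y: "y1 / (2 * y) = 2 / z * (2 * k * th * ci - 6 * K)"
  proof -
    have "4 / z * y * X / (2 * y) = 2 / z * X" for X using pos by simp
    then show ?thesis unfolding y .
  qed
  \<comment> \<open>Products with one common factor \<open>1/z\<close> make the remaining identity polynomial.\<close>
  define iz where "iz = 1 / z"
  have Z: "x / z = x * iz" for x by (simp add: iz_def)
  have "r * E1 = r * vv1 + r * (p / r\<^sup>2 * r1) + th * (r * eta1) + t0 / kap * (r * jj1) + e * (r * YY1)
     + al / 2 * r * K * c1 + al * r * th * k * (r1 / r) - al / 2 * r * th * k * (y1 / (2 * y))"
    unfolding E K by (simp add: algebra_simps)
  also have "\<dots> = r * vv1 - p * dv + (2 * al * r / z * Q - divj) + e * (r * YY1)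
     + al / 2 * r * K * c1 - al * r * th * k * dv - al * r * th * k / z * (2 * k * th * ci - 6 * K)"
    unfolding A B C D Y by (simp add: algebra_simps)
  also have "\<dots> = r * vv1 + LT - divj + e * (r * YY1)"
    unfolding LT c Q_def Z by (simp add: algebra_simps power2_eq_square)
  finally show ?thesis using v by (simp add: algebra_simps)
qed

lemma e_s_has_derivative:
  assumes M: "cV M > 0" "rho_ref M > 0" "covol M > 0" and r: "0 < R p" "R p < 1 / covol M"
    and R: "(R has_derivative R') (at p within D)" and \<sigma>: "(\<sigma> has_derivative \<sigma>') (at p within D)"
  shows "((\<lambda>q. e_s M (R q) (\<sigma> q)) has_derivative (\<lambda>d.
     (heat_factor_deriv M (R p) * exp (\<sigma> p / cV M) - pinf M / (R p)\<^sup>2) * R' d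
     + heat_factor M (R p) * exp (\<sigma> p / cV M) / cV M * \<sigma>' d)) (at p within D)"
proof -
  have h: "((\<lambda>q. heat_factor M (R q)) has_derivative (\<lambda>d. R' d * heat_factor_deriv M (R p))) (at p within D)"
    by (rule DERIV_compose_FDERIV[OF heat_factor_has_derivative R]) (use M r in auto)
  have e: "((\<lambda>q. exp (\<sigma> q / cV M)) has_derivative (\<lambda>d. \<sigma>' d * (exp (\<sigma> p / cV M) / cV M))) (at p within D)"
    by (rule DERIV_compose_FDERIV[where f = "\<lambda>s. exp (s / cV M)", OF _ \<sigma>])
      (use M in \<open>auto intro!: derivative_eq_intros\<close>)
  have i: "((\<lambda>q. (1 / R q - covol M) * pinf M + qref M) has_derivative (\<lambda>d. R' d * (- (pinf M / (R p)\<^sup>2)))) (at p within D)"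
    by (rule DERIV_compose_FDERIV[where f = "\<lambda>s. (1 / s - covol M) * pinf M + qref M", OF _ R])
      (use r in \<open>auto intro!: derivative_eq_intros simp: power2_eq_square\<close>)
  from has_derivative_add[OF has_derivative_mult[OF h e] i] show ?thesis
    unfolding e_s_eq by (rule has_derivative_eq_rhs) (simp add: algebra_simps)
qed

lemma system_source_eq:
  "system_source M zeta force u = (0,
      entropy_production M zeta (density u) (specific_entropy u) (energy_flux u) (deformation_gradient u) (Y_of u) (y_of u),
      - (energy_flux u /\<^sub>R (tau0 M * temperature_of M u)),
      density u *\<^sub>R force u,
      0,
      density u *\<^sub>R relaxation_Y M zeta (temperature_of M u) (deformation_gradient u) (Y_of u),
      density u * relaxation_y M zeta (temperature_of M u) (deformation_gradient u) (Y_of u) (y_of u))"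
  by (simp add: system_source_def primitive_eq Let_def temperature_of_def)

definition outer :: "vec3 \<Rightarrow> vec3 \<Rightarrow> mat3" where
  "outer x w = (\<chi> i a. x $ i * w $ a)"

lemma bounded_bilinear_outer: "bounded_bilinear outer"
  unfolding bilinear_conv_bounded_bilinear[symmetric] bilinear_def outer_def
  by (auto intro!: linearI simp: vec_eq_iff algebra_simps)

text \<open>The form in which the component \<open>\<pi>\<close> of the system is used: if it carries \<open>\<rho> a\<close> with flux
  \<open>\<rho> a v + b\<close>, its balance law says that \<open>\<rho>\<close> times the material derivative of \<open>a\<close>, plus the divergence of
  \<open>b\<close>, is the source.\<close>

lemma material_form:
  fixes a :: "spacetime \<Rightarrow> 'b::real_normed_vector"
  assumes sol: "smooth_solution \<Omega> flux src D u" and p: "p \<in> D"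
    and u: "(u has_derivative u') (at p within D)"
    and f: "\<And>k. ((\<lambda>q. flux k (u q)) has_derivative f' k) (at p within D)"
    and R: "(R has_derivative R') (at p within D)"
    and v: "(v has_derivative v') (at p within D)"
    and mass: "R' (1, v p) + R p * (\<Sum>k\<in>UNIV. v' (0, axis k 1) $ k) = (0 :: real)"
    and \<pi>: "bounded_linear \<pi>"
    and a: "(a has_derivative a') (at p within D)"
    and b: "\<And>k. (b k has_derivative b' k) (at p within D)"
    and ua: "\<And>q. q \<in> D \<Longrightarrow> \<pi> (u q) = R q *\<^sub>R a q"
    and fa: "\<And>k q. q \<in> D \<Longrightarrow> \<pi> (flux k (u q)) = (R q * v q $ k) *\<^sub>R a q + b k q"
  shows "R p *\<^sub>R a' (1, v p) + (\<Sum>k\<in>UNIV. b' k (0, axis k 1)) = \<pi> (src (u p))"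
proof -
  have D: "openin (top_of_set space_time) D" using sol by (simp add: smooth_solution_def)
  have t: "dt (\<lambda>q. \<pi> (u q)) p = dt (\<lambda>q. R q *\<^sub>R a q) p"
    by (rule dt_cong[OF D p has_derivative_scaleR[OF R a] ua])
  have x: "dx k (\<lambda>q. \<pi> (flux k (u q))) p = dx k (\<lambda>q. (R q * v q $ k) *\<^sub>R a q + b k q) p" for k
    by (rule dx_cong[OF D p has_derivative_add[OF has_derivative_scaleR[OF has_derivative_mult[OF R
          bounded_linear.has_derivative[OF bounded_linear_vec_nth v]] a] b] fa])
  show ?thesis
    using solution_component[OF sol p \<pi> u f] transport_with_flux[OF D p R v a b mass]
    unfolding t x by simp
qed

definition energy_transport :: "material \<Rightarrow> 3 \<Rightarrow> state \<Rightarrow> real" where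
  "energy_transport M k u = (density u * velocity u $ k) * E_tilde M (primitive u)
     + (energy_flux u $ k - velocity u \<bullet> column k (stress_of M u))"

definition energy_source :: "material \<Rightarrow> (real \<Rightarrow> real) \<Rightarrow> (state \<Rightarrow> vec3) \<Rightarrow> state \<Rightarrow> real" where
  "energy_source M zeta force u = density u * (velocity u \<bullet> force u)
     + eref M * (density u * (Y_of u \<bullet> relaxation_Y M zeta (temperature_of M u) (deformation_gradient u) (Y_of u)))"

lemma trace_C_has_derivative:
  assumes F: "(F has_derivative F') (at p within D)" and Y: "(Y has_derivative Y') (at p within D)"
    and spd: "\<And>q. q \<in> D \<Longrightarrow> spd (Y q)" and p: "p \<in> D"
  shows "((\<lambda>q. trace (C_mat (F q) (Y q))) has_derivative (\<lambda>d.
      trace (F' d ** inv_sqrt_mat (Y p) ** transpose (F p)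
        + F p ** (- (inv_sqrt_mat (Y p) ** sylvester (sqrt_mat (Y p)) (sym_part (Y' d)) ** inv_sqrt_mat (Y p))) ** transpose (F p)
        + F p ** inv_sqrt_mat (Y p) ** transpose (F' d)))) (at p within D)"
proof -
  have "Y ` D \<subseteq> {Y. spd Y}" using spd by auto
  from has_derivative_in_compose[OF Y has_derivative_subset[OF inv_sqrt_mat_has_derivative[OF spd[OF p]] this]]
  have Z: "((\<lambda>q. inv_sqrt_mat (Y q)) has_derivative
      (\<lambda>d. - (inv_sqrt_mat (Y p) ** sylvester (sqrt_mat (Y p)) (sym_part (Y' d)) ** inv_sqrt_mat (Y p)))) (at p within D)" .
  show ?thesis
    unfolding C_mat_def
    by (rule has_derivative_eq_rhs[OF bounded_linear.has_derivative[OF bounded_linear_trace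
          mat_mult.FDERIV[OF mat_mult.FDERIV[OF F Z] bounded_linear.has_derivative[OF bounded_linear_transpose F]]]])
      (simp add: mat_mult.add_left add_ac)
qed

lemma eta_hat_has_derivative:
  assumes \<rho>R: "rhoR M > 0" and pos: "\<And>q. q \<in> D \<Longrightarrow> 0 < R q" "\<And>q. q \<in> D \<Longrightarrow> 0 < y q" and p: "p \<in> D"
    and R: "(R has_derivative R') (at p within D)" and \<eta>: "(\<eta> has_derivative \<eta>') (at p within D)"
    and y: "(y has_derivative y') (at p within D)"
    and c: "((\<lambda>q. trace (C_mat (F q) (Y q))) has_derivative c') (at p within D)"
  shows "((\<lambda>q. eta_hat M (R q) (\<eta> q) (F q) (Y q) (y q)) has_derivative (\<lambda>d. \<eta>' d + alpha M / 2 *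
      (K1 M * c' d - kB M * (- 2 * (R' d / R p) + y' d / (2 * y p))))) (at p within D)"
proof -
  have lnR: "((\<lambda>q. ln (R q)) has_derivative (\<lambda>d. R' d * (1 / R p))) (at p within D)"
    by (rule DERIV_compose_FDERIV[OF _ R]) (use pos p in \<open>auto intro!: derivative_eq_intros\<close>)
  have lny: "((\<lambda>q. ln (y q)) has_derivative (\<lambda>d. y' d * (1 / y p))) (at p within D)"
    by (rule DERIV_compose_FDERIV[OF _ y]) (use pos p in \<open>auto intro!: derivative_eq_intros\<close>)
  have eq: "eta_hat M (R q) (\<eta> q) (F q) (Y q) (y q) = \<eta> q + alpha M / 2 * (K1 M * trace (C_mat (F q) (Y q))
      - kB M * (2 * ln (rhoR M) - 2 * ln (R q) + 1 / 2 * ln (y q)))" if "q \<in> D" for q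
    using pos[OF that] \<rho>R by (simp add: eta_hat_def ln_mult ln_div ln_realpow ln_powr)
  have "((\<lambda>q. \<eta> q + alpha M / 2 * (K1 M * trace (C_mat (F q) (Y q))
      - kB M * (2 * ln (rhoR M) - 2 * ln (R q) + 1 / 2 * ln (y q)))) has_derivative (\<lambda>d. \<eta>' d + alpha M / 2 *
      (K1 M * c' d - kB M * (0 - 2 * (R' d * (1 / R p)) + 1 / 2 * (y' d * (1 / y p)))))) (at p within D)"
    by (intro has_derivative_add has_derivative_diff has_derivative_mult_right has_derivative_const \<eta> c lnR lny)
  then have "((\<lambda>q. eta_hat M (R q) (\<eta> q) (F q) (Y q) (y q)) has_derivative (\<lambda>d. \<eta>' d + alpha M / 2 *
      (K1 M * c' d - kB M * (0 - 2 * (R' d * (1 / R p)) + 1 / 2 * (y' d * (1 / y p)))))) (at p within D)"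
    by (rule has_derivative_transform[rotated 2]) (rule p, rule eq)
  then show ?thesis by (rule has_derivative_eq_rhs) simp
qed

text \<open>Each component of the system is brought to material form, and the material derivative of \<open>E\<close> is
  computed by the chain rule from the derivatives of the equation of state and of \<open>tr C\<close>. The summands then
  combine by \<open>energy_identity\<close>.\<close>

lemma energy_balance:
  fixes M :: material
  assumes M: "cV M > 0" "theta_ref M > 0" "rho_ref M > 0" "covol M > 0" "tau0 M > 0" "kappa M > 0" "rhoR M > 0"
    and zeta: "\<And>\<theta>. \<theta> > 0 \<Longrightarrow> zeta \<theta> > 0"
    and sol: "smooth_solution (states M) (system_flux M) (system_source M zeta force) D u"
    and side: "standing_assumptions M D u" and p: "p \<in> D"
  shows "dt (\<lambda>q. rho_E M (u q)) p + (\<Sum>k\<in>UNIV. dx k (\<lambda>q. energy_transport M k (u q)) p)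
    = energy_source M zeta force (u p)"
proof -
  have D: "openin (top_of_set space_time) D" and sm: "smooth_on D u"
    and st: "\<And>q. q \<in> D \<Longrightarrow> u q \<in> states M"
    using sol by (auto simp: smooth_solution_def)
  have ex: "\<exists>f'. ((\<lambda>q. f (u q)) has_derivative f') (at p within D)"
    if "smooth_on (states M) f" for f :: "state \<Rightarrow> 'b::real_normed_vector"
    by (rule smooth_on_imp_has_derivative[OF smooth_on_compose[OF that sm st] p]) blast+
  define R where "R q = density (u q)" for q
  define \<eta> where "\<eta> q = specific_entropy (u q)" for q
  define j where "j q = energy_flux (u q)" for q
  define v where "v q = velocity (u q)" for q
  define F where "F q = deformation_gradient (u q)" for q
  define Y where "Y q = Y_of (u q)" for q
  define y where "y q = y_of (u q)" for q
  define \<theta> where "\<theta> q = temperature_of M (u q)" for q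
  define T where "T q = stress_of M (u q)" for q
  define e where "e k = (0 :: real, axis k 1 :: vec3)" for k
  note q_defs = R_def \<eta>_def j_def v_def F_def Y_def y_def \<theta>_def T_def
  have stD: "0 < R q" "R q < 1 / covol M" "invertible (F q)" "spd (Y q)" "0 < y q" "0 < \<theta> q" if "q \<in> D" for q
    using statesD[OF st[OF that]] temperature_of_pos[OF M st[OF that]] by (simp_all add: q_defs)
  obtain u' where u': "(u has_derivative u') (at p within D)"
    by (rule smooth_on_imp_has_derivative[OF sm p])
  obtain R' where R': "(R has_derivative R') (at p within D)"
    using ex[OF smooth_density] unfolding R_def[abs_def] by blast
  obtain \<eta>' where \<eta>': "(\<eta> has_derivative \<eta>') (at p within D)"
    using ex[OF smooth_fields(1)] unfolding \<eta>_def[abs_def] by blast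
  obtain j' where j': "(j has_derivative j') (at p within D)"
    using ex[OF smooth_fields(2)] unfolding j_def[abs_def] by blast
  obtain v' where v': "(v has_derivative v') (at p within D)"
    using ex[OF smooth_fields(3)] unfolding v_def[abs_def] by blast
  obtain F' where F': "(F has_derivative F') (at p within D)"
    using ex[OF smooth_fields(4)] unfolding F_def[abs_def] by blast
  obtain Y' where Y': "(Y has_derivative Y') (at p within D)"
    using ex[OF smooth_fields(5)] unfolding Y_def[abs_def] by blast
  obtain y' where y': "(y has_derivative y') (at p within D)"
    using ex[OF smooth_fields(6)] unfolding y_def[abs_def] by blast
  obtain \<theta>' where \<theta>': "(\<theta> has_derivative \<theta>') (at p within D)"
    using ex[OF smooth_temperature[OF M]] unfolding \<theta>_def[abs_def] by blast
  have "\<forall>k. \<exists>T'. ((\<lambda>q. column k (T q)) has_derivative T') (at p within D)"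
    using ex[OF smooth_column_stress[OF M]] unfolding T_def[abs_def] by blast
  then obtain T' where T': "\<And>k. ((\<lambda>q. column k (T q)) has_derivative T' k) (at p within D)" by metis
  have "\<forall>k. \<exists>f'. ((\<lambda>q. system_flux M k (u q)) has_derivative f') (at p within D)"
    using ex[OF smooth_flux[OF M]] by blast
  then obtain f' where f': "\<And>k. ((\<lambda>q. system_flux M k (u q)) has_derivative f' k) (at p within D)" by metis

  define dv where "dv = (\<Sum>k\<in>UNIV. v' (e k) $ k)"
  have mass: "R' (1, v p) + R p * (\<Sum>k\<in>UNIV. v' (0, axis k 1) $ k) = 0"
  proof -
    have "dt (\<lambda>q. fst (u q)) p + (\<Sum>k\<in>UNIV. dx k (\<lambda>q. fst (system_flux M k (u q))) p)
        = fst (system_source M zeta force (u p))"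
      by (rule solution_component[OF sol p bounded_linear_fst u' f'])
    then have "dt R p + (\<Sum>k\<in>UNIV. dx k (\<lambda>q. R q * v q $ k) p) = 0"
      by (simp add: system_flux_eq system_source_eq R_def[abs_def] v_def[abs_def] density_eq)
    moreover have "dx k (\<lambda>q. R q * v q $ k) p = R p * v' (0, axis k 1) $ k + R' (0, axis k 1) * v p $ k" for k
      by (rule dx_eq[OF D p has_derivative_mult[OF R' bounded_linear.has_derivative[OF bounded_linear_vec_nth v']]])
    ultimately show ?thesis
      unfolding dt_eq[OF D p R'] material_derivative[OF has_derivative_linear[OF R'], of "v p"]
      by (simp add: sum.distrib sum_distrib_left mult.commute add_ac)
  qed
  note mf = material_form[OF sol p u' f' R' v' mass]

  have eq_entropy: "R p *\<^sub>R \<eta>' (1, v p) + (\<Sum>k\<in>UNIV. (j' (e k) $ k * \<theta> p - j p $ k * \<theta>' (e k)) / (\<theta> p * \<theta> p))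
      = entropy_production M zeta (R p) (\<eta> p) (j p) (F p) (Y p) (y p)"
  proof -
    have b: "((\<lambda>q. j q $ k / \<theta> q) has_derivative (\<lambda>d. (j' d $ k * \<theta> p - j p $ k * \<theta>' d) / (\<theta> p * \<theta> p))) (at p within D)" for k
      using stD(6)[OF p]
      by (intro has_derivative_divide' bounded_linear.has_derivative[OF bounded_linear_vec_nth j'] \<theta>') simp
    have bl: "bounded_linear (\<lambda>u :: state. fst (snd u))"
      by (intro bounded_linear_compose[OF bounded_linear_fst] bounded_linear_snd)
    show ?thesis
      unfolding e_def
      by (rule trans[OF mf[OF bl \<eta>' b]])
        (simp_all add: system_flux_eq system_source_eq q_defs density_times(1)[OF st] mult_ac)
  qed

  have eq_j: "R p *\<^sub>R j' (1, v p) + (\<Sum>k\<in>UNIV. (kappa M * (\<theta>' (e k) * (1 / \<theta> p)) / tau0 M) *\<^sub>R axis k 1)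
      = - (j p /\<^sub>R (tau0 M * \<theta> p))"
  proof -
    have l: "((\<lambda>q. ln (\<theta> q)) has_derivative (\<lambda>d. \<theta>' d * (1 / \<theta> p))) (at p within D)"
      by (rule DERIV_compose_FDERIV[OF _ \<theta>']) (use stD(6)[OF p] in \<open>auto intro!: derivative_eq_intros\<close>)
    have b: "((\<lambda>q. (kappa M * ln (\<theta> q) / tau0 M) *\<^sub>R axis k (1::real)) has_derivative
        (\<lambda>d. (kappa M * (\<theta>' d * (1 / \<theta> p)) / tau0 M) *\<^sub>R (axis k 1 :: vec3))) (at p within D)" for k
      unfolding times_divide_eq_left[symmetric] divide_inverse
      by (intro has_derivative_scaleR_left has_derivative_mult_left has_derivative_mult_right l[unfolded divide_inverse])
    have bl: "bounded_linear (\<lambda>u :: state. fst (snd (snd u)))"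
      by (intro bounded_linear_compose[OF bounded_linear_fst] bounded_linear_compose[OF bounded_linear_snd] bounded_linear_snd)
    show ?thesis
      unfolding e_def
      by (rule trans[OF mf[OF bl j' b]])
        (simp_all add: system_flux_eq system_source_eq q_defs density_times(2)[OF st])
  qed

  have eq_v: "R p *\<^sub>R v' (1, v p) + (\<Sum>k\<in>UNIV. - T' k (e k)) = R p *\<^sub>R force (u p)"
  proof -
    have bl: "bounded_linear (\<lambda>u :: state. fst (snd (snd (snd u))))"
      by (intro bounded_linear_compose[OF bounded_linear_fst] bounded_linear_compose[OF bounded_linear_snd] bounded_linear_snd)
    show ?thesis
      unfolding e_def
      by (rule trans[OF mf[OF bl v' has_derivative_minus[OF T']]])
        (simp_all add: system_flux_eq system_source_eq q_defs density_times(3)[OF st])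
  qed

  have eq_Y: "Y' (1, v p) = relaxation_Y M zeta (\<theta> p) (F p) (Y p)"
  proof -
    have bl: "bounded_linear (\<lambda>u :: state. fst (snd (snd (snd (snd (snd u))))))"
      by (intro bounded_linear_compose[OF bounded_linear_fst] bounded_linear_compose[OF bounded_linear_snd] bounded_linear_snd)
    have "R p *\<^sub>R Y' (1, v p) + (\<Sum>k\<in>(UNIV :: 3 set). 0) = R p *\<^sub>R relaxation_Y M zeta (\<theta> p) (F p) (Y p)"
      by (rule trans[OF mf[OF bl Y' has_derivative_const[of 0]]])
        (simp_all add: system_flux_eq system_source_eq q_defs density_times(5)[OF st])
    then show ?thesis using stD(1)[OF p] by simp
  qed

  have eq_y: "y' (1, v p) = relaxation_y M zeta (\<theta> p) (F p) (Y p) (y p)"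
  proof -
    have bl: "bounded_linear (\<lambda>u :: state. snd (snd (snd (snd (snd (snd u))))))"
      by (intro bounded_linear_compose[OF bounded_linear_snd] bounded_linear_snd)
    have "R p *\<^sub>R y' (1, v p) + (\<Sum>k\<in>(UNIV :: 3 set). 0) = R p * relaxation_y M zeta (\<theta> p) (F p) (Y p) (y p)"
      by (rule trans[OF mf[OF bl y' has_derivative_const[of 0]]])
        (simp_all add: system_flux_eq system_source_eq q_defs density_times(6)[OF st] mult_ac)
    then show ?thesis using stD(1)[OF p] by simp
  qed

  define L :: mat3 where "L = (\<chi> i k. v' (e k) $ i)"
  \<comment> \<open>The only place where the Piola identity and the constancy of \<open>\<rho> det F\<close> enter.\<close>
  have eq_F: "F' (1, v p) = L ** F p"
  proof -
    define w where "w k q = R q *\<^sub>R F q $ k" for k q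
    define w' where "w' k d = R p *\<^sub>R F' d $ k + R' d *\<^sub>R F p $ k" for k d
    have w: "(w k has_derivative w' k) (at p within D)" for k
      unfolding w_def[abs_def] w'_def[abs_def]
      by (rule has_derivative_scaleR[OF R' bounded_linear.has_derivative[OF bounded_linear_vec_nth F']])
    \<comment> \<open>As \<open>\<rho> F\<close> equals \<open>\<rho>\<^sub>R F / det F\<close>, the Piola identity says that its columns are
      divergence free.\<close>
    have piola: "(\<Sum>k\<in>UNIV. w' k (e k)) = 0"
    proof -
      have "(\<Sum>k\<in>UNIV. w' k (e k) $ a) = 0" for a
      proof -
        have "dx k (\<lambda>q. F q $ k $ a / det (F q)) p = w' k (e k) $ a / rhoR M" for k
        proof -
          have wa: "((\<lambda>q. w k q $ a / rhoR M) has_derivative (\<lambda>d. w' k d $ a / rhoR M)) (at p within D)"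
            unfolding divide_inverse
            by (intro has_derivative_mult_left bounded_linear.has_derivative[OF bounded_linear_vec_nth w])
          have "F q $ k $ a / det (F q) = w k q $ a / rhoR M" if "q \<in> D" for q
          proof -
            have "R q * det (F q) = rhoR M" using side that by (simp add: standing_assumptions_def q_defs)
            then show ?thesis using stD(1)[OF that] M by (auto simp: w_def simp flip: \<open>R q * det (F q) = rhoR M\<close>)
          qed
          from dx_cong[OF D p wa this] show ?thesis unfolding dx_eq[OF D p wa] e_def .
        qed
        moreover have "(\<Sum>k\<in>UNIV. dx k (\<lambda>q. F q $ k $ a / det (F q)) p) = 0"
          using side p by (simp add: standing_assumptions_def q_defs)
        ultimately have "(\<Sum>k\<in>UNIV. w' k (e k) $ a) / rhoR M = 0" by (simp add: sum_divide_distrib)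
        then show ?thesis using M by simp
      qed
      then show ?thesis by (simp add: vec_eq_iff)
    qed
    have b: "((\<lambda>q. - outer (v q) (w k q)) has_derivative (\<lambda>d. - (outer (v p) (w' k d) + outer (v' d) (w k p)))) (at p within D)" for k
      by (intro has_derivative_minus bounded_bilinear.FDERIV[OF bounded_bilinear_outer] v' w)
    have bl: "bounded_linear (\<lambda>u :: state. fst (snd (snd (snd (snd u)))))"
      by (intro bounded_linear_compose[OF bounded_linear_fst] bounded_linear_compose[OF bounded_linear_snd] bounded_linear_snd)
    have "R p *\<^sub>R F' (1, v p) + (\<Sum>k\<in>UNIV. - (outer (v p) (w' k (e k)) + outer (v' (e k)) (w k p))) = 0"
      unfolding e_def
      by (rule trans[OF mf[OF bl F' b]])
        (simp_all add: system_flux_eq system_source_eq q_defs density_times(4)[OF st] w_def outer_def vec_eq_iff algebra_simps)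
    moreover have "(\<Sum>k\<in>UNIV. outer (v p) (w' k (e k))) = 0"
      unfolding bounded_bilinear.sum_right[OF bounded_bilinear_outer, symmetric] piola
      by (rule bounded_bilinear.zero_right[OF bounded_bilinear_outer])
    moreover have "(\<Sum>k\<in>UNIV. outer (v' (e k)) (w k p)) = R p *\<^sub>R (L ** F p)"
      by (simp add: vec_eq_iff outer_def w_def L_def matrix_matrix_mult_def sum_distrib_left mult_ac)
    ultimately have "R p *\<^sub>R F' (1, v p) = R p *\<^sub>R (L ** F p)"
      by (simp add: sum_negf sum_subtractf)
    then show ?thesis using stD(1)[OF p] by simp
  qed

  define c' where "c' d = trace (F' d ** inv_sqrt_mat (Y p) ** transpose (F p)
        + F p ** (- (inv_sqrt_mat (Y p) ** sylvester (sqrt_mat (Y p)) (sym_part (Y' d)) ** inv_sqrt_mat (Y p))) ** transpose (F p)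
        + F p ** inv_sqrt_mat (Y p) ** transpose (F' d))" for d
  have c': "((\<lambda>q. trace (C_mat (F q) (Y q))) has_derivative c') (at p within D)"
    unfolding c'_def[abs_def] by (rule trace_C_has_derivative[OF F' Y' stD(4) p])
  define \<sigma> where "\<sigma> q = eta_hat M (R q) (\<eta> q) (F q) (Y q) (y q)" for q
  define \<sigma>' where "\<sigma>' d = \<eta>' d + alpha M / 2 *
      (K1 M * c' d - kB M * (- 2 * (R' d / R p) + y' d / (2 * y p)))" for d
  have \<sigma>': "(\<sigma> has_derivative \<sigma>') (at p within D)"
    unfolding \<sigma>_def[abs_def] \<sigma>'_def[abs_def]
    by (rule eta_hat_has_derivative[OF M(7) stD(1) stD(5) p R' \<eta>' y' c'])
  define pr where "pr = pressure M (R p) (\<eta> p) (F p) (Y p) (y p)"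
  have th: "\<theta> p = heat_factor M (R p) * exp (\<sigma> p / cV M) / cV M"
    by (simp add: \<sigma>_def \<theta>_def temperature_of_def temperature_eq[OF M(1)] q_defs)
  have pr: "pr / (R p)\<^sup>2 = heat_factor_deriv M (R p) * exp (\<sigma> p / cV M) - pinf M / (R p)\<^sup>2"
    unfolding pr_def \<sigma>_def using stD[OF p] M by (subst pressure_eq) auto
  define E where "E q = E_tilde M (primitive (u q))" for q
  define E' where "E' d = v p \<bullet> v' d + (pr / (R p)\<^sup>2 * R' d + \<theta> p * \<sigma>' d) + tau0 M / kappa M * (j p \<bullet> j' d)
      + alpha M / 2 * K0 M * c' d + eref M * (Y p \<bullet> Y' d)" for d
  have E': "(E has_derivative E') (at p within D)"
  proof -
    have E: "E = (\<lambda>q. 1 / 2 * (v q \<bullet> v q) + e_s M (R q) (\<sigma> q) + tau0 M / (2 * kappa M) * (j q \<bullet> j q)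
        + alpha M / 2 * K0 M * trace (C_mat (F q) (Y q)) + eref M / 2 * (Y q \<bullet> Y q))"
      by (simp add: fun_eq_iff E_def E_tilde_def primitive_eq e_s_tilde_def power2_norm_eq_inner \<sigma>_def q_defs)
    have es: "((\<lambda>q. e_s M (R q) (\<sigma> q)) has_derivative (\<lambda>d. pr / (R p)\<^sup>2 * R' d + \<theta> p * \<sigma>' d)) (at p within D)"
      unfolding pr th by (rule e_s_has_derivative) (use M stD[OF p] R' \<sigma>' in auto)
    have "(E has_derivative (\<lambda>d. 1 / 2 * (v p \<bullet> v' d + v' d \<bullet> v p) + (pr / (R p)\<^sup>2 * R' d + \<theta> p * \<sigma>' d)
        + tau0 M / (2 * kappa M) * (j p \<bullet> j' d + j' d \<bullet> j p)
        + alpha M / 2 * K0 M * c' d + eref M / 2 * (Y p \<bullet> Y' d + Y' d \<bullet> Y p))) (at p within D)"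
      unfolding E by (intro has_derivative_add has_derivative_mult_right has_derivative_inner v' j' Y' es c')
    then show ?thesis
      by (rule has_derivative_eq_rhs) (simp add: E'_def[abs_def] inner_commute)
  qed

  define W where "W = (1 :: real, v p)"
  define LT where "LT = (\<Sum>k\<in>UNIV. v' (e k) \<bullet> column k (T p))"
  define divT where "divT = (\<Sum>k\<in>UNIV. v p \<bullet> T' k (e k))"
  define divj where "divj = (\<Sum>k\<in>UNIV. j' (e k) $ k)"
  define jgth where "jgth = (\<Sum>k\<in>UNIV. j p $ k * \<theta>' (e k))"
  define lc where "lc = L \<bullet> C_mat (F p) (Y p)"
  have balance: "dt (\<lambda>q. rho_E M (u q)) p + (\<Sum>k\<in>UNIV. dx k (\<lambda>q. energy_transport M k (u q)) p)
     = R p * E' W + (divj - LT - divT)"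
  proof -
    have b: "((\<lambda>q. j q $ k - v q \<bullet> column k (T q)) has_derivative
        (\<lambda>d. j' d $ k - (v p \<bullet> T' k d + v' d \<bullet> column k (T p)))) (at p within D)" for k
      by (intro has_derivative_diff has_derivative_inner bounded_linear.has_derivative[OF bounded_linear_vec_nth j'] v' T')
    have "dt (\<lambda>q. R q *\<^sub>R E q) p + (\<Sum>k\<in>UNIV. dx k (\<lambda>q. (R q * v q $ k) *\<^sub>R E q + (j q $ k - v q \<bullet> column k (T q))) p)
       = R p *\<^sub>R E' (1, v p) + (\<Sum>k\<in>UNIV. j' (0, axis k 1) $ k - (v p \<bullet> T' k (0, axis k 1) + v' (0, axis k 1) \<bullet> column k (T p)))"
      by (rule transport_with_flux[OF D p R' v' E' b mass])
    then show ?thesis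
      by (simp add: rho_E_def energy_transport_def W_def divj_def LT_def divT_def e_def E_def q_defs
          sum_subtractf sum.distrib diff_diff_eq add.commute)
  qed

  have LTeq: "LT = - (pr * dv) + alpha M * R p * (K_of M (\<theta> p) * lc - kB M * \<theta> p * dv)"
  proof -
    have "column k L = v' (e k)" for k by (simp add: column_def L_def vec_eq_iff)
    then have "LT = L \<bullet> T p" by (simp add: LT_def inner_matrix_columns)
    moreover have "L \<bullet> mat 1 = dv"
      by (simp add: inner_matrix_eq_trace transpose_mat) (simp add: trace_def L_def dv_def)
    moreover have "T p = - (pr *\<^sub>R mat 1) + (alpha M * R p) *\<^sub>R (K_of M (\<theta> p) *\<^sub>R C_mat (F p) (Y p) - (kB M * \<theta> p) *\<^sub>R mat 1)"
      by (simp add: T_def stress_of_def cauchy_stress_def Let_def pr_def q_defs temperature_of_def)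
    ultimately show ?thesis
      by (simp add: inner_add_right inner_diff_right lc_def)
  qed

  define z where "z = zeta (\<theta> p)"
  have pos: "0 < R p" "0 < \<theta> p" "0 < z" "0 < y p" "0 < kappa M" "0 < tau0 M"
    using stD[OF p] zeta M by (auto simp: z_def)
  define ci where "ci = trace (G_mat (F p) ** sqrt_mat (Y p))"
  define c where "c = trace (C_mat (F p) (Y p))"
  have "R p * E' W + (divj - LT - divT) = R p * (v p \<bullet> force (u p)) + eref M * (R p * (Y p \<bullet> Y' W))"
  proof (rule energy_identity[OF pos, where nj = "j p \<bullet> j p" and dv = dv and ?r1.0 = "R' W" and ?eta1.0 = "\<eta>' W"
        and ?jj1.0 = "j p \<bullet> j' W" and ?vv1.0 = "v p \<bullet> v' W" and ?c1.0 = "c' W" and ?y1.0 = "y' W" and LT = LT and p = pr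
        and jgth = jgth and lc = lc and ci = ci and c = c and K = "K_of M (\<theta> p)" and al = "alpha M" and k = "kB M"
        and Ka = "K0 M" and Kb = "K1 M"])
    have s: "(\<Sum>k\<in>UNIV. (j' (e k) $ k * \<theta> p - j p $ k * \<theta>' (e k)) / (\<theta> p * \<theta> p)) = divj / \<theta> p - jgth / (\<theta> p)\<^sup>2"
      using pos by (simp add: divj_def jgth_def sum_divide_distrib sum_subtractf power2_eq_square diff_divide_distrib)
    have "temperature M (R p) (\<eta> p) (F p) (Y p) (y p) = \<theta> p" by (simp add: q_defs temperature_of_def)
    then have "entropy_production M zeta (R p) (\<eta> p) (j p) (F p) (Y p) (y p) = (j p \<bullet> j p) / (kappa M * (\<theta> p)\<^sup>2)
        + 2 * alpha M * R p / (z * \<theta> p) * ((K_of M (\<theta> p))\<^sup>2 * c - 6 * K_of M (\<theta> p) * (kB M * \<theta> p) + (kB M * \<theta> p)\<^sup>2 * ci)"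
      unfolding entropy_production_def Let_def
      by (simp add: dissipation_eq[OF stD(4)[OF p] stD(3)[OF p]] power2_norm_eq_inner[of "j p"] z_def c_def ci_def)
    then show "R p * \<eta>' W + (divj / \<theta> p - jgth / (\<theta> p)\<^sup>2) = (j p \<bullet> j p) / (kappa M * (\<theta> p)\<^sup>2)
        + 2 * alpha M * R p / (z * \<theta> p) * ((K_of M (\<theta> p))\<^sup>2 * c - 6 * K_of M (\<theta> p) * (kB M * \<theta> p) + (kB M * \<theta> p)\<^sup>2 * ci)"
      using eq_entropy unfolding s by (simp add: W_def)
    have "j p \<bullet> (R p *\<^sub>R j' (1, v p) + (\<Sum>k\<in>UNIV. (kappa M * (\<theta>' (e k) * (1 / \<theta> p)) / tau0 M) *\<^sub>R axis k 1))
        = j p \<bullet> (- (j p /\<^sub>R (tau0 M * \<theta> p)))"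
      unfolding eq_j ..
    then have "R p * (j p \<bullet> j' W) + (\<Sum>k\<in>UNIV. kappa M * (\<theta>' (e k) * (1 / \<theta> p)) / tau0 M * j p $ k)
        = - (j p \<bullet> j p / (tau0 M * \<theta> p))"
      by (simp add: inner_add_right inner_sum_right inner_axis W_def divide_inverse mult_ac)
    moreover have "(\<Sum>k\<in>UNIV. kappa M * (\<theta>' (e k) * (1 / \<theta> p)) / tau0 M * j p $ k) = kappa M / tau0 M * (jgth / \<theta> p)"
      unfolding jgth_def sum_divide_distrib sum_distrib_left by (intro sum.cong) (simp_all add: mult_ac)
    ultimately show "R p * (j p \<bullet> j' W) + kappa M / tau0 M * (jgth / \<theta> p) = - (j p \<bullet> j p / (tau0 M * \<theta> p))" by simp
    show "R' W + R p * dv = 0" using mass by (simp add: W_def dv_def e_def)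
    have "v p \<bullet> (R p *\<^sub>R v' (1, v p) + (\<Sum>k\<in>UNIV. - T' k (e k))) = v p \<bullet> (R p *\<^sub>R force (u p))"
      unfolding eq_v ..
    then show "R p * (v p \<bullet> v' W) - divT = R p * (v p \<bullet> force (u p))"
      by (simp add: inner_diff_right inner_sum_right sum_negf W_def divT_def)
    have "c' W = 2 * lc - 4 * K_of M (\<theta> p) / z * c + 3 * (4 * kB M * \<theta> p / z)"
      unfolding c'_def W_def eq_F eq_Y inv_sqrt_rate[OF stD(4)[OF p]] trace_C_rate[OF stD(4)[OF p] stD(3)[OF p]]
      by (simp add: lc_def c_def z_def)
    then show "c' W = 2 * lc - 4 * K_of M (\<theta> p) / z * c + 3 * (4 * kB M * \<theta> p / z)" .
    show "y' W = 4 / z * y p * (2 * kB M * \<theta> p * ci - 6 * K_of M (\<theta> p))"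
      unfolding W_def eq_y relaxation_y_eq[OF stD(4)[OF p]] by (simp add: z_def ci_def)
    show "K_of M (\<theta> p) = K0 M + K1 M * \<theta> p" by (simp add: K_of_def)
    show "LT = - (pr * dv) + alpha M * R p * (K_of M (\<theta> p) * lc - kB M * \<theta> p * dv)" by (rule LTeq)
    show "E' W = v p \<bullet> v' W + (pr / (R p)\<^sup>2 * R' W + \<theta> p * (\<eta>' W + alpha M / 2 * (K1 M * c' W
        - kB M * (- 2 * (R' W / R p) + y' W / (2 * y p))))) + tau0 M / kappa M * (j p \<bullet> j' W)
        + alpha M / 2 * K0 M * c' W + eref M * (Y p \<bullet> Y' W)"
      by (simp add: E'_def \<sigma>'_def)
  qed
  then show ?thesis
    unfolding balance energy_source_def using eq_Y by (simp add: W_def q_defs)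
qed

theorem theorem6:
  fixes M :: material and zeta :: "real \<Rightarrow> real" and force :: "state \<Rightarrow> real ^ 3"
  assumes "alpha M > 0" "K0 M > 0" "K1 M > 0" "kB M > 0" "tau0 M > 0" "kappa M > 0"
    and "rhoR M > 0" "eref M > 0"
    and "cV M > 0" "theta_ref M > 0" "rho_ref M > 0" "gam M > 1" "covol M > 0"
    and "smooth_on {0<..} zeta" and "\<And>\<theta>. \<theta> > 0 \<Longrightarrow> zeta \<theta> > 0"
    and "smooth_on (states M) force"
  shows "mathematical_entropy (states M) (system_flux M) (system_source M zeta force)
           (standing_assumptions M) (rho_E M)"
proof -
  note M = assms(9,10,11,13,5,6,7)
  have 1: "smooth_on (states M) (energy_transport M k)" for k
    unfolding energy_transport_def[abs_def]
    by (intro smooth_intros smooth_density smooth_fields smooth_E[OF M] smooth_column_stress[OF M])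
  have 2: "smooth_on (states M) (energy_source M zeta force)"
    unfolding energy_source_def[abs_def]
    by (intro smooth_intros smooth_density smooth_fields smooth_relaxation_Y[OF M] assms)
  have 3: "dt (\<lambda>q. rho_E M (u q)) p + (\<Sum>k\<in>UNIV. dx k (\<lambda>q. energy_transport M k (u q)) p)
      = energy_source M zeta force (u p)"
    if "smooth_solution (states M) (system_flux M) (system_source M zeta force) D u"
      "standing_assumptions M D u" "p \<in> D" for D u p
    using energy_balance[OF M assms(15) that] by simp
  show ?thesis
    unfolding mathematical_entropy_def
    using smooth_rho_E[OF M] rho_E_strictly_convex[OF assms(1-13)] 1 2 3 by blast
qed

end
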